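(* Let $\{X_t,t\in\mathbb{R}\}$ be a strongly decomposable process, with associated i.i.d. family $(T_k,\{B^k_t,t\in[0,T_k]\})$, $k\in\mathbb{Z}$. If $\mathbb{E}T_k<\infty$, then $X$ is a two-sided Brownian motion (2BM).
   Context: Standard Brownian motion starts at $0$ at time $0$. A random time is a real-valued random variable (not necessarily a stopping time). Strongly decomposable processes: for each $k\in\mathbb{Z}$ let $\{B^k_t,t\ge0\}$ be a standard Brownian motion with respect to some normal filtration $\{\mathcal{F}^k_t,t\ge0\}$ and let $T_k$ be a stopping time with respect to $\mathcal{F}^k$. Assume that $(T_k,\{B^k_t,t\in[0,T_k]\})$, $k\in\mathbb{Z}$, are i.i.d. and that a.s. $0\le T_k<\infty$ for all $k$, $\sum_{k=1}^\infty T_k=\infty$ and $\sum_{k=-\infty}^{-1}T_k=\infty$. Let $S_0=0$ and let $S_k$, $k\in\mathbb{Z}$, be determined by $S_{k+1}-S_k=T_k$. Let $X$ be the unique continuous process with $X_0=0$ and $X_{S_k+t}-X_{S_k}=B^k_t$ for $t\in[0,T_k)$, $k\in\mathbb{Z}$. A process $X'$ is called strongly decomposable (with associated family $(T_k,\{B^k_t,t\in[0,T_k]\})$, $k\in\mathbb{Z}$) if for some random time $U$ the process $\{X'_{U+t}-X'_U,t\in\mathbb{R}\}$ can be represented as such an $X$. Two-sided Brownian motion (2BM): a process $\{X_t,t\in\mathbb{R}\}$ for which there exists a random time $S$ such that $\{X_{S+t}-X_S,t\ge0\}$ and $\{X_{S-t}-X_S,t\ge0\}$ are independent standard Brownian motions.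 *)

theory Defs
  imports "HOL-Probability.Probability"
begin

definition standard_brownian_motion :: "'a measure \<Rightarrow> (real \<Rightarrow> 'a \<Rightarrow> real) \<Rightarrow> bool" where
  "standard_brownian_motion M B \<longleftrightarrow>
     prob_space M \<and>
     (\<forall>t\<ge>0. B t \<in> borel_measurable M) \<and>
     (AE \<omega> in M. B 0 \<omega> = 0) \<and>
     (AE \<omega> in M. continuous_on {0..} (\<lambda>t. B t \<omega>)) \<and>
     (\<forall>s t. 0 \<le> s \<longrightarrow> s < t \<longrightarrow>
        distributed M lborel (\<lambda>\<omega>. B t \<omega> - B s \<omega>) (normal_density 0 (sqrt (t - s)))) \<and>
     (\<forall>(t :: nat \<Rightarrow> real) n. 0 \<le> t 0 \<longrightarrow> strict_mono t \<longrightarrow>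
        prob_space.indep_vars M (\<lambda>_. borel) (\<lambda>i \<omega>. B (t (Suc i)) \<omega> - B (t i) \<omega>) {..<n})"

text \<open>
  Filtrations are indexed by \<open>[0, \<infinity>]\<close>, so that the library's notion \<^const>\<open>stopping_time\<close>
  applies to times with values in \<open>[0, \<infinity>]\<close>. The member at \<open>\<infinity>\<close> may be any sub-\<open>\<sigma>\<close>-algebra
  containing all the others and plays no role.
\<close>

definition normal_filtration :: "'a measure \<Rightarrow> (ennreal \<Rightarrow> 'a measure) \<Rightarrow> bool" where
  "normal_filtration M F \<longleftrightarrow>
     complete_measure M \<and>
     filtration (space M) F \<and>
     (\<forall>t. sets (F t) \<subseteq> sets M) \<and>
     null_sets M \<subseteq> sets (F 0) \<and>
     (\<forall>t<\<infinity>. sets (F t) = (\<Inter>s\<in>{t<..}. sets (F s)))"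

definition brownian_motion_wrt ::
  "'a measure \<Rightarrow> (ennreal \<Rightarrow> 'a measure) \<Rightarrow> (real \<Rightarrow> 'a \<Rightarrow> real) \<Rightarrow> bool" where
  "brownian_motion_wrt M F B \<longleftrightarrow>
     standard_brownian_motion M B \<and>
     (\<forall>t\<ge>0. B t \<in> borel_measurable (F (ennreal t))) \<and>
     (\<forall>s t. 0 \<le> s \<longrightarrow> s < t \<longrightarrow>
        prob_space.indep_set M (sets (F (ennreal s)))
          (sets (vimage_algebra (space M) (\<lambda>\<omega>. B t \<omega> - B s \<omega>) borel)))"

text \<open>
  The random element \<open>(T, {B\<^sub>t, t \<in> [0, T]})\<close>. A path with random lifetime \<open>T\<close> is encoded,
  without loss or gain of information, by \<open>T\<close> together with the path stopped at \<open>T\<close>,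
  a random element of \<open>[0, \<infinity>] \<times> \<real>\<^bsup>[0, \<infinity>)\<^esup>\<close> with the product \<open>\<sigma>\<close>-algebra.
\<close>

abbreviation lifetime_path_space :: "(ennreal \<times> (real \<Rightarrow> real)) measure" where
  "lifetime_path_space \<equiv> borel \<Otimes>\<^sub>M (\<Pi>\<^sub>M t\<in>{0..}. borel)"

definition lifetime_path ::
  "('a \<Rightarrow> ennreal) \<Rightarrow> (real \<Rightarrow> 'a \<Rightarrow> real) \<Rightarrow> 'a \<Rightarrow> ennreal \<times> (real \<Rightarrow> real)" where
  "lifetime_path T B \<omega> = (T \<omega>, \<lambda>t\<in>{0..}. B (enn2real (min (ennreal t) (T \<omega>))) \<omega>)"

text \<open>The times \<open>S\<^sub>k\<close> with \<open>S\<^sub>0 = 0\<close> and \<open>S\<^sub>k\<^sub>+\<^sub>1 - S\<^sub>k = T\<^sub>k\<close>, where all \<open>T\<^sub>k\<close> are finite.\<close>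

definition epoch :: "(int \<Rightarrow> 'a \<Rightarrow> ennreal) \<Rightarrow> int \<Rightarrow> 'a \<Rightarrow> real" where
  "epoch T k \<omega> =
     (if 0 \<le> k then (\<Sum>i\<in>{0..<k}. enn2real (T i \<omega>)) else - (\<Sum>i\<in>{k..<0}. enn2real (T i \<omega>)))"

lemma epoch_0: "epoch T 0 \<omega> = 0"
  by (simp add: epoch_def)

lemma epoch_step: "epoch T (k + 1) \<omega> - epoch T k \<omega> = enn2real (T k \<omega>)"
proof -
  consider "0 \<le> k" | "k = -1" | "k < -1" by linarith
  then show ?thesis
  proof cases
    case 1
    then have "{0..<k + 1} = insert k {0..<k}" by auto
    with 1 show ?thesis by (simp add: epoch_def)
  next
    case 2
    then have "{k..<0} = {k}" by auto
    with 2 show ?thesis by (simp add: epoch_def)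
  next
    case 3
    then have "{k..<0} = insert k {k + 1..<0}" by auto
    with 3 show ?thesis by (simp add: epoch_def)
  qed
qed

text \<open>The conditions on the family \<open>(T\<^sub>k, B\<^sup>k)\<close>. The filtrations for different \<open>k\<close> are unrelated.\<close>

definition decomposition_family ::
  "'b measure \<Rightarrow> (int \<Rightarrow> 'b \<Rightarrow> ennreal) \<Rightarrow> (int \<Rightarrow> real \<Rightarrow> 'b \<Rightarrow> real) \<Rightarrow> bool" where
  "decomposition_family N T B \<longleftrightarrow>
     prob_space N \<and>
     (\<exists>F. \<forall>k. normal_filtration N (F k) \<and> brownian_motion_wrt N (F k) (B k) \<and>
               stopping_time (F k) (T k)) \<and>
     prob_space.indep_vars N (\<lambda>_. lifetime_path_space) (\<lambda>k. lifetime_path (T k) (B k)) UNIV \<and>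
     (\<forall>j k. distr N lifetime_path_space (lifetime_path (T j) (B j)) =
            distr N lifetime_path_space (lifetime_path (T k) (B k))) \<and>
     (AE \<omega> in N. \<forall>k. T k \<omega> < \<infinity>) \<and>
     (AE \<omega> in N. (\<Sum>n. T (1 + int n) \<omega>) = \<infinity>) \<and>
     (AE \<omega> in N. (\<Sum>n. T (- 1 - int n) \<omega>) = \<infinity>)"

text \<open>\<open>W\<close> is (a version of) the unique continuous process glued together from the pieces \<open>B\<^sup>k\<close>.\<close>

definition concatenation ::
  "'b measure \<Rightarrow> (int \<Rightarrow> 'b \<Rightarrow> ennreal) \<Rightarrow> (int \<Rightarrow> real \<Rightarrow> 'b \<Rightarrow> real) \<Rightarrow>
     (real \<Rightarrow> 'b \<Rightarrow> real) \<Rightarrow> bool" where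
  "concatenation N T B W \<longleftrightarrow>
     (\<forall>t. W t \<in> borel_measurable N) \<and>
     (AE \<omega> in N. continuous_on UNIV (\<lambda>t. W t \<omega>) \<and> W 0 \<omega> = 0 \<and>
        (\<forall>k. \<forall>t\<ge>0. ennreal t < T k \<omega> \<longrightarrow>
           W (epoch T k \<omega> + t) \<omega> - W (epoch T k \<omega>) \<omega> = B k t \<omega>))"

text \<open>
  \<open>N\<close> is an extension of the probability space \<open>M\<close>, with projection \<open>p\<close>. A random variable \<open>Y\<close>
  on \<open>M\<close> is identified with \<open>Y \<circ> p\<close> on \<open>N\<close>.
\<close>

definition prob_extension :: "'a measure \<Rightarrow> 'b measure \<Rightarrow> ('b \<Rightarrow> 'a) \<Rightarrow> bool" where
  "prob_extension M N p \<longleftrightarrow> prob_space M \<and> prob_space N \<and> p \<in> N \<rightarrow>\<^sub>M M \<and> distr N M p = M"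

text \<open>
  Both notions below are properties of the law of the process: random times, and the families
  representing the process, may live on an extension of the probability space carrying it. This
  includes the unextended case (\<open>N = M\<close> and \<open>p = id\<close>). For the two-sided
  Brownian motion, extensions on \<open>'a \<times> real\<close> projecting to \<open>'a\<close> suffice, since the property depends
  on the joint law of the process and one real random variable only. The extension cannot be
  dispensed with: on the probability space generated by \<open>X\<close> itself, external randomization needed to
  define the time \<open>S\<close> may be missing. For example, with \<open>T\<close> the first time \<open>t \<ge> 1\<close> at which
  \<open>B\<^sub>t - B\<^sub>t\<^sub>-\<^sub>1 = 1\<close>, the \<open>S\<^sub>k\<close> are functionals of \<open>X\<close>; if \<open>S\<close> were one too, its translates along the
  \<open>S\<^sub>k\<close> would form a point process with the same Palm law (up to a factor) as Lebesgue measure.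
\<close>

definition strongly_decomposable ::
  "'a measure \<Rightarrow> (real \<Rightarrow> 'a \<Rightarrow> real) \<Rightarrow>
     'b measure \<Rightarrow> ('b \<Rightarrow> 'a) \<Rightarrow> (int \<Rightarrow> 'b \<Rightarrow> ennreal) \<Rightarrow> (int \<Rightarrow> real \<Rightarrow> 'b \<Rightarrow> real) \<Rightarrow> bool" where
  "strongly_decomposable M X N p T B \<longleftrightarrow>
     prob_extension M N p \<and>
     (\<forall>t. X t \<in> borel_measurable M) \<and>
     decomposition_family N T B \<and>
     (\<exists>U \<in> borel_measurable N.
        concatenation N T B (\<lambda>t \<omega>. X (U \<omega> + t) (p \<omega>) - X (U \<omega>) (p \<omega>)))"

definition two_sided_brownian_motion :: "'a measure \<Rightarrow> (real \<Rightarrow> 'a \<Rightarrow> real) \<Rightarrow> bool" where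
  "two_sided_brownian_motion M X \<longleftrightarrow>
     (\<forall>t. X t \<in> borel_measurable M) \<and>
     (\<exists>(Q :: ('a \<times> real) measure). prob_extension M Q fst \<and>
       (\<exists>S \<in> borel_measurable Q.
         let R = (\<lambda>t \<omega>. X (S \<omega> + t) (fst \<omega>) - X (S \<omega>) (fst \<omega>));
             L = (\<lambda>t \<omega>. X (S \<omega> - t) (fst \<omega>) - X (S \<omega>) (fst \<omega>))
         in standard_brownian_motion Q R \<and> standard_brownian_motion Q L \<and>
            prob_space.indep_var Q
              (\<Pi>\<^sub>M t\<in>{0..}. borel) (\<lambda>\<omega>. \<lambda>t\<in>{0..}. R t \<omega>)
              (\<Pi>\<^sub>M t\<in>{0..}. borel) (\<lambda>\<omega>. \<lambda>t\<in>{0..}. L t \<omega>)))"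

end

theory Submission
  imports Defs "HOL-Real_Asymp.Real_Asymp"
begin

text \<open>
  Seen from a time that is uniformly distributed in a length-biased cycle, the process has
  stationary increments: shifting the window of length \<open>T\<^sub>0\<close> by \<open>r\<close> changes the integral over it by two
  boundary terms, which are images of each other under the shift of the cycles. Its increments after
  the new origin are Brownian, because the origin \<open>u\<close> in cycle \<open>0\<close> satisfies \<open>u < T\<^sub>0\<close>, an event of the
  past of \<open>u\<close>, and the exponential martingale can be stopped at each \<open>T\<^sub>k\<close> in turn. By stationarity the
  increments on the whole line are Brownian.

  It remains to realize this law by a random time of the given process. This amounts to
  choosing a random cycle such that the cycles seen from it have the length-biased law, that is, to
  transporting the unit masses at the integers to masses \<open>T\<^sub>k / E T\<^sub>0\<close> in a shift-invariant
  way. The greedy transport, which treats the displacements one after another, works: afterwards,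
  unshipped mass and unmet demand cannot both occur, by ergodicity one of them is absent
  almost surely, and both have the same mean.
\<close>

text \<open>Optional stopping controls only what follows the origin; nothing is known directly about
  the path read backwards from an epoch. This is why stationarity enters: it moves increments at
  negative times to positive ones. The origin must be length-biased because a window of length
  \<open>T 0\<close> weights cycle \<open>0\<close> by its length; \<open>1 / E T 0\<close> is the
  normalization.

  The filtrations of different cycles are unrelated, so the concatenated path comes with no
  filtration. Independence of the cycles replaces it: a cycle is integrated out while its start time
  is held fixed. Exponentials of increments suit this, since their exponents add over cycles.

  The transport has two sides: that each site ships total mass 1 keeps the law of the given process,
  so that the new origin lives on an extension; that site \<open>k\<close> receives
  \<open>T k / E T 0\<close> produces the length bias.

  Measurability is the other obstacle. Paths are continuous only almost surely and \<open>X\<close>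
  is not known to be jointly measurable in time, so all integration is done with functionals of the
  sequence of cycles and carried back to \<open>X\<close> at the end.\<close>

section \<open>Independence from factorizing characteristic functions\<close>

text \<open>Under the probability measure with density \<open>g / expectation g\<close> the variable
  \<open>Y\<close> has characteristic function \<open>char \<nu>\<close>, so Levy uniqueness
  identifies its law.\<close>

lemma (in prob_space) weighted_law_of_char:
  fixes g :: "'a \<Rightarrow> real" and Y :: "'a \<Rightarrow> real"
  assumes [measurable]: "g \<in> borel_measurable M" "Y \<in> borel_measurable M"
    and nu: "real_distribution \<nu>"
    and g: "\<And>x. 0 \<le> g x" "\<And>x. g x \<le> C" "expectation g > 0"
    and ch: "\<And>l. (\<integral>x. g x * iexp (l * Y x) \<partial>M) = expectation g * char \<nu> l"
    and B[measurable]: "B \<in> sets borel"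
  shows "(\<integral>x. g x * indicator B (Y x) \<partial>M) = expectation g * measure \<nu> B"
proof -
  define c where "c = expectation g"
  define M' where "M' = density M (\<lambda>x. ennreal (g x / c))"
  have c: "c > 0" using g by (simp add: c_def)
  have gi: "integrable M g"
    by (rule integrable_const_bound[where B=C]) (use g in auto)
  have [measurable_cong]: "sets M' = sets M" by (simp add: M'_def)
  have nn: "AE x in M. 0 \<le> g x / c" using g c by auto
  have "emeasure M' (space M') = (\<integral>\<^sup>+x. ennreal (g x / c) \<partial>M)"
    unfolding M'_def by (subst emeasure_density) (auto intro!: nn_integral_cong)
  also have "\<dots> = ennreal (\<integral>x. g x / c \<partial>M)"
    using gi g c by (intro nn_integral_eq_integral) auto
  also have "\<dots> = 1" using c by (simp add: c_def)
  finally interpret M': prob_space M' by (rule prob_spaceI)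
  have rd: "real_distribution (distr M' borel Y)"
    by (intro M'.real_distribution_distr) simp
  have "char (distr M' borel Y) l = char \<nu> l" for l
  proof -
    have "char (distr M' borel Y) l = (\<integral>x. iexp (l * Y x) \<partial>M')"
      unfolding char_def by (subst integral_distr) auto
    also have "\<dots> = (\<integral>x. (g x / c) *\<^sub>R iexp (l * Y x) \<partial>M)"
      unfolding M'_def by (subst integral_density) (use nn in auto)
    also have "\<dots> = (\<integral>x. (1/c) *\<^sub>R (g x * iexp (l * Y x)) \<partial>M)"
      by (intro Bochner_Integration.integral_cong) (auto simp: scaleR_conv_of_real)
    also have "\<dots> = (1/c) *\<^sub>R (c * char \<nu> l)"
      by (subst integral_scaleR_right) (simp only: ch c_def)
    also have "\<dots> = char \<nu> l" using c by (simp add: scaleR_conv_of_real)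
    finally show ?thesis .
  qed
  hence eq: "distr M' borel Y = \<nu>" by (intro Levy_uniqueness rd nu ext)
  have "measure \<nu> B = (\<integral>x. indicator B x \<partial>distr M' borel Y)"
    unfolding eq using nu real_distribution.events_eq_borel[OF nu] by (simp add: real_distribution.space_eq_univ)
  also have "\<dots> = (\<integral>x. indicator B (Y x) \<partial>M')" by (subst integral_distr) auto
  also have "\<dots> = (\<integral>x. (g x / c) *\<^sub>R indicator B (Y x) \<partial>M)"
    unfolding M'_def by (subst integral_density) (use nn in auto)
  also have "\<dots> = (1/c) * (\<integral>x. g x * indicator B (Y x) \<partial>M)"
    by (subst integral_mult_right_zero[symmetric]) simp
  finally show ?thesis using c by (simp add: c_def field_simps)
qed

text \<open>
  Uniqueness of characteristic functions requires probability measures. The densities \<open>2 + Re A\<close> and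
  \<open>2 + Im A\<close> are positive, so it applies to complex weights \<open>A\<close> as well.
\<close>

lemma (in prob_space) complex_weighted_law_of_char:
  fixes A :: "'a \<Rightarrow> complex" and Y :: "'a \<Rightarrow> real"
  assumes [measurable]: "A \<in> borel_measurable M" "Y \<in> borel_measurable M"
    and nu: "real_distribution \<nu>"
    and A: "\<And>x. norm (A x) \<le> 1"
    and chA: "\<And>l. (\<integral>x. A x * iexp (l * Y x) \<partial>M) = (\<integral>x. A x \<partial>M) * char \<nu> l"
    and ch: "\<And>l. (\<integral>x. iexp (l * Y x) \<partial>M) = char \<nu> l"
    and B[measurable]: "B \<in> sets borel"
  shows "(\<integral>x. A x * indicator B (Y x) \<partial>M) = (\<integral>x. A x \<partial>M) * measure \<nu> B"
proof -
  have Ai[simp]: "integrable M A" by (rule integrable_const_bound[where B=1]) (use A in auto)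
  have Ri[simp]: "integrable M (\<lambda>x. Re (A x))" "integrable M (\<lambda>x. Im (A x))" by auto
  have [measurable]: "(\<lambda>x. cnj (A x)) \<in> borel_measurable M"
    by (rule measurable_compose[OF _ borel_measurable_continuous_onI]) (auto intro!: continuous_intros)
  have Aei[simp]: "integrable M (\<lambda>x. A x * iexp (l * Y x))" "integrable M (\<lambda>x. cnj (A x) * iexp (l * Y x))" for l
    by (rule integrable_const_bound[where B=1], use A in \<open>auto simp: norm_mult\<close>)+
  have ei[simp]: "integrable M (\<lambda>x. iexp (l * Y x))" for l
    by (rule integrable_const_bound[where B=1]) (auto)
  have cnjch: "cnj (char \<nu> (-l)) = char \<nu> l" for l
    unfolding char_def
    using Bochner_Integration.integral_cnj[of \<nu> "\<lambda>x. iexp (- l * x)"] by (simp add: exp_cnj)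
  \<comment> \<open>Conjugating the hypothesis at \<open>-l\<close> gives the factorization for
    \<open>cnj A\<close>; the weights \<open>Re A\<close> and \<open>Im A\<close> are combinations
    of \<open>A\<close> and \<open>cnj A\<close>.\<close>
  have chA': "(\<integral>x. cnj (A x) * iexp (l * Y x) \<partial>M) = (\<integral>x. cnj (A x) \<partial>M) * char \<nu> l" for l
  proof -
    have "(\<integral>x. cnj (A x) * iexp (l * Y x) \<partial>M) = (\<integral>x. cnj (A x * iexp ((-l) * Y x)) \<partial>M)"
      by (simp add: exp_cnj)
    also have "\<dots> = cnj ((\<integral>x. A x \<partial>M) * char \<nu> (-l))" by (subst Bochner_Integration.integral_cnj) (simp only: chA)
    finally show ?thesis by (simp add: cnjch)
  qed
  have real: "(\<integral>x. (2 + r x) * indicator B (Y x) \<partial>M) = expectation (\<lambda>x. 2 + r x) * measure \<nu> B"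
    if rm[measurable]: "r \<in> borel_measurable M" and rb: "\<And>x. \<bar>r x\<bar> \<le> 1"
      and rc: "\<And>l. (\<integral>x. r x * iexp (l * Y x) \<partial>M) = expectation r * char \<nu> l" for r :: "'a \<Rightarrow> real"
  proof -
    have ri[simp]: "integrable M r" by (rule integrable_const_bound[where B=1]) (use rb in auto)
    have re[simp]: "integrable M (\<lambda>x. r x * iexp (l * Y x))" for l
      by (rule integrable_const_bound[where B=1], use rb in \<open>auto simp: norm_mult\<close>)
    have e1: "expectation (\<lambda>x. 2 + r x) = 2 + expectation r" by (simp add: prob_space)
    have "\<bar>expectation r\<bar> \<le> expectation (\<lambda>_. 1)"
      using integral_mono[of M "\<lambda>x. \<bar>r x\<bar>" "\<lambda>_. 1"] rb by (intro order.trans[OF integral_abs_bound]) auto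
    hence pos: "expectation (\<lambda>x. 2 + r x) > 0" unfolding e1 by (simp add: prob_space)
    show ?thesis
    proof (rule weighted_law_of_char[OF _ _ nu _ _ pos _ B, where C=3])
      show "0 \<le> 2 + r x" "2 + r x \<le> 3" for x using rb[of x] by auto
      fix l
      have "(\<integral>x. complex_of_real (2 + r x) * iexp (l * Y x) \<partial>M)
         = (\<integral>x. 2 * iexp (l * Y x) + r x * iexp (l * Y x) \<partial>M)" by (simp add: algebra_simps)
      also have "\<dots> = 2 * char \<nu> l + expectation r * char \<nu> l"
        unfolding Bochner_Integration.integral_add[OF integrable_mult_right[OF ei] re] integral_mult_right_zero rc ch ..
      finally show "(\<integral>x. complex_of_real (2 + r x) * iexp (l * Y x) \<partial>M) = expectation (\<lambda>x. 2 + r x) * char \<nu> l"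
        unfolding e1 by (simp add: algebra_simps)
    qed auto
  qed
  have bi[simp]: "integrable M (\<lambda>x. r x * indicator B (Y x))"
    if "r \<in> borel_measurable M" "\<And>x. \<bar>r x\<bar> \<le> 1" for r :: "'a \<Rightarrow> real"
    by (rule integrable_const_bound[where B=1], use that in \<open>auto split: split_indicator\<close>)
  have ib[simp]: "integrable M (\<lambda>x. indicator B (Y x) :: real)"
    by (rule integrable_const_bound[where B=1], auto split: split_indicator)
  \<comment> \<open>Subtracting the instance \<open>r = 0\<close> removes the summand 2.\<close>
  have real': "(\<integral>x. r x * indicator B (Y x) \<partial>M) = expectation r * measure \<nu> B"
    if rm[measurable]: "r \<in> borel_measurable M" and rb: "\<And>x. \<bar>r x\<bar> \<le> 1"
      and rc: "\<And>l. (\<integral>x. r x * iexp (l * Y x) \<partial>M) = expectation r * char \<nu> l" for r :: "'a \<Rightarrow> real"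
  proof -
    have ri[simp]: "integrable M r" by (rule integrable_const_bound[where B=1]) (use rb in auto)
    have "2 * (\<integral>x. indicator B (Y x) \<partial>M) = 2 * measure \<nu> B"
      using real[of "\<lambda>_. 0"] by (simp add: prob_space)
    moreover have "2 * (\<integral>x. indicator B (Y x) \<partial>M) + (\<integral>x. r x * indicator B (Y x) \<partial>M) = (2 + expectation r) * measure \<nu> B"
      using real[OF rm rb rc] rm rb by (simp add: distrib_right prob_space)
    ultimately show ?thesis by (simp add: algebra_simps)
  qed
  have b: "\<bar>Re (A x)\<bar> \<le> 1" "\<bar>Im (A x)\<bar> \<le> 1" for x
    using A[of x] abs_Re_le_cmod[of "A x"] abs_Im_le_cmod[of "A x"] by linarith+
  have rc: "(\<integral>x. Re (A x) * iexp (l * Y x) \<partial>M) = expectation (\<lambda>x. Re (A x)) * char \<nu> l" for l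
  proof -
    have "(\<integral>x. Re (A x) * iexp (l * Y x) \<partial>M) = (\<integral>x. (1/2) * (A x * iexp (l * Y x) + cnj (A x) * iexp (l * Y x)) \<partial>M)"
      by (intro Bochner_Integration.integral_cong refl) (simp add: distrib_right[symmetric] complex_add_cnj)
    also have "\<dots> = (1/2) * ((\<integral>x. A x \<partial>M) + cnj (\<integral>x. A x \<partial>M)) * char \<nu> l"
      unfolding integral_mult_right_zero Bochner_Integration.integral_add[OF Aei] chA chA' by (simp add: algebra_simps)
    also have "\<dots> = expectation (\<lambda>x. Re (A x)) * char \<nu> l"
      by (simp add: complex_add_cnj)
    finally show ?thesis .
  qed
  have im: "(1/(2*\<i>)) * (z - cnj z) = complex_of_real (Im z)" for z
    by (simp add: complex_diff_cnj) (simp add: complex_eq_iff)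
  have ic: "(\<integral>x. Im (A x) * iexp (l * Y x) \<partial>M) = expectation (\<lambda>x. Im (A x)) * char \<nu> l" for l
  proof -
    have "(\<integral>x. Im (A x) * iexp (l * Y x) \<partial>M) = (\<integral>x. (1/(2*\<i>)) * (A x * iexp (l * Y x) - cnj (A x) * iexp (l * Y x)) \<partial>M)"
      by (simp only: left_diff_distrib[symmetric] mult.assoc[symmetric] im)
    also have "\<dots> = (1/(2*\<i>)) * ((\<integral>x. A x \<partial>M) - cnj (\<integral>x. A x \<partial>M)) * char \<nu> l"
      unfolding integral_mult_right_zero Bochner_Integration.integral_diff[OF Aei] chA chA' by (simp add: algebra_simps)
    also have "\<dots> = expectation (\<lambda>x. Im (A x)) * char \<nu> l"
      unfolding im by simp
    finally show ?thesis .
  qed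
  have Abi: "integrable M (\<lambda>x. A x * indicator B (Y x))"
    by (rule integrable_const_bound[where B=1], use A in \<open>auto split: split_indicator simp: norm_mult\<close>)
  have "Re (\<integral>x. A x * indicator B (Y x) \<partial>M) = (\<integral>x. Re (A x) * indicator B (Y x) \<partial>M)"
    by (subst integral_Re[OF Abi,symmetric]) (auto intro!: Bochner_Integration.integral_cong split: split_indicator)
  moreover have "Im (\<integral>x. A x * indicator B (Y x) \<partial>M) = (\<integral>x. Im (A x) * indicator B (Y x) \<partial>M)"
    by (subst integral_Im[OF Abi,symmetric]) (auto intro!: Bochner_Integration.integral_cong split: split_indicator)
  ultimately show ?thesis
    using real'[OF _ b(1) rc] real'[OF _ b(2) ic] by (simp add: complex_eq_iff)
qed

text \<open>The exponentials are replaced by indicators one coordinate at a time.\<close>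

lemma (in prob_space) indep_vars_of_char:
  fixes Y :: "'i \<Rightarrow> 'a \<Rightarrow> real"
  assumes I: "finite I"
    and Y[measurable]: "\<And>i. i \<in> I \<Longrightarrow> Y i \<in> borel_measurable M"
    and nu: "\<And>i. i \<in> I \<Longrightarrow> real_distribution (\<nu> i)"
    and ch: "\<And>l :: 'i \<Rightarrow> real. (\<integral>x. iexp (\<Sum>i\<in>I. l i * Y i x) \<partial>M) = (\<Prod>i\<in>I. char (\<nu> i) (l i))"
  shows "indep_vars (\<lambda>_. borel) Y I" and "\<And>i. i \<in> I \<Longrightarrow> distr M borel (Y i) = \<nu> i"
proof -
  note char_0 = real_distribution.char_zero[OF nu]
  have chJ: "(\<integral>x. iexp (\<Sum>i\<in>J. l i * Y i x) \<partial>M) = (\<Prod>i\<in>J. char (\<nu> i) (l i))"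
    if J: "J \<subseteq> I" for J l
  proof -
    let ?l = "\<lambda>i. if i \<in> J then l i else 0"
    have "(\<Sum>i\<in>I. ?l i * Y i x) = (\<Sum>i\<in>J. l i * Y i x)" for x
      by (rule sum.mono_neutral_cong_right) (use I J in auto)
    moreover have "(\<Prod>i\<in>I. char (\<nu> i) (?l i)) = (\<Prod>i\<in>J. char (\<nu> i) (l i))"
      by (rule prod.mono_neutral_cong_right) (use I J char_0 in auto)
    ultimately show ?thesis using ch[of ?l] by simp
  qed
  have ch1: "(\<integral>x. iexp (l * Y i x) \<partial>M) = char (\<nu> i) l" if "i \<in> I" for i l
    using chJ[of "{i}" "\<lambda>_. l"] that by simp
  show di: "distr M borel (Y i) = \<nu> i" if i: "i \<in> I" for i
  proof (rule Levy_uniqueness)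
    show "real_distribution (distr M borel (Y i))" using i by (intro real_distribution_distr) simp
    show "char (distr M borel (Y i)) = char (\<nu> i)"
    proof
      fix l
      have "char (distr M borel (Y i)) l = (\<integral>x. iexp (l * Y i x) \<partial>M)"
        unfolding char_def using i by (subst integral_distr) auto
      then show "char (distr M borel (Y i)) l = char (\<nu> i) l" using ch1[OF i] by simp
    qed
  qed (rule nu[OF i])
  have main: "(\<integral>x. iexp (\<Sum>i\<in>I - J. l i * Y i x) * (\<Prod>i\<in>J. indicator (S i) (Y i x)) \<partial>M)
      = (\<Prod>i\<in>I - J. char (\<nu> i) (l i)) * (\<Prod>i\<in>J. measure (\<nu> i) (S i))"
    if "J \<subseteq> I" "\<And>i. i \<in> I \<Longrightarrow> S i \<in> sets borel" for J S l
  proof -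
    have "finite J" using that I finite_subset by blast
    then show ?thesis using that
    proof (induction J arbitrary: l)
      case empty then show ?case using ch[of l] by simp
    next
      case (insert k J)
      have k: "k \<in> I" "k \<notin> J" and JI: "J \<subseteq> I" and [measurable]: "Y k \<in> borel_measurable M"
        and fJ: "finite J"
        using insert by auto
      have S[measurable]: "S i \<in> sets borel" if "i \<in> I" for i using insert.prems that by auto
      define A where "A = (\<lambda>x. iexp (\<Sum>i\<in>I - insert k J. l i * Y i x) * (\<Prod>i\<in>J. indicator (S i) (Y i x)) :: complex)"
      have [measurable]: "A \<in> borel_measurable M" unfolding A_def
        using JI by (intro borel_measurable_times borel_measurable_prod borel_measurable_exp borel_measurable_of_real borel_measurable_sum) (auto intro!: measurable_compose[OF Y borel_measurable_indicator] S Y)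
      have split: "(\<Sum>i\<in>I - J. f i) = f k + (\<Sum>i\<in>I - insert k J. f i)" for f :: "'i \<Rightarrow> real"
        using I k by (subst sum.remove[of _ k]) (auto intro!: arg_cong2[where f="(+)"] sum.cong)
      have splitp: "(\<Prod>i\<in>I - J. f i) = f k * (\<Prod>i\<in>I - insert k J. f i)" for f :: "'i \<Rightarrow> complex"
        using I k by (subst prod.remove[of _ k]) (auto intro!: arg_cong2[where f="(*)"] prod.cong)
      \<comment> \<open>The induction hypothesis holds for every \<open>l\<close>, so the frequency
        \<open>l'\<close> of coordinate \<open>k\<close> can vary while \<open>A\<close> stays
        fixed. The value \<open>l' = 0\<close> yields the integral of \<open>A\<close>
        itself.\<close>
      have gen: "(\<integral>x. A x * iexp (l' * Y k x) \<partial>M) = char (\<nu> k) l' * (\<Prod>i\<in>I - insert k J. char (\<nu> i) (l i)) * (\<Prod>i\<in>J. measure (\<nu> i) (S i))" for l'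
      proof -
        have e: "A x * iexp (l' * Y k x) = iexp (\<Sum>i\<in>I - J. (l(k := l')) i * Y i x) * (\<Prod>i\<in>J. indicator (S i) (Y i x))" for x
        proof -
          have "(\<Sum>i\<in>I - J. (l(k := l')) i * Y i x) = l' * Y k x + (\<Sum>i\<in>I - insert k J. l i * Y i x)"
            unfolding split by (simp cong: sum.cong_simp)
          thus ?thesis by (simp only: of_real_add distrib_left exp_add A_def mult_ac)
        qed
        have "(\<Prod>i\<in>I - J. char (\<nu> i) ((l(k := l')) i)) = char (\<nu> k) l' * (\<Prod>i\<in>I - insert k J. char (\<nu> i) (l i))"
          unfolding splitp by (simp cong: prod.cong_simp)
        then show ?thesis unfolding e using insert.IH[OF JI, of "l(k := l')"] S by simp
      qed
      have EA: "(\<integral>x. A x \<partial>M) = (\<Prod>i\<in>I - insert k J. char (\<nu> i) (l i)) * (\<Prod>i\<in>J. measure (\<nu> i) (S i))"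
        using gen[of 0] char_0[OF k(1)] by simp
      have "(\<integral>x. A x * indicator (S k) (Y k x) \<partial>M) = (\<integral>x. A x \<partial>M) * measure (\<nu> k) (S k)"
      proof (rule complex_weighted_law_of_char)
        show "norm (A x) \<le> 1" for x
          unfolding A_def norm_mult by (auto simp: prod_norm[symmetric] intro!: prod_le_1 split: split_indicator)
      qed (use nu k S ch1 gen EA in \<open>auto simp: mult_ac\<close>)
      moreover have "A x * indicator (S k) (Y k x) = iexp (\<Sum>i\<in>I - insert k J. l i * Y i x) * (\<Prod>i\<in>insert k J. indicator (S i) (Y i x))" for x
        unfolding A_def using k fJ by (simp add: mult_ac)
      ultimately show ?case using k fJ by (simp add: EA mult_ac)
    qed
  qed
  show "indep_vars (\<lambda>_. borel) Y I"
  proof (cases "I = {}")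
    case True then show ?thesis by (simp add: indep_vars_def indep_sets_def)
  next
    case False
    have "prob (\<Inter>j\<in>I. Y j -` S j \<inter> space M) = (\<Prod>j\<in>I. prob (Y j -` S j \<inter> space M))"
      if "S \<in> (\<Pi> i\<in>I. sets borel)" for S
    proof -
      have S[measurable]: "S i \<in> sets borel" if "i \<in> I" for i using \<open>S \<in> _\<close> that by auto
      have E[measurable]: "(\<Inter>j\<in>I. Y j -` S j \<inter> space M) \<in> sets M"
        using False I by (intro sets.finite_INT) (auto intro!: measurable_sets[OF Y])
      have "complex_of_real (prob (\<Inter>j\<in>I. Y j -` S j \<inter> space M)) = (\<integral>x. complex_of_real (indicator (\<Inter>j\<in>I. Y j -` S j \<inter> space M) x) \<partial>M)"
        using sets.sets_into_space[OF E]
        by (subst integral_complex_of_real) (simp only: Bochner_Integration.integral_indicator Int_absorb2)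
      also have "\<dots> = (\<integral>x. (\<Prod>i\<in>I. indicator (S i) (Y i x)) \<partial>M)"
      proof (intro Bochner_Integration.integral_cong refl)
        fix x assume "x \<in> space M"
        show "complex_of_real (indicator (\<Inter>j\<in>I. Y j -` S j \<inter> space M) x) = (\<Prod>i\<in>I. indicator (S i) (Y i x) :: complex)"
        proof (cases "\<forall>i\<in>I. Y i x \<in> S i")
          case True then show ?thesis using \<open>x \<in> space M\<close> by simp
        next
          case F: False
          then have "(\<Prod>i\<in>I. indicator (S i) (Y i x) :: complex) = 0"
            using I by (auto simp: indicator_def intro!: prod_zero)
          then show ?thesis using F by (auto simp: indicator_def)
        qed
      qed
      also have "\<dots> = (\<Prod>i\<in>I. complex_of_real (measure (\<nu> i) (S i)))"
        using main[of I S "\<lambda>_. 0"] S by simp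
      also have "\<dots> = (\<Prod>i\<in>I. complex_of_real (prob (Y i -` S i \<inter> space M)))"
        by (intro prod.cong refl) (simp add: di[symmetric] measure_distr)
      finally show ?thesis by (simp only: of_real_prod[symmetric] of_real_eq_iff)
    qed
    then show ?thesis
      by (subst indep_vars_finite[where E="\<lambda>_. sets borel"])
         (use False I Y in \<open>auto simp: sets.sigma_sets_eq[of borel, simplified] sets.Int_stable\<close>)
  qed
qed

section \<open>Gaussian increments and Brownian motion\<close>

lemma char_normal_density:
  assumes "\<sigma> > 0"
  shows "real_distribution (density lborel (normal_density 0 \<sigma>))"
    and "char (density lborel (normal_density 0 \<sigma>)) l = exp (- (l\<^sup>2 * \<sigma>\<^sup>2) / 2)"
proof -
  show rd: "real_distribution (density lborel (normal_density 0 \<sigma>))"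
    using prob_space_normal_density[OF assms] by (auto simp: real_distribution_def real_distribution_axioms_def)
  interpret std: real_distribution std_normal_distribution by (rule real_dist_normal_dist)
  have "distributed std_normal_distribution lborel (\<lambda>x. x) std_normal_density"
    by (auto simp: distributed_def intro!: distr_id2)
  from std.normal_density_affine[OF this, of \<sigma> 0] assms
  have "distributed std_normal_distribution lborel (\<lambda>x. \<sigma> * x) (normal_density 0 \<sigma>)" by simp
  then have eq: "distr std_normal_distribution lborel (\<lambda>x. \<sigma> * x) = density lborel (normal_density 0 \<sigma>)"
    by (simp add: distributed_def)
  have "char (density lborel (normal_density 0 \<sigma>)) l = char std_normal_distribution (l * \<sigma>)"
    unfolding char_def eq[symmetric] by (subst integral_distr) (auto simp: mult_ac)
  also have "\<dots> = exp (- (l\<^sup>2 * \<sigma>\<^sup>2) / 2)"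
    by (simp add: char_std_normal_distribution power_mult_distrib)
  finally show "char (density lborel (normal_density 0 \<sigma>)) l = exp (- (l\<^sup>2 * \<sigma>\<^sup>2) / 2)" .
qed

abbreviation incr_variance :: "(nat \<Rightarrow> real) \<Rightarrow> (nat \<Rightarrow> real) \<Rightarrow> nat \<Rightarrow> real" where
  "incr_variance a l n \<equiv> (\<Sum>j<n. (l j)\<^sup>2 * (a (Suc j) - a j))"

definition gaussian_increments :: "'a measure \<Rightarrow> (real \<Rightarrow> 'a \<Rightarrow> real) \<Rightarrow> bool" where
  "gaussian_increments M Z \<longleftrightarrow>
    (\<forall>(a :: nat \<Rightarrow> real) l n. mono a \<longrightarrow>
      (\<integral>x. iexp (\<Sum>j<n. l j * (Z (a (Suc j)) x - Z (a j) x)) \<partial>M) =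
        complex_of_real (exp (- incr_variance a l n / 2)))"

lemma gaussian_increments_reverse:
  assumes "gaussian_increments M Z"
  shows "gaussian_increments M (\<lambda>t. Z (- t))"
  unfolding gaussian_increments_def
proof (intro allI impI)
  fix a l :: "nat \<Rightarrow> real" and n assume a: "mono a"
  \<comment> \<open>Read backwards, increment \<open>j\<close> becomes increment
    \<open>n - Suc j\<close> with the opposite sign, hence the minus in \<open>k\<close>. From index
    \<open>n\<close> on, truncated subtraction makes \<open>b\<close> constant.\<close>
  define b where "b = (\<lambda>j. - a (n - j))"
  define k where "k = (\<lambda>j. - l (n - Suc j))"
  have "mono b" unfolding b_def using a by (auto simp: mono_def)
  have s: "n - j = Suc (n - Suc j)" if "j < n" for j using that by simp
  have 1: "(\<Sum>j<n. k j * (Z (b (Suc j)) x - Z (b j) x)) = (\<Sum>j<n. l j * (Z (- a (Suc j)) x - Z (- a j) x))" for x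
    unfolding b_def k_def
    by (subst (2) sum.nat_diff_reindex[symmetric]) (auto intro!: sum.cong simp: s algebra_simps)
  have 2: "(\<Sum>j<n. (k j)\<^sup>2 * (b (Suc j) - b j)) = incr_variance a l n"
    unfolding b_def k_def
    by (subst (2) sum.nat_diff_reindex[symmetric]) (auto intro!: sum.cong simp: s algebra_simps)
  have "(\<integral>x. iexp (\<Sum>j<n. k j * (Z (b (Suc j)) x - Z (b j) x)) \<partial>M) =
        complex_of_real (exp (- (\<Sum>j<n. (k j)\<^sup>2 * (b (Suc j) - b j)) / 2))"
    using assms \<open>mono b\<close> unfolding gaussian_increments_def by blast
  then show "(\<integral>x. iexp (\<Sum>j<n. l j * (Z (- a (Suc j)) x - Z (- a j) x)) \<partial>M) =
        complex_of_real (exp (- incr_variance a l n / 2))"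
    unfolding 1 2 .
qed

lemma (in prob_space) gaussian_increments_indep:
  assumes Z[measurable]: "\<And>t. Z t \<in> borel_measurable M" and g: "gaussian_increments M Z"
    and a: "mono a" "\<And>j. j < n \<Longrightarrow> a j < a (Suc j)"
  shows "indep_vars (\<lambda>_. borel) (\<lambda>j x. Z (a (Suc j)) x - Z (a j) x) {..<n}"
    and "\<And>j. j < n \<Longrightarrow> distr M borel (\<lambda>x. Z (a (Suc j)) x - Z (a j) x) =
           density lborel (normal_density 0 (sqrt (a (Suc j) - a j)))"
proof -
  let ?\<nu> = "\<lambda>j. density lborel (normal_density 0 (sqrt (a (Suc j) - a j)))"
  have ch: "(\<integral>x. iexp (\<Sum>j<n. l j * (Z (a (Suc j)) x - Z (a j) x)) \<partial>M) = (\<Prod>j<n. char (?\<nu> j) (l j))" for l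
  proof -
    have "(\<Prod>j<n. char (?\<nu> j) (l j)) = (\<Prod>j<n. complex_of_real (exp (- ((l j)\<^sup>2 * (a (Suc j) - a j)) / 2)))"
      using a(2) by (intro prod.cong refl) (simp add: char_normal_density less_imp_le)
    also have "\<dots> = complex_of_real (exp (\<Sum>j<n. - ((l j)\<^sup>2 * (a (Suc j) - a j)) / 2))"
      by (simp add: exp_sum)
    also have "(\<Sum>j<n. - ((l j)\<^sup>2 * (a (Suc j) - a j)) / 2) = - incr_variance a l n / 2"
      by (simp add: sum_negf sum_divide_distrib)
    finally show ?thesis using g a(1) unfolding gaussian_increments_def by simp
  qed
  have nu: "j \<in> {..<n} \<Longrightarrow> real_distribution (?\<nu> j)" for j using a(2) by (intro char_normal_density) simp
  have m: "j \<in> {..<n} \<Longrightarrow> (\<lambda>x. Z (a (Suc j)) x - Z (a j) x) \<in> borel_measurable M" for j by simp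
  show "indep_vars (\<lambda>_. borel) (\<lambda>j x. Z (a (Suc j)) x - Z (a j) x) {..<n}"
    by (rule indep_vars_of_char(1)[OF _ m nu ch]) auto
  show "distr M borel (\<lambda>x. Z (a (Suc j)) x - Z (a j) x) = ?\<nu> j" if "j < n" for j
    using that by (intro indep_vars_of_char(2)[OF _ m nu ch]) auto
qed

lemma (in prob_space) standard_brownian_motion_of_gaussian_increments:
  assumes Z[measurable]: "\<And>t. Z t \<in> borel_measurable M" and g: "gaussian_increments M Z"
    and 0: "\<And>x. x \<in> space M \<Longrightarrow> Z 0 x = 0" and c: "AE x in M. continuous_on {0..} (\<lambda>t. Z t x)"
  shows "standard_brownian_motion M Z"
  unfolding standard_brownian_motion_def
proof (intro conjI allI impI)
  show "AE x in M. Z 0 x = 0" using 0 by (intro AE_I2)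
  show "prob_space M" by unfold_locales
  show "Z t \<in> borel_measurable M" for t by simp
  show "AE x in M. continuous_on {0..} (\<lambda>t. Z t x)" by (rule c)
next
  fix s t :: real assume st: "0 \<le> s" "s < t"
  define a where "a = (\<lambda>j::nat. if j = 0 then s else t)"
  have a: "mono a" "\<And>j. j < 1 \<Longrightarrow> a j < a (Suc j)" unfolding a_def mono_def using st by auto
  have "distr M borel (\<lambda>x. Z (a (Suc 0)) x - Z (a 0) x) =
           density lborel (normal_density 0 (sqrt (a (Suc 0) - a 0)))"
    by (rule gaussian_increments_indep(2)[where n=1, OF Z g a]) auto
  moreover have "distr M lborel (\<lambda>x. Z t x - Z s x) = distr M borel (\<lambda>x. Z t x - Z s x)"
    by (rule distr_cong) auto
  ultimately show "distributed M lborel (\<lambda>x. Z t x - Z s x) (normal_density 0 (sqrt (t - s)))"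
    unfolding distributed_def by (simp add: a_def)
next
  fix t :: "nat \<Rightarrow> real" and n assume "0 \<le> t 0" "strict_mono t"
  then show "indep_vars (\<lambda>_. borel) (\<lambda>i x. Z (t (Suc i)) x - Z (t i) x) {..<n}"
    by (intro gaussian_increments_indep(1)[OF Z g]) (auto simp: strict_mono_mono strict_monoD)
qed

text \<open>With a grid that starts at 0, the values of a process at finitely many times become
  partial sums of increments. The induction inserts a new maximum \<open>b\<close>; that
  \<open>t n\<close> lies in \<open>insert 0 F\<close> is carried along so that the grid can be cut
  after \<open>n\<close> and continued at \<open>b\<close>.\<close>

lemma finite_set_in_strict_mono_grid:
  fixes F :: "real set"
  assumes "finite F" "F \<subseteq> {0..}"
  obtains t :: "nat \<Rightarrow> real" and n where "strict_mono t" "t 0 = 0" "F \<subseteq> t ` {..n}"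
proof -
  have "F \<subseteq> {0..} \<Longrightarrow> \<exists>(t :: nat \<Rightarrow> real) n. strict_mono t \<and> t 0 = 0 \<and> F \<subseteq> t ` {..n} \<and> t n \<in> insert 0 F"
    using assms(1)
  proof (induction F rule: finite_linorder_max_induct)
    case empty
    show ?case by (intro exI[of _ real] exI[of _ 0]) (auto simp: strict_mono_def)
  next
    case (insert b F)
    then obtain t :: "nat \<Rightarrow> real" and n where t: "strict_mono t" "t 0 = 0" "F \<subseteq> t ` {..n}" "t n \<in> insert 0 F"
      by auto
    show ?case
    proof (cases "b = 0")
      case True
      then show ?thesis using t by (intro exI[of _ t] exI[of _ n]) (auto simp: image_iff intro: bexI[of _ 0])
    next
      case False
      define t' where "t' = (\<lambda>i. if i \<le> n then t i else b + real (i - Suc n))"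
      have "t n < b" using insert t(4) False by force
      have sm: "strict_mono t'"
        unfolding strict_mono_Suc_iff
      proof
        fix i
        consider "i < n" | "i = n" | "i > n" by linarith
        then show "t' i < t' (Suc i)"
          by cases (use \<open>t n < b\<close> t(1) in \<open>auto simp: t'_def strict_mono_Suc_iff\<close>)
      qed
      have "t' (Suc n) = b" by (simp add: t'_def)
      moreover have "t' ` {..n} = t ` {..n}" by (auto simp: t'_def)
      ultimately have "insert b F \<subseteq> t' ` {..Suc n}" using t(3) by (auto simp: atMost_Suc)
      then show ?thesis using sm t(2) \<open>t' (Suc n) = b\<close> by (intro exI[of _ t'] exI[of _ "Suc n"]) (auto simp: t'_def)
    qed
  qed
  then show ?thesis using assms(2) that by blast
qed

lemma (in prob_space) indep_var_cong_space:
  assumes ind: "indep_var S X T Y"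
    and X: "\<And>x. x \<in> space M \<Longrightarrow> X x = X' x" and Y: "\<And>x. x \<in> space M \<Longrightarrow> Y x = Y' x"
  shows "indep_var S X' T Y'"
proof -
  have "{X' -` A \<inter> space M |A. A \<in> sets S} = {X -` A \<inter> space M |A. A \<in> sets S}"
    "{Y' -` A \<inter> space M |A. A \<in> sets T} = {Y -` A \<inter> space M |A. A \<in> sets T}"
    using X Y by (intro Collect_cong ex_cong; auto)+
  moreover have "X' \<in> M \<rightarrow>\<^sub>M S \<longleftrightarrow> X \<in> M \<rightarrow>\<^sub>M S" "Y' \<in> M \<rightarrow>\<^sub>M T \<longleftrightarrow> Y \<in> M \<rightarrow>\<^sub>M T"
    using X Y by (intro measurable_cong; simp)+
  ultimately show ?thesis using ind unfolding indep_var_eq by simp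
qed

lemma (in prob_space) gaussian_increments_indep_finite:
  assumes Z[measurable]: "\<And>t. Z t \<in> borel_measurable M" and g: "gaussian_increments M Z"
    and 0: "\<And>x. x \<in> space M \<Longrightarrow> Z 0 x = 0"
    and J: "finite J" "J \<subseteq> {0..}" and K: "finite K" "K \<subseteq> {0..}"
  shows "indep_var (PiM J (\<lambda>_. borel)) (\<lambda>x. \<lambda>t\<in>J. Z t x) (PiM K (\<lambda>_. borel)) (\<lambda>x. \<lambda>t\<in>K. Z (- t) x)"
proof -
  obtain t :: "nat \<Rightarrow> real" and n where t: "strict_mono t" "t 0 = 0" and JK: "J \<union> K \<subseteq> t ` {..n}"
    by (rule finite_set_in_strict_mono_grid[of "J \<union> K"]) (use J K in \<open>simp_all\<close>)
  \<comment> \<open>The grid is symmetric about \<open>a n = 0\<close>. Increments with index below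
    \<open>n\<close> belong to negative times, the others to positive times, so the two sides are
    functions of disjoint blocks of independent increments.\<close>
  define a where "a = (\<lambda>j. if j \<le> n then - t (n - j) else t (j - n))"
  have tm: "t i < t j \<longleftrightarrow> i < j" for i j using t(1) by (simp add: strict_mono_less)
  have tpos: "0 < t j" if "j > 0" for j using tm[of 0 j] that t(2) by simp
  have sm: "strict_mono a" unfolding strict_mono_Suc_iff
  proof
    fix j
    consider "j < n" | "j = n" | "j > n" by linarith
    then show "a j < a (Suc j)"
    proof cases
      case 1
      then show ?thesis using tm[of "n - Suc j" "n - j"] by (simp add: a_def)
    next
      case 2
      then show ?thesis using tpos[of 1] t(2) by (simp add: a_def)
    next
      case 3
      then show ?thesis using tm[of "j - n" "Suc j - n"] by (simp add: a_def)
    qed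
  qed
  define D where "D = (\<lambda>j x. Z (a (Suc j)) x - Z (a j) x)"
  have "indep_vars (\<lambda>_. borel) D {..<n + n}"
    unfolding D_def using sm by (intro gaussian_increments_indep(1)[OF Z g]) (auto simp: strict_mono_mono strict_monoD)
  then have ind: "indep_var (PiM {n..<n+n} (\<lambda>_. borel)) (\<lambda>x. \<lambda>i\<in>{n..<n+n}. D i x)
     (PiM {..<n} (\<lambda>_. borel)) (\<lambda>x. \<lambda>i\<in>{..<n}. D i x)"
    by (rule indep_var_restrict) auto
  define idx where "idx = (\<lambda>s. SOME i. i \<le> n \<and> t i = s)"
  have idx: "idx s \<le> n" "t (idx s) = s" if "s \<in> J \<union> K" for s
  proof -
    from JK that have "s \<in> t ` {..n}" by (rule subsetD)
    then obtain i where "i \<le> n \<and> t i = s" by auto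
    then have "idx s \<le> n \<and> t (idx s) = s" unfolding idx_def by (rule someI)
    then show "idx s \<le> n" "t (idx s) = s" by auto
  qed
  define Y1 where "Y1 = (\<lambda>f. \<lambda>s\<in>J. \<Sum>j<idx s. f (n + j) :: real)"
  define Y2 where "Y2 = (\<lambda>f. \<lambda>s\<in>K. - (\<Sum>j\<in>{n - idx s..<n}. f j) :: real)"
  have Y1: "Y1 \<in> PiM {n..<n+n} (\<lambda>_. borel) \<rightarrow>\<^sub>M PiM J (\<lambda>_. borel)"
    unfolding Y1_def
  proof (intro measurable_restrict borel_measurable_sum measurable_component_singleton)
    show "n + j \<in> {n..<n+n}" if "s \<in> J" "j \<in> {..<idx s}" for s j
      using idx(1)[of s] that by auto
  qed
  have Y2: "Y2 \<in> PiM {..<n} (\<lambda>_. borel) \<rightarrow>\<^sub>M PiM K (\<lambda>_. borel)"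
    unfolding Y2_def
    by (intro measurable_restrict borel_measurable_sum borel_measurable_uminus measurable_component_singleton) simp
  have ind': "indep_var (PiM J (\<lambda>_. borel)) (Y1 \<circ> (\<lambda>x. \<lambda>i\<in>{n..<n+n}. D i x)) (PiM K (\<lambda>_. borel)) (Y2 \<circ> (\<lambda>x. \<lambda>i\<in>{..<n}. D i x))"
    by (rule indep_var_compose[OF ind Y1 Y2])
  have e1: "(Y1 \<circ> (\<lambda>x. \<lambda>i\<in>{n..<n+n}. D i x)) x = (\<lambda>t\<in>J. Z t x)" if "x \<in> space M" for x
  proof -
    have "(\<Sum>j<idx s. D (n + j) x) = Z s x" if "s \<in> J" for s
    proof -
      have "(\<Sum>j<i. D (n + j) x) = Z (a (n + i)) x - Z (a n) x" for i
        by (induction i) (auto simp: D_def)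
      moreover have "a (n + idx s) = s" using idx[of s] that by (auto simp: a_def t(2))
      moreover have "a n = 0" by (simp add: a_def t(2))
      ultimately show ?thesis using 0[OF \<open>x \<in> space M\<close>] by simp
    qed
    moreover have "n + j < n + n" if "j < idx s" "s \<in> J" for j s using idx(1)[of s] that by auto
    ultimately show ?thesis by (simp add: Y1_def fun_eq_iff)
  qed
  have e2: "(Y2 \<circ> (\<lambda>x. \<lambda>i\<in>{..<n}. D i x)) x = (\<lambda>t\<in>K. Z (- t) x)" if "x \<in> space M" for x
  proof -
    have "(\<Sum>j\<in>{n - idx s..<n}. D j x) = - Z (- s) x" if "s \<in> K" for s
    proof -
      have "(\<Sum>j\<in>{n - idx s..<n}. D j x) = Z (a n) x - Z (a (n - idx s)) x"
        unfolding D_def using sum_Suc_diff'[of "n - idx s" n "\<lambda>j. Z (a j) x"] by simp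
      moreover have "a (n - idx s) = - s" using idx[of s] that unfolding a_def by simp
      moreover have "a n = 0" by (simp add: a_def t(2))
      ultimately show ?thesis using 0[OF \<open>x \<in> space M\<close>] by simp
    qed
    then show ?thesis by (simp add: Y2_def fun_eq_iff)
  qed
  show ?thesis by (rule indep_var_cong_space[OF ind' e1 e2])
qed

text \<open>Cylinder sets form an intersection-stable generator of the path sigma-algebra, and two
  of them involve only finitely many times on each side.\<close>

lemma (in prob_space) gaussian_increments_indep_halves:
  assumes Z[measurable]: "\<And>t. Z t \<in> borel_measurable M" and g: "gaussian_increments M Z"
    and 0: "\<And>x. x \<in> space M \<Longrightarrow> Z 0 x = 0"
  shows "indep_var (PiM {0..} (\<lambda>_. borel)) (\<lambda>x. \<lambda>t\<in>{0..}. Z t x)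
    (PiM {0..} (\<lambda>_. borel)) (\<lambda>x. \<lambda>t\<in>{0..}. Z (- t) x)"
proof -
  let ?P = "PiM {0..} (\<lambda>_. borel) :: (real \<Rightarrow> real) measure"
  let ?R = "\<lambda>x. \<lambda>t\<in>{0..}. Z t x" and ?L = "\<lambda>x. \<lambda>t\<in>{0..}. Z (- t) x"
  let ?G = "prod_algebra {0..} (\<lambda>_. borel) :: (real \<Rightarrow> real) set set"
  have RL: "?R \<in> M \<rightarrow>\<^sub>M ?P" "?L \<in> M \<rightarrow>\<^sub>M ?P" by (auto intro!: measurable_restrict)
  have G: "A \<in> ?G \<Longrightarrow> A \<in> sets ?P" for A by (simp add: sets_PiM sigma_sets.Basic)
  have gen: "sigma_sets (space M) {X -` A \<inter> space M |A. A \<in> sets ?P} = sigma_sets (space M) {X -` A \<inter> space M |A. A \<in> ?G}"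
    if X: "X \<in> M \<rightarrow>\<^sub>M ?P" for X
  proof (rule sigma_sets_eqI)
    fix B assume "B \<in> {X -` A \<inter> space M |A. A \<in> sets ?P}"
    then obtain A where A: "A \<in> sigma_sets (\<Pi>\<^sub>E i\<in>{0..}. space borel) ?G" "B = X -` A \<inter> space M"
      by (auto simp: sets_PiM)
    have "{X -` A \<inter> space M |A. A \<in> sigma_sets (\<Pi>\<^sub>E i\<in>{0..}. space borel) ?G} =
      sigma_sets (space M) {X -` A \<inter> space M |A. A \<in> ?G}"
      by (rule sigma_sets_vimage_commute) (use measurable_space[OF X] in \<open>auto simp: space_PiM\<close>)
    then show "B \<in> sigma_sets (space M) {X -` A \<inter> space M |A. A \<in> ?G}" using A by blast
  next
    fix B assume "B \<in> {X -` A \<inter> space M |A. A \<in> ?G}"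
    then show "B \<in> sigma_sets (space M) {X -` A \<inter> space M |A. A \<in> sets ?P}"
      by (auto simp: sets_PiM intro!: sigma_sets.Basic)
  qed
  have stab: "Int_stable {X -` A \<inter> space M |A. A \<in> ?G}" for X
  proof (rule Int_stableI)
    fix a b assume "a \<in> {X -` A \<inter> space M |A. A \<in> ?G}" "b \<in> {X -` A \<inter> space M |A. A \<in> ?G}"
    then obtain A B where AB: "A \<in> ?G" "B \<in> ?G" "a = X -` A \<inter> space M" "b = X -` B \<inter> space M" by auto
    then have "a \<inter> b = X -` (A \<inter> B) \<inter> space M" "A \<inter> B \<in> ?G"
      using Int_stableD[OF Int_stable_prod_algebra AB(1,2)] by auto
    then show "a \<inter> b \<in> {X -` A \<inter> space M |A. A \<in> ?G}" by blast
  qed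
  have "indep_set {?R -` A \<inter> space M |A. A \<in> ?G} {?L -` A \<inter> space M |A. A \<in> ?G}"
  proof (rule indep_setI)
    show "{?R -` A \<inter> space M |A. A \<in> ?G} \<subseteq> events" "{?L -` A \<inter> space M |A. A \<in> ?G} \<subseteq> events"
      using G measurable_sets[OF RL(1)] measurable_sets[OF RL(2)] by blast+
    fix a b assume "a \<in> {?R -` A \<inter> space M |A. A \<in> ?G}" "b \<in> {?L -` A \<inter> space M |A. A \<in> ?G}"
    then obtain A B where AB: "A \<in> ?G" "B \<in> ?G" "a = ?R -` A \<inter> space M" "b = ?L -` B \<inter> space M" by auto
    obtain J E where J: "A = prod_emb {0..} (\<lambda>_. borel) J (Pi\<^sub>E J E)" "finite J" "J \<subseteq> {0..}" "\<And>i. i \<in> J \<Longrightarrow> E i \<in> sets borel"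
      using prod_algebraE[OF AB(1)] by metis
    obtain K F where K: "B = prod_emb {0..} (\<lambda>_. borel) K (Pi\<^sub>E K F)" "finite K" "K \<subseteq> {0..}" "\<And>i. i \<in> K \<Longrightarrow> F i \<in> sets borel"
      using prod_algebraE[OF AB(2)] by metis
    have a: "a = (\<lambda>x. \<lambda>t\<in>J. Z t x) -` (Pi\<^sub>E J E) \<inter> space M"
      unfolding AB J(1) using J(3) by (auto simp: prod_emb_def space_PiM restrict_restrict Int_absorb1)
    have b: "b = (\<lambda>x. \<lambda>t\<in>K. Z (- t) x) -` (Pi\<^sub>E K F) \<inter> space M"
      unfolding AB K(1) using K(3) by (auto simp: prod_emb_def space_PiM restrict_restrict Int_absorb1)
    have "prob ((\<lambda>x. (\<lambda>t\<in>J. Z t x, \<lambda>t\<in>K. Z (- t) x)) -` (Pi\<^sub>E J E \<times> Pi\<^sub>E K F) \<inter> space M) = prob a * prob b"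
      unfolding a b using J K
      by (intro indep_varD[OF gaussian_increments_indep_finite[OF Z g 0]]) (auto intro!: sets_PiM_I_finite)
    moreover have "(\<lambda>x. (\<lambda>t\<in>J. Z t x, \<lambda>t\<in>K. Z (- t) x)) -` (Pi\<^sub>E J E \<times> Pi\<^sub>E K F) \<inter> space M = a \<inter> b"
      unfolding a b by auto
    ultimately show "prob (a \<inter> b) = prob a * prob b" by simp
  qed
  then have "indep_set (sigma_sets (space M) {?R -` A \<inter> space M |A. A \<in> ?G}) (sigma_sets (space M) {?L -` A \<inter> space M |A. A \<in> ?G})"
    by (intro indep_set_sigma_sets stab)
  then show ?thesis unfolding indep_var_eq gen[OF RL(1)] gen[OF RL(2)] using RL by blast
qed

section \<open>Exponential martingales stopped at a lifetime\<close>

text \<open>The compensated exponential of the increments of \<open>x\<close>, with \<open>c\<close>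
  in the role of the quadratic variation. The clock is a separate argument because stopping and
  clamping act on the path and on its clock alike.\<close>

definition expo :: "(nat \<Rightarrow> real) \<Rightarrow> (nat \<Rightarrow> real) \<Rightarrow> nat \<Rightarrow> (real \<Rightarrow> real) \<Rightarrow> (real \<Rightarrow> real) \<Rightarrow> complex" where
  "expo a l n x c = exp (\<i> * complex_of_real (\<Sum>j<n. l j * (x (a (Suc j)) - x (a j)))
     + complex_of_real ((\<Sum>j<n. (l j)\<^sup>2 * (c (a (Suc j)) - c (a j))) / 2))"

lemma exp_Complex_mult:
  assumes "C = A + A'" "D = B + B'"
  shows "exp (\<i> * complex_of_real C + complex_of_real D) =
    exp (\<i> * complex_of_real A + complex_of_real B) * exp (\<i> * complex_of_real A' + complex_of_real B')"
  unfolding assms by (simp add: exp_add[symmetric] algebra_simps)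

lemma norm_expo: "norm (expo a l n x c) = exp ((\<Sum>j<n. (l j)\<^sup>2 * (c (a (Suc j)) - c (a j))) / 2)"
  unfolding expo_def by (simp only: norm_exp_eq_Re) simp

lemma norm_expo_le:
  assumes "\<And>j. j < n \<Longrightarrow> c (a (Suc j)) - c (a j) \<le> a (Suc j) - a j"
  shows "norm (expo a l n x c) \<le> exp (incr_variance a l n / 2)"
  unfolding norm_expo using assms by (auto intro!: divide_right_mono sum_mono mult_left_mono)

lemma expo_Suc:
  "expo a l (Suc n) x c = expo a l n x c *
     exp (\<i> * complex_of_real (l n * (x (a (Suc n)) - x (a n)))
       + complex_of_real ((l n)\<^sup>2 * (c (a (Suc n)) - c (a n)) / 2))"
  unfolding expo_def by (rule exp_Complex_mult) (simp_all add: add_divide_distrib)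

text \<open>The exponent is linear in path and clock. This is what later turns a product over cycles
  into the exponential of the concatenated path.\<close>

lemma expo_add:
  "expo a l n (\<lambda>t. x t + x' t) (\<lambda>t. c t + c' t) = expo a l n x c * expo a l n x' c'"
  unfolding expo_def
  by (rule exp_Complex_mult)
     (simp_all add: add_divide_distrib[symmetric] sum.distrib[symmetric] algebra_simps)

lemma expo_cong:
  assumes "\<And>j. j \<le> n \<Longrightarrow> x (a j) = x' (a j)" "\<And>j. j \<le> n \<Longrightarrow> c (a j) = c' (a j)"
  shows "expo a l n x c = expo a l n x' c'"
  unfolding expo_def using assms by (auto intro!: arg_cong[where f=exp] arg_cong2[where f="(+)"] sum.cong)

lemma expo_const:
  assumes "\<And>j. j \<le> n \<Longrightarrow> x (a j) = x0" "\<And>j. j \<le> n \<Longrightarrow> c (a j) = c0"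
  shows "expo a l n x c = 1"
  unfolding expo_def using assms by simp

lemma borel_measurable_expo:
  assumes "\<And>j. j \<le> n \<Longrightarrow> (\<lambda>w. x w (a j)) \<in> borel_measurable M" "\<And>j. j \<le> n \<Longrightarrow> (\<lambda>w. c w (a j)) \<in> borel_measurable M"
  shows "(\<lambda>w. expo a l n (x w) (c w)) \<in> borel_measurable M"
proof -
  have [measurable]: "(\<lambda>w. \<Sum>j<n. l j * (x w (a (Suc j)) - x w (a j))) \<in> borel_measurable M"
    "(\<lambda>w. \<Sum>j<n. (l j)\<^sup>2 * (c w (a (Suc j)) - c w (a j))) \<in> borel_measurable M"
    using assms by (auto intro!: borel_measurable_sum borel_measurable_times borel_measurable_diff)
  show ?thesis unfolding expo_def by measurable
qed

locale adapted_brownian_motion = prob_space +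
  fixes F :: "ennreal \<Rightarrow> 'a measure" and B :: "real \<Rightarrow> 'a \<Rightarrow> real"
  assumes filt: "filtration (space M) F" and sets_F: "sets (F t) \<subseteq> sets M"
    and bm: "brownian_motion_wrt M F B"
begin

sublocale filtration "space M" F by (rule filt)

lemma measurable_F_mono: "s \<le> t \<Longrightarrow> f \<in> F s \<rightarrow>\<^sub>M K \<Longrightarrow> f \<in> F t \<rightarrow>\<^sub>M K"
  using sets_F_mono[of s t] by (auto simp: measurable_def space_F)

lemma measurable_F_M: "f \<in> F t \<rightarrow>\<^sub>M K \<Longrightarrow> f \<in> M \<rightarrow>\<^sub>M K"
  using sets_F[of t] by (auto simp: measurable_def space_F)

lemma measurable_B_F: "0 \<le> s \<Longrightarrow> ennreal s \<le> t \<Longrightarrow> B s \<in> borel_measurable (F t)"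
  using bm measurable_F_mono unfolding brownian_motion_wrt_def by blast

lemma measurable_B: "0 \<le> s \<Longrightarrow> B s \<in> borel_measurable M"
  using measurable_B_F[of s "ennreal s"] measurable_F_M by blast

lemma continuous_B: "AE x in M. continuous_on {0..} (\<lambda>t. B t x)"
  using bm unfolding brownian_motion_wrt_def standard_brownian_motion_def by blast

text \<open>The increment is independent of \<open>F s\<close>, and the term with
  \<open>l\<^sup>2\<close> cancels its Gaussian characteristic function.\<close>

lemma integral_increment:
  assumes st: "0 \<le> s" "s \<le> t" and H[measurable]: "H \<in> borel_measurable (F (ennreal s))"
    and bd: "\<And>x. x \<in> space M \<Longrightarrow> norm (H x) \<le> C"
  shows "(\<integral>x. H x * exp (\<i> * complex_of_real (l * (B t x - B s x)) + complex_of_real (l\<^sup>2 * (t - s) / 2)) \<partial>M)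
     = (\<integral>x. H x \<partial>M :: complex)"
proof (cases "s = t")
  case True then show ?thesis by simp
next
  case False
  with st have st': "s < t" by simp
  let ?D = "\<lambda>x. B t x - B s x"
  have D[measurable]: "?D \<in> borel_measurable M" using st by (auto intro!: measurable_B borel_measurable_diff)
  have HM[measurable]: "H \<in> borel_measurable M" using H by (rule measurable_F_M)
  have ind: "indep_set (sets (F (ennreal s))) (sets (vimage_algebra (space M) ?D borel))"
    using bm st st' unfolding brownian_motion_wrt_def by blast
  have iv: "indep_var borel H borel (\<lambda>x. iexp (l * ?D x))"
    unfolding indep_var_eq
  proof (intro conjI)
    have a: "sigma_sets (space M) {H -` A \<inter> space M |A. A \<in> sets borel} \<subseteq> sets (F (ennreal s))"
      using H by (intro sets.sigma_sets_subset[of _ "F (ennreal s)", unfolded space_F]) (auto simp: measurable_def space_F)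
    let ?V = "vimage_algebra (space M) ?D borel"
    have "?D \<in> borel_measurable ?V" by (rule measurable_vimage_algebra1) auto
    then have "(\<lambda>x. iexp (l * ?D x)) \<in> borel_measurable ?V"
      by (rule measurable_compose[where g="\<lambda>d. iexp (l * d)"]) simp
    then have b: "sigma_sets (space M) {(\<lambda>x. iexp (l * ?D x)) -` A \<inter> space M |A. A \<in> sets borel} \<subseteq> sets ?V"
      by (intro sets.sigma_sets_subset[of _ ?V, simplified]) (auto simp: measurable_def)
    show "indep_set (sigma_sets (space M) {H -` A \<inter> space M |A. A \<in> sets borel})
        (sigma_sets (space M) {(\<lambda>x. iexp (l * ?D x)) -` A \<inter> space M |A. A \<in> sets borel})"
      using a b unfolding indep_set_def
      by (intro indep_sets_mono_sets[OF ind[unfolded indep_set_def]]) (simp split: bool.split)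
  next
    show "H \<in> borel_measurable M" by (rule HM)
    show "(\<lambda>x. iexp (l * ?D x)) \<in> borel_measurable M" by (rule measurable_compose[OF D, where g="\<lambda>d. iexp (l * d)"]) simp
  qed
  have Hi: "integrable M H" by (rule integrable_const_bound[where B=C]) (use bd in auto)
  have "(\<lambda>x. iexp (l * ?D x)) \<in> borel_measurable M"
    by (rule measurable_compose[OF D, where g="\<lambda>d. iexp (l * d)"]) simp
  then have Ei: "integrable M (\<lambda>x. iexp (l * ?D x))"
    by (intro integrable_const_bound[where B=1]) auto
  have dist: "distr M lborel ?D = density lborel (normal_density 0 (sqrt (t - s)))"
    using bm st st' unfolding brownian_motion_wrt_def standard_brownian_motion_def distributed_def by blast
  have "distr M lborel ?D = distr M borel ?D" by (rule distr_cong) auto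
  then have "(\<integral>x. iexp (l * ?D x) \<partial>M) = char (density lborel (normal_density 0 (sqrt (t - s)))) l"
    unfolding dist[symmetric] char_def by (simp add: integral_distr)
  also have "\<dots> = exp (- (l\<^sup>2 * (t - s)) / 2)" using st' by (simp add: char_normal_density)
  finally have ch: "(\<integral>x. iexp (l * ?D x) \<partial>M) = exp (- (l\<^sup>2 * (t - s)) / 2)" .
  have "(\<integral>x. H x * exp (\<i> * complex_of_real (l * ?D x) + complex_of_real (l\<^sup>2 * (t - s) / 2)) \<partial>M)
     = (\<integral>x. (H x * iexp (l * ?D x)) * complex_of_real (exp (l\<^sup>2 * (t - s) / 2)) \<partial>M)"
    by (intro Bochner_Integration.integral_cong refl) (simp only: exp_add mult.assoc exp_of_real)
  also have "\<dots> = (\<integral>x. H x \<partial>M) * (complex_of_real (exp (- (l\<^sup>2 * (t - s)) / 2)) * complex_of_real (exp (l\<^sup>2 * (t - s) / 2)))"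
    unfolding integral_mult_left_zero indep_var_lebesgue_integral[OF iv Hi Ei] ch by simp
  also have "complex_of_real (exp (- (l\<^sup>2 * (t - s)) / 2)) * complex_of_real (exp (l\<^sup>2 * (t - s) / 2)) = 1"
    by (simp only: of_real_mult[symmetric] exp_add[symmetric]) simp
  finally show ?thesis by simp
qed

text \<open>The induction peels off the last increment, whose factor is 1 until time passes
  \<open>a n\<close>. If \<open>s < a n < t\<close>, this factor is integrated out from
  \<open>a n\<close> on, with all earlier factors absorbed into the bounded weight, and the
  induction hypothesis covers the stretch from \<open>s\<close> to \<open>a n\<close>.\<close>

lemma expo_martingale:
  assumes a: "mono a" "0 \<le> a 0" and st: "0 \<le> s" "s \<le> t"
    and H: "H \<in> borel_measurable (F (ennreal s))" and bd: "\<And>x. x \<in> space M \<Longrightarrow> norm (H x) \<le> C"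
  shows "(\<integral>x. H x * expo a l n (\<lambda>r. B (min t r) x) (min t) \<partial>M)
     = (\<integral>x. H x * expo a l n (\<lambda>r. B (min s r) x) (min s) \<partial>M)"
  using st H bd
proof (induction n arbitrary: s t H C)
  case 0 then show ?case by (simp add: expo_def)
next
  case (Suc n)
  note st = Suc.prems(1,2) and H = Suc.prems(3) and bd = Suc.prems(4)
  let ?E = "\<lambda>n t x. expo a l n (\<lambda>r. B (min t r) x) (min t)"
  let ?G = "\<lambda>s t x. exp (\<i> * complex_of_real (l n * (B t x - B s x)) + complex_of_real ((l n)\<^sup>2 * (t - s) / 2))"
  have an: "a j \<le> a k" if "j \<le> k" for j k using a(1) that by (auto simp: mono_def)
  have a0: "0 \<le> a j" for j using an[of 0 j] a(2) by simp
  have EF: "?E k r \<in> borel_measurable (F (ennreal r'))" if "0 \<le> r" "r \<le> r'" for k r r'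
    using that a0 by (intro borel_measurable_expo measurable_B_F) (auto intro!: ennreal_leI)
  define K where "K = (\<lambda>k. exp ((\<Sum>j<k. (l j)\<^sup>2 * (a (Suc j) - a j)) / 2))"
  have Eb: "norm (?E k r x) \<le> K k" for k r x
    unfolding K_def
  proof (rule norm_expo_le)
    show "min r (a (Suc j)) - min r (a j) \<le> a (Suc j) - a j" for j
      using an[of j "Suc j"] by (auto simp: min_def)
  qed
  have stop: "?E n t x = ?E n (a n) x" if "a n \<le> t" for t x
    by (intro expo_cong) (simp_all add: min_absorb2 an order.trans[OF an that])
  have HEb: "norm (H x * ?E k r x) \<le> C * K k" if "x \<in> space M" for k r x
    unfolding norm_mult using bd[OF that] Eb by (intro mult_mono) (auto intro: order.trans[OF norm_ge_zero])
  consider "t \<le> a n" | "a n \<le> s" | "s < a n" "a n < t" by linarith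
  then show ?case
  proof cases
    case 1
    have "?E (Suc n) r x = ?E n r x" if "r \<le> a n" for r x
      using that an[of n "Suc n"] by (simp add: expo_Suc min_absorb1)
    then show ?thesis using Suc.IH[OF st H bd] 1 st by simp
  next
    case 2
    have red: "?E (Suc n) r x = ?E n (a n) x * ?G (a n) (min r (a (Suc n))) x" if "a n \<le> r" for r x
      using that an[of n "Suc n"] stop[OF that, of x] by (simp add: expo_Suc min_absorb2)
    show ?thesis
    proof (cases "a (Suc n) \<le> s")
      case True
      then show ?thesis using 2 st by (simp add: red min_absorb2)
    next
      case False
      have H': "(\<lambda>x. H x * ?E (Suc n) s x) \<in> borel_measurable (F (ennreal s))"
        using st H by (intro borel_measurable_times EF) auto
      have "?E (Suc n) t x = ?E (Suc n) s x * ?G s (min t (a (Suc n))) x" for x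
      proof -
        have "?G (a n) (min t (a (Suc n))) x = ?G (a n) s x * ?G s (min t (a (Suc n))) x"
          by (rule exp_Complex_mult)
             (simp_all add: add_divide_distrib[symmetric] algebra_simps)
        then show ?thesis using 2 st False by (simp add: red min_absorb1 mult.assoc)
      qed
      then show ?thesis
        using integral_increment[OF st(1) _ H' HEb, of "min t (a (Suc n))" "l n"] st False
        by (simp add: mult.assoc)
    qed
  next
    case 3
    have red: "?E (Suc n) t x = ?E n (a n) x * ?G (a n) (min t (a (Suc n))) x" for x
      using 3 an[of n "Suc n"] stop[of t x] by (simp add: expo_Suc min_absorb2)
    have H': "(\<lambda>x. H x * ?E n (a n) x) \<in> borel_measurable (F (ennreal (a n)))"
      using 3 a0 by (intro borel_measurable_times EF measurable_F_mono[OF _ H] ennreal_leI) auto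
    have "(\<integral>x. H x * ?E (Suc n) t x \<partial>M) = (\<integral>x. H x * ?E n (a n) x \<partial>M)"
      using integral_increment[OF a0 _ H' HEb, of "min t (a (Suc n))" "l n"] 3 an[of n "Suc n"]
      unfolding red by (simp add: mult.assoc)
    also have "\<dots> = (\<integral>x. H x * ?E n s x \<partial>M)"
      using Suc.IH[OF st(1) _ H bd, of "a n"] 3 by simp
    also have "\<dots> = (\<integral>x. H x * ?E (Suc n) s x \<partial>M)"
      using 3 an[of n "Suc n"] by (simp add: expo_Suc min_absorb1)
    finally show ?thesis .
  qed
qed

text \<open>Nothing happens after \<open>a n\<close>, so \<open>T\<close> can be cut off at a
  horizon even where it is infinite. The bounded time is approximated from above by multiples of a
  mesh: whether the \<open>i\<close>-th multiple is taken is then known at that multiple, and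
  bounded convergence along continuous paths finishes. Measurability of the stopped values is
  assumed because continuity holds only almost surely.\<close>

lemma expo_optional_stopping:
  assumes a: "mono a" "0 \<le> a 0" and T: "stopping_time F T"
    and meas: "\<And>t. 0 \<le> t \<Longrightarrow> (\<lambda>x. B (enn2real (min (ennreal t) (T x))) x) \<in> borel_measurable M"
  shows "(\<integral>x. expo a l n (\<lambda>t. B (enn2real (min (ennreal t) (T x))) x) (\<lambda>t. enn2real (min (ennreal t) (T x))) \<partial>M) = 1"
proof -
  \<comment> \<open>The summand 1 keeps the horizon, and with it the mesh, positive when
    \<open>a n = 0\<close>.\<close>
  define h where "h = a n + 1"
  have an: "a j \<le> a k" if "j \<le> k" for j k using a(1) that by (auto simp: mono_def)
  have a0: "0 \<le> a j" for j using an[of 0 j] a(2) by simp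
  have h: "h > 0" "a n \<le> h" using a0[of n] by (auto simp: h_def)
  define \<tau> where "\<tau> x = enn2real (min (ennreal h) (T x))" for x
  have hfin: "min (ennreal h) (T x) < top" for x by (simp add: min_less_iff_disj)
  have \<tau>le: "\<tau> x \<le> r \<longleftrightarrow> h \<le> r \<or> T x \<le> ennreal r" if "0 \<le> r" for x r
  proof -
    have "\<tau> x \<le> r \<longleftrightarrow> min (ennreal h) (T x) \<le> ennreal r"
      using hfin[of x] that by (metis \<tau>_def enn2real_leI ennreal_enn2real ennreal_leI)
    then show ?thesis using that by (auto simp: min_le_iff_disj)
  qed
  have \<tau>: "0 \<le> \<tau> x" "\<tau> x \<le> h" for x using \<tau>le[of h x] h by (auto simp: \<tau>_def)
  have clock: "enn2real (min (ennreal t) (T x)) = min (\<tau> x) t" if "0 \<le> t" "t \<le> h" for t x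
  proof (cases "T x")
    case (real r)
    have m: "min (ennreal p) (ennreal q) = ennreal (min p q)" if "0 \<le> p" "0 \<le> q" for p q
      using that by (auto simp: min_def)
    show ?thesis using that real h by (simp add: \<tau>_def m)
  next
    case top
    then show ?thesis using that by (simp add: \<tau>_def min_def)
  qed
  let ?E = "\<lambda>t x. expo a l n (\<lambda>r. B (min t r) x) (min t)"
  define K where "K = exp (incr_variance a l n / 2)"
  have Eb: "norm (?E r x) \<le> K" for r x
    unfolding K_def
  proof (rule norm_expo_le)
    show "min r (a (Suc j)) - min r (a j) \<le> a (Suc j) - a j" for j
      using an[of j "Suc j"] by (auto simp: min_def)
  qed
  have EM: "?E r \<in> borel_measurable M" if "0 \<le> r" for r
    using that a0 by (intro borel_measurable_expo measurable_B) auto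
  have EM\<tau>: "(\<lambda>x. ?E (\<tau> x) x) \<in> borel_measurable M"
  proof (rule borel_measurable_expo)
    show "(\<lambda>x. B (min (\<tau> x) (a j)) x) \<in> borel_measurable M" if "j \<le> n" for j
      using meas[OF a0[of j]] clock[OF a0[of j]] an[OF that] h(2) by simp
    have "T \<in> borel_measurable M"
      by (rule measurable_stopping_time[OF T sets_F space_F])
    then show "(\<lambda>x. min (\<tau> x) (a j)) \<in> borel_measurable M" if "j \<le> n" for j
      unfolding \<tau>_def by measurable
  qed
  have Eh: "(\<integral>x. ?E h x \<partial>M) = 1"
  proof -
    have "(\<integral>x. 1 * ?E h x \<partial>M) = (\<integral>x. 1 * ?E 0 x \<partial>M)"
      using h by (intro expo_martingale[OF a, where C=1]) auto
    moreover have "?E 0 x = 1" for x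
      using a0 by (intro expo_const[where ?x0.0="B 0 x" and ?c0.0=0]) (auto simp: min_absorb1)
    ultimately show ?thesis by (simp add: prob_space)
  qed
  define \<delta> where "\<delta> k = h / real (Suc k)" for k
  have \<delta>: "0 < \<delta> k" for k using h by (simp add: \<delta>_def)
  define I where "I k x = nat \<lceil>\<tau> x / \<delta> k\<rceil>" for k x
  define \<tau>' where "\<tau>' k x = \<delta> k * real (I k x)" for k x
  have I_le: "I k x \<le> i \<longleftrightarrow> \<tau> x \<le> \<delta> k * real i" for k x i
    using \<delta>[of k] by (simp add: I_def nat_le_iff ceiling_le_iff field_simps)
  have I_bd: "I k x \<le> Suc k" for k x
    unfolding I_le using \<tau>(2)[of x] by (simp add: \<delta>_def)
  have E\<tau>': "(\<integral>x. ?E (\<tau>' k x) x \<partial>M) = 1" for k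
  proof -
    have sums: "?E (\<tau>' k x) x = (\<Sum>i\<le>Suc k. of_bool (I k x = i) * ?E (\<delta> k * real i) x)" for x
      using I_bd[of k x] unfolding \<tau>'_def by (simp add: of_bool_def if_distrib[of "\<lambda>b. b * _"] sum.delta cong: if_cong del: sum.atMost_Suc)
    have IF: "(\<lambda>x. of_bool (I k x = i) :: complex) \<in> borel_measurable (F (ennreal (\<delta> k * real i)))" for i
    proof -
      have le: "Measurable.pred (F (ennreal (\<delta> k * real i))) (\<lambda>x. I k x \<le> j)" if "j \<le> i" for j
      proof -
        have "0 \<le> \<delta> k * real j" using \<delta>[of k] by simp
        moreover have "Measurable.pred (F (ennreal (\<delta> k * real i))) (\<lambda>x. T x \<le> ennreal (\<delta> k * real j))"
          using \<delta>[of k] that by (intro stopping_time_le_const[OF T] ennreal_leI) simp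
        ultimately show ?thesis unfolding I_le by (simp add: \<tau>le)
      qed
      have "I k x = i \<longleftrightarrow> I k x \<le> i \<and> (i = 0 \<or> \<not> I k x \<le> i - 1)" for x by auto
      then have "Measurable.pred (F (ennreal (\<delta> k * real i))) (\<lambda>x. I k x = i)"
        using le[of i] le[of "i - 1"] by simp
      then show ?thesis by simp
    qed
    have ii: "integrable M (\<lambda>x. of_bool (I k x = i) * ?E r x)" if "0 \<le> r" for i r
      using Eb IF[THEN measurable_F_M] EM[OF that]
      by (intro integrable_const_bound[where B=K]) (auto simp: of_bool_def K_def)
    have "(\<integral>x. ?E (\<tau>' k x) x \<partial>M) = (\<Sum>i\<le>Suc k. (\<integral>x. of_bool (I k x = i) * ?E (\<delta> k * real i) x \<partial>M))"
      unfolding sums using \<delta>[of k] by (intro Bochner_Integration.integral_sum ii) simp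
    \<comment> \<open>On each event \<open>I k x = i\<close> the martingale property moves the time
      forward to the horizon \<open>h\<close>; there the events recombine to the whole
      space.\<close>
    also have "\<dots> = (\<Sum>i\<le>Suc k. (\<integral>x. of_bool (I k x = i) * ?E h x \<partial>M))"
    proof (intro sum.cong refl)
      fix i assume "i \<in> {..Suc k}"
      then have "real i \<le> real (Suc k)" by simp
      then have "\<delta> k * real i \<le> \<delta> k * real (Suc k)" using \<delta>[of k] by (intro mult_left_mono) auto
      then have "\<delta> k * real i \<le> h" unfolding \<delta>_def by simp
      then show "(\<integral>x. of_bool (I k x = i) * ?E (\<delta> k * real i) x \<partial>M) = (\<integral>x. of_bool (I k x = i) * ?E h x \<partial>M)"
        using \<delta>[of k] by (intro expo_martingale[OF a, where C=1, symmetric] IF) (auto simp: of_bool_def)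
    qed
    also have "\<dots> = (\<integral>x. (\<Sum>i\<le>Suc k. of_bool (I k x = i) * ?E h x) \<partial>M)"
      using h by (intro Bochner_Integration.integral_sum[symmetric] ii) simp
    also have "\<dots> = (\<integral>x. ?E h x \<partial>M)"
      using I_bd[of k] by (intro Bochner_Integration.integral_cong refl)
        (simp add: of_bool_def if_distrib[of "\<lambda>b. b * _"] sum.delta cong: if_cong del: sum.atMost_Suc)
    finally show ?thesis using Eh by simp
  qed
  have conv: "(\<lambda>k. \<tau>' k x) \<longlonglongrightarrow> \<tau> x" for x
  proof (rule tendsto_sandwich[where f="\<lambda>_. \<tau> x" and h="\<lambda>k. \<tau> x + \<delta> k"])
    have "\<tau> x \<le> \<tau>' k x" "\<tau>' k x \<le> \<tau> x + \<delta> k" for k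
    proof -
      have "\<tau> x / \<delta> k \<le> real (I k x)" "real (I k x) \<le> \<tau> x / \<delta> k + 1"
        using \<tau>(1)[of x] \<delta>[of k] unfolding I_def by (auto simp: of_nat_nat le_of_int_ceiling less_imp_le[OF ceiling_correct[THEN conjunct1]])
      then show "\<tau> x \<le> \<tau>' k x" "\<tau>' k x \<le> \<tau> x + \<delta> k"
        using \<delta>[of k] unfolding \<tau>'_def by (simp_all add: field_simps)
    qed
    then show "\<forall>\<^sub>F k in sequentially. \<tau> x \<le> \<tau>' k x" "\<forall>\<^sub>F k in sequentially. \<tau>' k x \<le> \<tau> x + \<delta> k" by auto
    have "\<delta> \<longlonglongrightarrow> 0" unfolding \<delta>_def by real_asymp
    then show "(\<lambda>k. \<tau> x + \<delta> k) \<longlonglongrightarrow> \<tau> x" using tendsto_add[of "\<lambda>_. \<tau> x" "\<tau> x" _ \<delta> 0] by simp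
  qed simp
  have "(\<lambda>k. (\<integral>x. ?E (\<tau>' k x) x \<partial>M)) \<longlonglongrightarrow> (\<integral>x. ?E (\<tau> x) x \<partial>M)"
  proof (rule integral_dominated_convergence[where w="\<lambda>_. K"])
    show "(\<lambda>x. ?E (\<tau>' k x) x) \<in> borel_measurable M" for k
    proof -
      have "T \<in> borel_measurable M"
        by (rule measurable_stopping_time[OF T sets_F space_F])
      then have [measurable]: "I k \<in> M \<rightarrow>\<^sub>M count_space UNIV" unfolding I_def \<tau>_def by measurable
      show ?thesis unfolding \<tau>'_def
        by (rule measurable_compose_countable[where g="I k"]) (use EM \<delta>[of k] in auto)
    qed
    show "AE x in M. (\<lambda>k. ?E (\<tau>' k x) x) \<longlonglongrightarrow> ?E (\<tau> x) x"
      using continuous_B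
    proof eventually_elim
      case (elim x)
      have Bc: "(\<lambda>k. B (min (\<tau>' k x) r) x) \<longlonglongrightarrow> B (min (\<tau> x) r) x" if "0 \<le> r" for r
      proof (rule continuous_on_tendsto_compose[OF elim])
        show "(\<lambda>k. min (\<tau>' k x) r) \<longlonglongrightarrow> min (\<tau> x) r" by (intro tendsto_min conv tendsto_const)
      qed (use \<delta> \<tau> that in \<open>auto simp: \<tau>'_def less_imp_le\<close>)
      show ?case unfolding expo_def
        by (intro tendsto_intros Bc a0 conv) auto
    qed
  qed (use EM\<tau> Eb in auto)
  then have "(\<integral>x. ?E (\<tau> x) x \<partial>M) = 1" unfolding E\<tau>' by (simp add: LIMSEQ_const_iff)
  moreover have "?E (\<tau> x) x = expo a l n (\<lambda>t. B (enn2real (min (ennreal t) (T x))) x) (\<lambda>t. enn2real (min (ennreal t) (T x)))" for x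
    using a0 an h by (intro expo_cong) (simp_all add: clock order.trans[OF an h(2)])
  ultimately show ?thesis by simp
qed

text \<open>On the event \<open>T \<le> u\<close> the whole grid lies after \<open>T\<close>, where
  path and clock stand still and the exponential is 1. Removing this part from the total mean 1
  leaves the probability of survival.\<close>

lemma expo_optional_stopping_alive:
  assumes a: "mono a" "0 \<le> a 0" and T: "stopping_time F T"
    and meas: "\<And>t. 0 \<le> t \<Longrightarrow> (\<lambda>x. B (enn2real (min (ennreal t) (T x))) x) \<in> borel_measurable M"
    and u: "0 \<le> u" "u \<le> a 0"
  shows "(\<integral>x. of_bool (ennreal u < T x) * expo a l n (\<lambda>t. B (enn2real (min (ennreal t) (T x))) x) (\<lambda>t. enn2real (min (ennreal t) (T x))) \<partial>M)
    = complex_of_real (prob {x \<in> space M. ennreal u < T x})"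
proof -
  let ?E = "\<lambda>x. expo a l n (\<lambda>t. B (enn2real (min (ennreal t) (T x))) x) (\<lambda>t. enn2real (min (ennreal t) (T x)))"
  have an: "a j \<le> a k" if "j \<le> k" for j k using a(1) that by (auto simp: mono_def)
  have a0: "0 \<le> a j" for j using an[of 0 j] a(2) by simp
  have [measurable]: "T \<in> borel_measurable M"
    by (rule measurable_stopping_time[OF T sets_F space_F])
  have [measurable]: "?E \<in> borel_measurable M"
  proof (rule borel_measurable_expo)
    show "(\<lambda>x. B (enn2real (min (ennreal (a j)) (T x))) x) \<in> borel_measurable M" for j
      by (rule meas[OF a0])
  qed simp
  have E1: "?E x = 1" if "\<not> ennreal u < T x" for x
  proof (rule expo_const)
    show "enn2real (min (ennreal (a j)) (T x)) = enn2real (T x)" for j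
    proof -
      have "u \<le> a j" using an[of 0 j] u by simp
      then have "T x \<le> ennreal (a j)" using that by (meson ennreal_leI leI order.trans)
      then show ?thesis by (simp add: min_absorb2)
    qed
    then show "B (enn2real (min (ennreal (a j)) (T x))) x = B (enn2real (T x)) x" for j by simp
  qed
  have E: "(\<integral>x. ?E x \<partial>M) = 1" by (rule expo_optional_stopping[OF a T meas])
  \<comment> \<open>The Bochner integral of a non-integrable function is 0, so an integral equal to
    1 already gives integrability.\<close>
  then have Ei: "integrable M ?E" using not_integrable_integral_eq by fastforce
  let ?A = "{x \<in> space M. ennreal u < T x}"
  have "(\<integral>x. of_bool (ennreal u < T x) * ?E x \<partial>M) = (\<integral>x. ?E x - (1 - complex_of_real (indicator ?A x)) \<partial>M)"
    using E1 by (intro Bochner_Integration.integral_cong refl) (auto simp: indicator_def)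
  also have "\<dots> = 1 - (\<integral>x. 1 - complex_of_real (indicator ?A x) \<partial>M)"
    unfolding E[symmetric] by (intro Bochner_Integration.integral_diff Ei) (simp add: integrable_const_bound[where B=1])
  also have "(\<integral>x. 1 - complex_of_real (indicator ?A x) \<partial>M) = (\<integral>x. 1 \<partial>M) - (\<integral>x. complex_of_real (indicator ?A x) \<partial>M)"
    by (intro Bochner_Integration.integral_diff) (simp_all add: integrable_const_bound[where B=1])
  also have "\<dots> = 1 - complex_of_real (prob ?A)"
    unfolding integral_complex_of_real by (simp add: prob_space Int_absorb2)
  finally show ?thesis by simp
qed

end

section \<open>Balanced transport along an ergodic shift\<close>

locale ergodic_shift = prob_space +
  fixes \<theta> :: "int \<Rightarrow> 'a \<Rightarrow> 'a"
  assumes measurable_shift[measurable]: "\<theta> d \<in> M \<rightarrow>\<^sub>M M"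
    and distr_shift: "distr M M (\<theta> d) = M"
    and shift_shift: "x \<in> space M \<Longrightarrow> \<theta> d (\<theta> e x) = \<theta> (d + e) x"
    and shift_0: "x \<in> space M \<Longrightarrow> \<theta> 0 x = x"
    and ergodic: "A \<in> events \<Longrightarrow> (\<And>d. \<theta> d -` A \<inter> space M = A) \<Longrightarrow> prob A = 0 \<or> prob A = 1"
begin

lemma nn_integral_shift: "g \<in> borel_measurable M \<Longrightarrow> (\<integral>\<^sup>+x. g (\<theta> d x) \<partial>M) = (\<integral>\<^sup>+x. g x \<partial>M)"
  using nn_integral_distr[of "\<theta> d" M M g] by (simp add: distr_shift)

lemma shift_in_space: "x \<in> space M \<Longrightarrow> \<theta> d x \<in> space M"
  using measurable_space[OF measurable_shift] .

text \<open>
  Every site supplies one unit of mass, and a site with environment \<open>x\<close> demands \<open>f x\<close>. In step \<open>n\<close>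
  each site ships as much as possible to the site at displacement \<open>int_decode n\<close>. The two
  components are the mass shipped and the mass received before step \<open>n\<close>.
\<close>

primrec shipped_received :: "('a \<Rightarrow> ennreal) \<Rightarrow> nat \<Rightarrow> ('a \<Rightarrow> ennreal) \<times> ('a \<Rightarrow> ennreal)" where
  "shipped_received f 0 = (\<lambda>_. 0, \<lambda>_. 0)"
| "shipped_received f (Suc n) =
    (let (A, R) = shipped_received f n;
         m = (\<lambda>x. min (1 - A x) (f (\<theta> (int_decode n) x) - R (\<theta> (int_decode n) x)))
     in (\<lambda>x. A x + m x, \<lambda>x. R x + m (\<theta> (- int_decode n) x)))"

definition "shipped f n = fst (shipped_received f n)"
definition "received f n = snd (shipped_received f n)"
definition "shipment f n x =
  min (1 - shipped f n x) (f (\<theta> (int_decode n) x) - received f n (\<theta> (int_decode n) x))"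

lemma shipped_simps:
  "shipped f 0 x = 0" "shipped f (Suc n) x = shipped f n x + shipment f n x"
  "received f 0 x = 0" "received f (Suc n) x = received f n x + shipment f n (\<theta> (- int_decode n) x)"
  by (simp_all add: shipped_def received_def shipment_def Let_def split: prod.split)

lemma measurable_shipped:
  assumes [measurable]: "f \<in> borel_measurable M"
  shows "shipped f n \<in> borel_measurable M \<and> received f n \<in> borel_measurable M \<and> shipment f n \<in> borel_measurable M"
proof -
  have S: "shipment f n \<in> borel_measurable M"
    if [measurable]: "shipped f n \<in> borel_measurable M" "received f n \<in> borel_measurable M" for n
    unfolding shipment_def[abs_def] by measurable
  have "shipped f n \<in> borel_measurable M \<and> received f n \<in> borel_measurable M" for n
  proof (induction n)
    case 0
    show ?case by (simp add: shipped_simps[abs_def])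
  next
    case (Suc n)
    then have [measurable]: "shipped f n \<in> borel_measurable M" "received f n \<in> borel_measurable M"
      "shipment f n \<in> borel_measurable M" using S by auto
    show ?case unfolding shipped_simps[abs_def] by (intro conjI) measurable
  qed
  with S show ?thesis by blast
qed

lemma shipped_eq_sum: "shipped f n x = (\<Sum>k<n. shipment f k x)"
  and received_eq_sum: "received f n x = (\<Sum>k<n. shipment f k (\<theta> (- int_decode k) x))"
  by (induction n) (simp_all add: shipped_simps)

lemma shipped_le: "shipped f n x \<le> 1"
proof (induction n)
  case (Suc n)
  have "shipped f (Suc n) x \<le> shipped f n x + (1 - shipped f n x)"
    unfolding shipped_simps shipment_def by (intro add_left_mono) simp
  with Suc show ?case by (simp add: add_diff_inverse_ennreal)
qed (simp add: shipped_simps)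

lemma received_le:
  assumes "x \<in> space M"
  shows "received f n x \<le> f x"
proof (induction n)
  case (Suc n)
  have "\<theta> (int_decode n) (\<theta> (- int_decode n) x) = x"
    using assms by (simp add: shift_shift shift_0)
  then have "received f (Suc n) x \<le> received f n x + (f x - received f n x)"
    unfolding shipped_simps shipment_def by (intro add_left_mono) simp
  with Suc show ?case by (simp add: add_diff_inverse_ennreal)
qed (simp add: shipped_simps)

text \<open>The shipment is a minimum: attained by its first argument, it exhausts the supply at the
  source; attained by the second, it meets the demand at the target.\<close>

lemma shipped_or_received_full:
  assumes x: "x \<in> space M"
  shows "shipped f (Suc n) x = 1 \<or> received f (Suc n) (\<theta> (int_decode n) x) = f (\<theta> (int_decode n) x)"
proof -
  let ?z = "\<theta> (int_decode n) x"
  have "\<theta> (- int_decode n) ?z = x" using x by (simp add: shift_shift shift_0)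
  then have "received f (Suc n) ?z = received f n ?z + shipment f n x" by (simp add: shipped_simps)
  moreover have "received f n ?z \<le> f ?z" by (rule received_le) (rule shift_in_space[OF x])
  moreover have "shipment f n x = 1 - shipped f n x \<or> shipment f n x = f ?z - received f n ?z"
    unfolding shipment_def by (auto simp: min_def)
  ultimately show ?thesis
    using shipped_le[of f n x] by (metis shipped_simps(2) add_diff_inverse_ennreal)
qed

lemma balanced_transport:
  assumes f[measurable]: "f \<in> borel_measurable M" and f1: "(\<integral>\<^sup>+x. f x \<partial>M) = 1"
  shows "AE x in M. (\<Sum>n. shipment f n x) = 1"
    and "AE x in M. (\<Sum>n. shipment f n (\<theta> (- int_decode n) x)) = f x"
proof -
  define A where "A x = (\<Sum>n. shipment f n x)" for x
  define R where "R x = (\<Sum>n. shipment f n (\<theta> (- int_decode n) x))" for x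
  have m[measurable]: "shipment f n \<in> borel_measurable M" for n using measurable_shipped[OF f] by blast
  have [measurable]: "A \<in> borel_measurable M" "R \<in> borel_measurable M" unfolding A_def R_def by measurable
  have A_ge: "shipped f n x \<le> A x" for n x
    unfolding A_def shipped_eq_sum by (intro sum_le_suminf) auto
  have R_ge: "received f n x \<le> R x" for n x
    unfolding R_def received_eq_sum by (intro sum_le_suminf) auto
  have A_le: "A x \<le> 1" for x
    unfolding A_def by (intro suminf_le_const) (use shipped_le[of f _ x] in \<open>auto simp: shipped_eq_sum\<close>)
  have R_le: "R x \<le> f x" if "x \<in> space M" for x
    unfolding R_def by (intro suminf_le_const) (use received_le[OF that, of f] in \<open>auto simp: received_eq_sum\<close>)
  \<comment> \<open>Mass transport: over each displacement, the mean mass that a site sends equals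
    the mean mass that it receives.\<close>
  have AR: "(\<integral>\<^sup>+x. A x \<partial>M) = (\<integral>\<^sup>+x. R x \<partial>M)"
    unfolding A_def R_def by (simp add: nn_integral_suminf nn_integral_shift)
  have eqI: "AE x in M. g x = h x"
    if [measurable]: "g \<in> borel_measurable M" "h \<in> borel_measurable M"
      and "\<And>x. x \<in> space M \<Longrightarrow> g x \<le> h x" "(\<integral>\<^sup>+x. g x \<partial>M) = 1" "(\<integral>\<^sup>+x. h x \<partial>M) = 1" for g h :: "'a \<Rightarrow> ennreal"
  proof -
    have "(\<integral>\<^sup>+x. h x - g x \<partial>M) = 0"
      using that by (subst nn_integral_diff) auto
    then have "AE x in M. h x - g x = 0" by (subst (asm) nn_integral_0_iff_AE) auto
    then show ?thesis using that(3) by (auto simp: diff_eq_0_iff_ennreal intro: antisym)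
  qed
  \<comment> \<open>The event that some site is left with unshipped mass. Quantifying over all
    translates makes it shift-invariant.\<close>
  define Bad where "Bad = {x \<in> space M. \<exists>d. A (\<theta> d x) \<noteq> 1}"
  have Bad[measurable]: "Bad \<in> sets M" unfolding Bad_def by measurable
  have "\<theta> e -` Bad \<inter> space M = Bad" for e
  proof (intro equalityI subsetI)
    fix x assume "x \<in> \<theta> e -` Bad \<inter> space M"
    then have x: "\<theta> e x \<in> Bad" "x \<in> space M" by auto
    then obtain d where "A (\<theta> d (\<theta> e x)) \<noteq> 1" by (auto simp: Bad_def)
    then show "x \<in> Bad" using x by (auto simp: Bad_def shift_shift)
  next
    fix x assume x: "x \<in> Bad"
    then obtain d where d: "A (\<theta> d x) \<noteq> 1" "x \<in> space M" by (auto simp: Bad_def)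
    then have "A (\<theta> (d - e) (\<theta> e x)) \<noteq> 1" by (simp add: shift_shift)
    then show "x \<in> \<theta> e -` Bad \<inter> space M" using d shift_in_space by (auto simp: Bad_def)
  qed
  from ergodic[OF Bad this] have "(AE x in M. A x = 1) \<or> (AE x in M. R x = f x)"
  proof
    assume "prob Bad = 0"
    then have "AE x in M. x \<notin> Bad" by (intro AE_not_in) (simp add: null_sets_def emeasure_eq_measure)
    then have "AE x in M. A x = 1"
      using AE_space
    proof eventually_elim
      case (elim x)
      then have "A (\<theta> 0 x) = 1" unfolding Bad_def by blast
      then show ?case using shift_0[OF elim(2)] by simp
    qed
    then show ?thesis ..
  next
    assume "prob Bad = 1"
    then have "AE x in M. x \<in> Bad" by (rule AE_prob_1)
    then have "AE x in M. R x = f x"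
    proof eventually_elim
      case (elim x)
      then obtain d where d: "A (\<theta> d x) \<noteq> 1" and x: "x \<in> space M" by (auto simp: Bad_def)
      \<comment> \<open>The step in which the site at \<open>d\<close> ships to the origin, which
        lies at displacement \<open>- d\<close> from it. Since that site is not exhausted, the
        demand at the origin is met.\<close>
      define n where "n = int_encode (- d)"
      have "\<theta> (int_decode n) (\<theta> d x) = x" using x by (simp add: n_def shift_shift shift_0)
      moreover have "shipped f (Suc n) (\<theta> d x) \<noteq> 1"
        using d A_ge[of "Suc n" "\<theta> d x"] A_le[of "\<theta> d x"] by (metis antisym)
      ultimately have "received f (Suc n) x = f x"
        using shipped_or_received_full[OF shift_in_space[OF x], of f n d] by simp
      then show "R x = f x" using R_ge[of "Suc n" x] R_le[OF x] by (metis antisym)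
    qed
    then show ?thesis ..
  qed
  \<comment> \<open>Either alternative gives one of the two means the value 1, and \<open>AR\<close>
    passes it to the other. Both pointwise bounds then have to be equalities almost surely.\<close>
  then have "(\<integral>\<^sup>+x. A x \<partial>M) = (\<integral>\<^sup>+x. 1 \<partial>M) \<or> (\<integral>\<^sup>+x. R x \<partial>M) = (\<integral>\<^sup>+x. f x \<partial>M)"
    by (elim disjE) ((rule disjI1, erule nn_integral_cong_AE), (rule disjI2, erule nn_integral_cong_AE))
  then have A1: "(\<integral>\<^sup>+x. A x \<partial>M) = 1" and R1: "(\<integral>\<^sup>+x. R x \<partial>M) = 1"
    unfolding AR f1 by (simp_all add: emeasure_space_1)
  show "AE x in M. A x = 1"
    by (rule eqI) (use A1 A_le in \<open>simp_all add: emeasure_space_1\<close>)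
  show "AE x in M. R x = f x"
    by (rule eqI) (use R1 f1 R_le in simp_all)
qed

lemma shipment_le: "shipment f n x \<le> f (\<theta> (int_decode n) x)"
  unfolding shipment_def by (rule min.coboundedI2) (rule diff_le_self_ennreal)

end

section \<open>Mixing and ergodicity of the shift of an i.i.d. sequence\<close>

text \<open>The passage from a generator to all events in a proof of mixing. It serves twice, with
  \<open>\<mu> n A\<close> the probability that \<open>A\<close> meets a shifted event, and that the
  shifted \<open>A\<close> meets a fixed event. The bound by \<open>prob\<close>, uniform in
  \<open>n\<close>, dominates the series over a disjoint union.\<close>

lemma (in prob_space) tendsto_prob_dynkin:
  fixes \<mu> :: "nat \<Rightarrow> 'a set \<Rightarrow> real"
  assumes G: "Int_stable G" "G \<subseteq> Pow (space M)" "sets M = sigma_sets (space M) G"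
    and nonneg: "\<And>n A. A \<in> sets M \<Longrightarrow> 0 \<le> \<mu> n A" and le: "\<And>n A. A \<in> sets M \<Longrightarrow> \<mu> n A \<le> prob A"
    and sums: "\<And>n (A :: nat \<Rightarrow> 'a set). disjoint_family A \<Longrightarrow> range A \<subseteq> sets M \<Longrightarrow> (\<lambda>i. \<mu> n (A i)) sums \<mu> n (\<Union>i. A i)"
    and compl: "\<And>n A. A \<in> sets M \<Longrightarrow> \<mu> n (space M - A) = \<mu> n (space M) - \<mu> n A"
    and space: "\<And>n. \<mu> n (space M) = c"
    and lim: "\<And>A. A \<in> G \<Longrightarrow> (\<lambda>n. \<mu> n A) \<longlonglongrightarrow> c * prob A"
    and A: "A \<in> sets M"
  shows "(\<lambda>n. \<mu> n A) \<longlonglongrightarrow> c * prob A"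
proof -
  from A have "A \<in> sigma_sets (space M) G" using G by simp
  from G(1,2) this show ?thesis
  proof (induction rule: sigma_sets_induct_disjoint)
    case (basic A) then show ?case by (rule lim)
  next
    case empty
    have "\<mu> n {} = 0" for n using nonneg[of "{}" n] le[of "{}" n] by simp
    then show ?case by simp
  next
    case (compl A)
    then have "A \<in> sets M" using G by simp
    moreover have "(\<lambda>n. c - \<mu> n A) \<longlonglongrightarrow> c - c * prob A" by (intro tendsto_intros compl)
    ultimately show ?case by (simp add: assms(7) space prob_compl algebra_simps)
  next
    case (union A)
    have A: "A i \<in> sets M" for i using union G by auto
    have "(\<lambda>i. prob (A i)) sums prob (\<Union>i. A i)"
      using union A by (intro finite_measure_UNION) auto
    then have su: "summable (\<lambda>i. prob (A i))" and s: "(\<Sum>i. c * prob (A i)) = c * prob (\<Union>i. A i)"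
      by (auto simp: sums_iff suminf_mult)
    have "(\<lambda>n. \<Sum>i. \<mu> n (A i)) \<longlonglongrightarrow> (\<Sum>i. c * prob (A i))"
      by (rule tannerys_theorem[where M="\<lambda>i. prob (A i)", THEN conjunct2, THEN conjunct2])
         (use union su nonneg[OF A] le[OF A] in \<open>auto simp: case_prod_unfold\<close>)
    moreover have "(\<Sum>i. \<mu> n (A i)) = \<mu> n (\<Union>i. A i)" for n
      using sums[of A n] union A by (simp add: sums_iff image_subset_iff)
    ultimately show ?case by (simp add: s)
  qed
qed

definition shift_seq :: "int \<Rightarrow> (int \<Rightarrow> 'c) \<Rightarrow> int \<Rightarrow> 'c" where
  "shift_seq d y = (\<lambda>k. y (k + d))"

text \<open>After a long shift two cylinder events depend on disjoint coordinates and are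
  independent. The limit relation extends to all events, first in one argument and then in the
  other; for an invariant event it says that its probability equals its own square.\<close>

lemma ergodic_shift_iid:
  assumes D: "prob_space D"
  shows "ergodic_shift (PiM UNIV (\<lambda>_. D)) shift_seq"
proof -
  let ?P = "PiM UNIV (\<lambda>_ :: int. D)"
  interpret D: prob_space D by fact
  interpret P: product_prob_space "\<lambda>_ :: int. D" UNIV ..
  have meas[measurable]: "shift_seq d \<in> ?P \<rightarrow>\<^sub>M ?P" for d
    unfolding shift_seq_def by (rule measurable_PiM_single') (auto simp: space_PiM)
  have distr: "distr ?P ?P (shift_seq d) = ?P" for d
  proof -
    have "distr ?P ?P (\<lambda>\<omega>. \<lambda>n\<in>UNIV. \<omega> (n + d)) = ?P"
      by (rule distr_PiM_reindex[where f="\<lambda>k. k + d"]) (auto simp: D inj_on_def)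
    then show ?thesis by (simp add: shift_seq_def[abs_def] restrict_UNIV)
  qed
  have prob_shift: "P.prob (shift_seq d -` A \<inter> space ?P) = P.prob A" if "A \<in> sets ?P" for d A
    using measure_distr[of "shift_seq d" ?P ?P A] that by (simp add: distr)
  let ?C = "\<lambda>J X. prod_emb UNIV (\<lambda>_. D) J (\<Pi>\<^sub>E j\<in>J. X j)"
  have C: "?C J X = {y \<in> space ?P. \<forall>j\<in>J. y j \<in> X j}" for J :: "int set" and X
    by (auto simp: prod_emb_def space_PiM PiE_iff)
  have Cprob: "P.prob (?C J X) = (\<Prod>j\<in>J. D.prob (X j))" if "finite J" "\<And>j. j \<in> J \<Longrightarrow> X j \<in> sets D" for J X
    using P.emeasure_PiM_emb[of J X] that
    by (simp add: P.emeasure_eq_measure D.emeasure_eq_measure prod_ennreal prod_nonneg)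
  let ?G = "prod_algebra UNIV (\<lambda>_ :: int. D)"
  have G: "Int_stable ?G" "?G \<subseteq> Pow (space ?P)" "sets ?P = sigma_sets (space ?P) ?G"
    using prod_algebra_sets_into_space[of UNIV "\<lambda>_ :: int. D"]
    by (simp_all add: Int_stable_prod_algebra sets_PiM space_PiM)
  have G_sets: "A \<in> sets ?P" if "A \<in> ?G" for A using that G(3) by auto
  have cyl: "(\<lambda>n. P.prob (E \<inter> (shift_seq (int n) -` F \<inter> space ?P))) \<longlonglongrightarrow> P.prob F * P.prob E"
    if E: "E \<in> ?G" and F: "F \<in> ?G" for E F
  proof -
    obtain J X where J: "E = ?C J X" "finite J" "\<And>i. i \<in> J \<Longrightarrow> X i \<in> sets D"
      using prod_algebraE[OF E] by metis
    obtain K Y where K: "F = ?C K Y" "finite K" "\<And>i. i \<in> K \<Longrightarrow> Y i \<in> sets D"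
      using prod_algebraE[OF F] by metis
    have pE: "P.prob E = (\<Prod>j\<in>J. D.prob (X j))" unfolding J(1) by (rule Cprob) (use J in auto)
    have pF: "P.prob F = (\<Prod>j\<in>K. D.prob (Y j))" unfolding K(1) by (rule Cprob) (use K in auto)
    obtain N :: int where N: "\<And>j k. j \<in> J \<Longrightarrow> k \<in> K \<Longrightarrow> j - k < N"
    proof -
      have fin: "finite ((\<lambda>(j, k). j - k) ` (J \<times> K))" using J K by simp
      obtain N where "\<forall>x \<in> (\<lambda>(j, k). j - k) ` (J \<times> K). x \<le> N"
        using bdd_above_finite[OF fin] by (auto simp: bdd_above_def)
      then show ?thesis by (intro that[of "N + 1"]) force
    qed
    have "P.prob (E \<inter> (shift_seq (int n) -` F \<inter> space ?P)) = P.prob F * P.prob E" if n: "N \<le> int n" for n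
    proof -
      let ?K = "(\<lambda>k. k + int n) ` K"
      have disj: "J \<inter> ?K = {}" using N n by force
      let ?Z = "\<lambda>j. if j \<in> J then X j else Y (j - int n)"
      have eqn: "E \<inter> (shift_seq (int n) -` F \<inter> space ?P) = ?C (J \<union> ?K) ?Z"
        unfolding J K C using disj measurable_space[OF meas]
        by (auto simp: shift_seq_def ball_Un)
      have "P.prob (E \<inter> (shift_seq (int n) -` F \<inter> space ?P)) = (\<Prod>j\<in>J \<union> ?K. D.prob (?Z j))"
        unfolding eqn by (rule Cprob) (use J K in auto)
      also have "\<dots> = (\<Prod>j\<in>J. D.prob (?Z j)) * (\<Prod>j\<in>?K. D.prob (?Z j))"
        by (rule prod.union_disjoint) (use J(2) K(2) disj in auto)
      also have "(\<Prod>j\<in>J. D.prob (?Z j)) = P.prob E"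
        unfolding pE by (rule prod.cong) auto
      also have "(\<Prod>j\<in>?K. D.prob (?Z j)) = (\<Prod>j\<in>?K. D.prob (Y (j - int n)))"
        by (rule prod.cong) (use disj in auto)
      also have "\<dots> = P.prob F"
        unfolding pF by (subst prod.reindex) (auto simp: inj_on_def)
      finally show ?thesis by (simp only: mult.commute)
    qed
    moreover have "eventually (\<lambda>n. N \<le> int n) sequentially"
      using eventually_ge_at_top[of "nat N"] by eventually_elim auto
    ultimately show ?thesis
      by (intro tendsto_eventually) (auto elim: eventually_mono)
  qed
  have mix1: "(\<lambda>n. P.prob (E \<inter> (shift_seq (int n) -` F \<inter> space ?P))) \<longlonglongrightarrow> P.prob F * P.prob E"
    if E: "E \<in> sets ?P" and F: "F \<in> ?G" for E F
  proof (rule P.tendsto_prob_dynkin[OF G _ _ _ _ _ _ E])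
    have F': "F \<in> sets ?P" using F by (rule G_sets)
    let ?F = "\<lambda>n. shift_seq (int n) -` F \<inter> space ?P"
    have F'': "?F n \<in> sets ?P" for n using measurable_sets[OF meas F'] .
    show "P.prob (A \<inter> ?F n) \<le> P.prob A" if "A \<in> sets ?P" for n A
      using that by (intro P.finite_measure_mono) auto
    show "(\<lambda>i. P.prob (A i \<inter> ?F n)) sums P.prob ((\<Union>i. A i) \<inter> ?F n)"
      if "disjoint_family A" "range A \<subseteq> sets ?P" for A :: "nat \<Rightarrow> _" and n
    proof -
      have "(\<lambda>i. P.prob (A i \<inter> ?F n)) sums P.prob (\<Union>i. A i \<inter> ?F n)"
        using that F'' by (intro P.finite_measure_UNION) (auto simp: disjoint_family_on_def)
      then show ?thesis by (simp only: UN_extend_simps)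
    qed
    show "P.prob ((space ?P - A) \<inter> ?F n) = P.prob (space ?P \<inter> ?F n) - P.prob (A \<inter> ?F n)" if "A \<in> sets ?P" for n A
    proof -
      have "(space ?P - A) \<inter> ?F n = space ?P \<inter> ?F n - A \<inter> ?F n" by auto
      then show ?thesis using that F'' by (simp only: P.finite_measure_Diff sets.Int sets.top Int_mono[OF sets.sets_into_space order_refl])
    qed
    show "P.prob (space ?P \<inter> ?F n) = P.prob F" for n
      using prob_shift[OF F'] by (simp add: Int_absorb1)
  qed (use cyl F in auto)
  have mix: "(\<lambda>n. P.prob (E \<inter> (shift_seq (int n) -` F \<inter> space ?P))) \<longlonglongrightarrow> P.prob E * P.prob F"
    if E: "E \<in> sets ?P" and F: "F \<in> sets ?P" for E F
  proof (rule P.tendsto_prob_dynkin[OF G _ _ _ _ _ _ F])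
    let ?S = "\<lambda>n A. shift_seq (int n) -` A \<inter> space ?P"
    have S: "?S n A \<in> sets ?P" if "A \<in> sets ?P" for n A using measurable_sets[OF meas that] .
    show "P.prob (E \<inter> ?S n A) \<le> P.prob A" if "A \<in> sets ?P" for n A
    proof -
      have "P.prob (E \<inter> ?S n A) \<le> P.prob (?S n A)" by (intro P.finite_measure_mono S that) auto
      then show ?thesis unfolding prob_shift[OF that] .
    qed
    show "(\<lambda>i. P.prob (E \<inter> ?S n (A i))) sums P.prob (E \<inter> ?S n (\<Union>i. A i))"
      if "disjoint_family A" "range A \<subseteq> sets ?P" for A :: "nat \<Rightarrow> _" and n
    proof -
      have "(\<lambda>i. P.prob (E \<inter> ?S n (A i))) sums P.prob (\<Union>i. E \<inter> ?S n (A i))"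
        using that E S by (intro P.finite_measure_UNION) (auto simp: disjoint_family_on_def)
      moreover have "(\<Union>i. E \<inter> ?S n (A i)) = E \<inter> ?S n (\<Union>i. A i)" by auto
      ultimately show ?thesis by simp
    qed
    show "P.prob (E \<inter> ?S n (space ?P - A)) = P.prob (E \<inter> ?S n (space ?P)) - P.prob (E \<inter> ?S n A)" if "A \<in> sets ?P" for n A
    proof -
      have "E \<inter> ?S n (space ?P - A) = E \<inter> ?S n (space ?P) - E \<inter> ?S n A" by auto
      moreover have "E \<inter> ?S n A \<subseteq> E \<inter> ?S n (space ?P)" using sets.sets_into_space[OF that] by auto
      ultimately show ?thesis
        using that E S P.finite_measure_Diff[of "E \<inter> ?S n (space ?P)" "E \<inter> ?S n A"] by auto
    qed
    have "?S n (space ?P) = space ?P" for n using measurable_space[OF meas] by blast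
    then show "P.prob (E \<inter> ?S n (space ?P)) = P.prob E" for n
      using sets.sets_into_space[OF E] by (simp add: Int_absorb2)
    show "(\<lambda>n. P.prob (E \<inter> ?S n A)) \<longlonglongrightarrow> P.prob E * P.prob A" if "A \<in> ?G" for A
      using mix1[OF E that] by (simp add: mult.commute)
  qed auto
  show ?thesis
  proof
    show "shift_seq d (shift_seq e x) = shift_seq (d + e) x" for d e :: int and x :: "int \<Rightarrow> 'a"
      by (simp add: shift_seq_def ac_simps)
    show "shift_seq 0 x = x" for x :: "int \<Rightarrow> 'a" by (simp add: shift_seq_def)
    fix A assume A: "A \<in> sets ?P" and inv: "\<And>d. shift_seq d -` A \<inter> space ?P = A"
    have "(\<lambda>n :: nat. P.prob A) \<longlonglongrightarrow> P.prob A * P.prob A"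
      using mix[OF A A] by (simp add: inv)
    then have "P.prob A = P.prob A * P.prob A" by (simp add: LIMSEQ_const_iff)
    then show "P.prob A = 0 \<or> P.prob A = 1" by auto
  qed (auto simp: distr meas)
qed

section \<open>Concatenation of cycles\<close>

text \<open>
  Point evaluation of a path is measurable in the path but not jointly in path and time, since the
  product \<open>\<sigma>\<close>-algebra ignores continuity. Evaluating through a limit along a grid repairs this;
  negative times are sent to \<open>0\<close>, because \<^term>\<open>nat\<close> truncates.
\<close>

definition path_at :: "ennreal \<times> (real \<Rightarrow> real) \<Rightarrow> real \<Rightarrow> real" where
  "path_at c t = lim (\<lambda>n. snd c (real (nat \<lfloor>real (Suc n) * t\<rfloor>) / real (Suc n)))"

definition dur :: "ennreal \<times> (real \<Rightarrow> real) \<Rightarrow> real" where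
  "dur c = enn2real (fst c)"

lemma dur_nonneg [simp]: "0 \<le> dur c"
  by (simp add: dur_def)

lemma measurable_path_at:
  assumes [measurable]: "f \<in> M \<rightarrow>\<^sub>M lifetime_path_space" "g \<in> borel_measurable M"
  shows "(\<lambda>x. path_at (f x) (g x)) \<in> borel_measurable M"
  unfolding path_at_def
proof (rule borel_measurable_lim_metric)
  fix n
  show "(\<lambda>x. snd (f x) (real (nat \<lfloor>real (Suc n) * g x\<rfloor>) / real (Suc n))) \<in> borel_measurable M"
  proof (rule measurable_compose_countable[where g="\<lambda>x. nat \<lfloor>real (Suc n) * g x\<rfloor>"])
    show "(\<lambda>x. snd (f x) (real i / real (Suc n))) \<in> borel_measurable M" for i
      by (rule measurable_compose[OF measurable_compose[OF assms(1) measurable_snd] measurable_component_singleton]) simp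
  qed measurable
qed

lemma measurable_dur [measurable]: "dur \<in> borel_measurable lifetime_path_space"
  unfolding dur_def by measurable

lemma enn2real_min_ennreal:
  assumes "0 \<le> t" "T < \<infinity>"
  shows "enn2real (min (ennreal t) T) = min t (enn2real T)"
  using assms by (cases T) (auto simp: min_def)

lemma path_at_lifetime_path:
  assumes c: "continuous_on {0..} (\<lambda>t. B t \<omega>)" and T: "T \<omega> < \<infinity>"
  shows "path_at (lifetime_path T B \<omega>) t = B (min (max 0 t) (enn2real (T \<omega>))) \<omega>"
proof -
  define r where "r n = real (nat \<lfloor>real (Suc n) * t\<rfloor>) / real (Suc n)" for n
  have "r \<longlonglongrightarrow> max 0 t"
  proof (cases "0 \<le> t")
    case True
    have "t - 1 / real (Suc n) \<le> r n \<and> r n \<le> t" for n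
    proof -
      have "real (nat \<lfloor>real (Suc n) * t\<rfloor>) = of_int \<lfloor>real (Suc n) * t\<rfloor>" using True by simp
      moreover have "of_int \<lfloor>real (Suc n) * t\<rfloor> \<le> real (Suc n) * t" "real (Suc n) * t - 1 \<le> of_int \<lfloor>real (Suc n) * t\<rfloor>"
        by linarith+
      moreover have "0 < real (Suc n)" by simp
      moreover have "t - 1 / K \<le> F / K \<and> F / K \<le> t" if "F \<le> K * t" "K * t - 1 \<le> F" "0 < K" for F K :: real
        using that divide_right_mono[of F "K * t" K] divide_right_mono[of "K * t - 1" F K]
        by (simp add: diff_divide_distrib)
      ultimately show ?thesis unfolding r_def by metis
    qed
    moreover have "(\<lambda>n. t - 1 / real (Suc n)) \<longlonglongrightarrow> t" by real_asymp
    ultimately have "r \<longlonglongrightarrow> t"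
      by (intro tendsto_sandwich[of "\<lambda>n. t - 1 / real (Suc n)" r _ "\<lambda>_. t" t]) auto
    then show ?thesis using True by (simp add: max_absorb2)
  next
    case False
    then have "real (Suc n) * t \<le> 0" for n by (intro mult_nonneg_nonpos) auto
    then have "\<lfloor>real (Suc n) * t\<rfloor> \<le> 0" for n using floor_mono[of "real (Suc n) * t" 0] by simp
    then have "r n = 0" for n unfolding r_def by (simp only: nat_0_iff[THEN iffD2])
    then have "r = (\<lambda>_. 0)" by (rule ext)
    then show ?thesis using False by simp
  qed
  then have "(\<lambda>n. min (r n) (enn2real (T \<omega>))) \<longlonglongrightarrow> min (max 0 t) (enn2real (T \<omega>))"
    by (intro tendsto_intros)
  then have "(\<lambda>n. B (min (r n) (enn2real (T \<omega>))) \<omega>) \<longlonglongrightarrow> B (min (max 0 t) (enn2real (T \<omega>))) \<omega>"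
    by (rule continuous_on_tendsto_compose[OF c]) (auto simp: r_def)
  moreover have "snd (lifetime_path T B \<omega>) (r n) = B (min (r n) (enn2real (T \<omega>))) \<omega>" for n
    using T by (simp add: lifetime_path_def enn2real_min_ennreal r_def)
  ultimately show ?thesis unfolding path_at_def r_def by (simp add: limI)
qed

text \<open>The epochs as functionals of the sequence of cycles instead of the sample point, so that
  they can be shifted and integrated under the product law.\<close>

definition ep :: "int \<Rightarrow> (int \<Rightarrow> ennreal \<times> (real \<Rightarrow> real)) \<Rightarrow> real" where
  "ep k y = epoch (\<lambda>i y. fst (y i)) k y"

lemma ep_0 [simp]: "ep 0 y = 0"
  by (simp add: ep_def epoch_0)

lemma ep_Suc: "ep (k + 1) y = ep k y + dur (y k)"
  using epoch_step[of "\<lambda>i y. fst (y i)" k y] by (simp add: ep_def dur_def)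

lemma ep_nonneg: "0 \<le> k \<Longrightarrow> ep k y = (\<Sum>i\<in>{0..<k}. dur (y i))"
  by (simp add: ep_def epoch_def dur_def)

lemma ep_mono: "j \<le> k \<Longrightarrow> ep j y \<le> ep k y"
  by (induction k rule: int_ge_induct) (auto simp: ep_Suc intro: order.trans)

lemma ep_shift: "ep k (shift_seq d y) = ep (k + d) y - ep d y"
proof (induction k rule: int_induct[where k=0])
  case (step1 i)
  have "shift_seq d y i = y (i + d)" by (simp add: shift_seq_def)
  then show ?case using step1 ep_Suc[of "i + d" y] ep_Suc[of i "shift_seq d y"] by (simp add: ac_simps)
next
  case (step2 i)
  have "shift_seq d y (i - 1) = y (i - 1 + d)" by (simp add: shift_seq_def)
  then show ?case using step2 ep_Suc[of "i - 1 + d" y] ep_Suc[of "i - 1" "shift_seq d y"]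
    by (simp add: algebra_simps)
qed simp

lemma measurable_ep [measurable]: "ep k \<in> borel_measurable (PiM UNIV (\<lambda>_. lifetime_path_space))"
  unfolding ep_def[abs_def] epoch_def by measurable

text \<open>
  The path obtained by concatenating the cycles. Cycle \<open>k\<close> contributes its increment between
  times \<open>0\<close> and \<open>s\<close>, both clamped to the lifetime of the cycle; \<^const>\<open>path_at\<close> clamps
  automatically, so that no case distinction on the position of \<open>s\<close> is needed.
\<close>

definition glued :: "(int \<Rightarrow> ennreal \<times> (real \<Rightarrow> real)) \<Rightarrow> real \<Rightarrow> real" where
  "glued y s = lim (\<lambda>n. \<Sum>k\<in>{- int n..<int n}. path_at (y k) (s - ep k y) - path_at (y k) (- ep k y))"

lemma measurable_glued:
  assumes f[measurable]: "f \<in> M \<rightarrow>\<^sub>M PiM UNIV (\<lambda>_. lifetime_path_space)" and [measurable]: "g \<in> borel_measurable M"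
  shows "(\<lambda>x. glued (f x) (g x)) \<in> borel_measurable M"
proof -
  have [measurable]: "(\<lambda>x. f x k) \<in> M \<rightarrow>\<^sub>M lifetime_path_space" for k
    by (rule measurable_compose[OF f measurable_component_singleton]) simp
  have [measurable]: "(\<lambda>x. ep k (f x)) \<in> borel_measurable M" for k
    by (rule measurable_compose[OF f measurable_ep])
  show ?thesis unfolding glued_def
    by (intro borel_measurable_lim_metric borel_measurable_sum borel_measurable_diff measurable_path_at) measurable
qed

text \<open>The almost sure properties of the concatenation, collected into a relation between
  single sequences and single paths. What follows from it is deterministic, and the set of good
  sequences need not be measurable.\<close>

definition glues :: "(int \<Rightarrow> ennreal \<times> (real \<Rightarrow> real)) \<Rightarrow> (real \<Rightarrow> real) \<Rightarrow> bool" where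
  "glues y w \<longleftrightarrow> continuous_on UNIV w \<and> w 0 = 0 \<and>
    (\<forall>k t. path_at (y k) t = w (ep k y + min (max 0 t) (dur (y k))) - w (ep k y)) \<and>
    (\<forall>r. \<exists>k. r \<le> ep k y) \<and> (\<forall>r. \<exists>k. ep k y \<le> r)"

text \<open>Each term is the increment of \<open>w\<close> over the part of the cycle before
  \<open>s\<close>: the full increment if the cycle ends before \<open>s\<close>, and zero if it
  starts after \<open>s\<close>.\<close>

lemma clamped_telescope:
  fixes w :: "real \<Rightarrow> real"
  assumes "m \<le> n"
  shows "(\<Sum>k\<in>{m..<n}. w (ep k y + min (max 0 (s - ep k y)) (dur (y k))) - w (ep k y))
    = w (max (ep m y) (min s (ep n y))) - w (ep m y)"
  using assms
proof (induction n rule: int_ge_induct)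
  case base
  show ?case by (simp add: max_def min_def)
next
  case (step n)
  have "{m..<n + 1} = insert n {m..<n}" using step by auto
  moreover have "ep m y \<le> ep n y" using step by (intro ep_mono)
  moreover have "w (b + min (max 0 (s - b)) e) - w b + (w (max a (min s b)) - w a) = w (max a (min s (b + e))) - w a"
    if "a \<le> b" "0 \<le> e" for a b e
  proof (cases "s \<le> b")
    case True
    then have "b + min (max 0 (s - b)) e = b" "min s (b + e) = s" "min s b = s" using that by auto
    then show ?thesis by simp
  next
    case False
    then have "b + min (max 0 (s - b)) e = min s (b + e)" "max a (min s b) = b" "max a (min s (b + e)) = min s (b + e)"
      using that by auto
    then show ?thesis by simp
  qed
  ultimately show ?case using step dur_nonneg[of "y n"] by (simp add: ep_Suc)
qed

lemma glued_eq:
  assumes "glues y w"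
  shows "glued y s = w s"
proof -
  have path: "path_at (y k) t = w (ep k y + min (max 0 t) (dur (y k))) - w (ep k y)" for k t
    using assms by (simp add: glues_def)
  have part: "(\<Sum>k\<in>{m..<n}. path_at (y k) (s - ep k y) - path_at (y k) (0 - ep k y))
    = w (max (ep m y) (min s (ep n y))) - w (max (ep m y) (min 0 (ep n y)))" if "m \<le> n" for m n
  proof -
    have "(\<Sum>k\<in>{m..<n}. path_at (y k) (s - ep k y)) = w (max (ep m y) (min s (ep n y))) - w (ep m y)" for s
      unfolding path by (rule clamped_telescope[OF that])
    then show ?thesis by (simp only: sum_subtractf)
  qed
  obtain k1 where k1: "max s 0 \<le> ep k1 y" using assms unfolding glues_def by blast
  obtain k2 where k2: "ep k2 y \<le> min s 0" using assms unfolding glues_def by blast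
  \<comment> \<open>From this \<open>n\<close> on, the cycles in the sum cover both \<open>0\<close>
    and \<open>s\<close>. The sequence defining \<open>glued\<close> is therefore eventually
    constant.\<close>
  have "(\<Sum>k\<in>{- int n..<int n}. path_at (y k) (s - ep k y) - path_at (y k) (- ep k y)) = w s"
    if n: "n \<ge> nat (max (k1) (- k2))" for n
  proof -
    have "ep k1 y \<le> ep (int n) y" "ep (- int n) y \<le> ep k2 y" using n by (intro ep_mono; linarith)+
    then have "max (ep (- int n) y) (min s (ep (int n) y)) = s" "max (ep (- int n) y) (min 0 (ep (int n) y)) = 0"
      using k1 k2 by auto
    moreover have "w 0 = 0" using assms by (simp add: glues_def)
    ultimately show ?thesis using part[of "- int n" "int n"] by simp
  qed
  then have "(\<lambda>n. \<Sum>k\<in>{- int n..<int n}. path_at (y k) (s - ep k y) - path_at (y k) (- ep k y)) \<longlonglongrightarrow> w s"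
    by (intro tendsto_eventually eventually_sequentiallyI)
  then show ?thesis unfolding glued_def by (rule limI)
qed

lemma glues_shift:
  assumes "glues y w"
  shows "glues (shift_seq d y) (\<lambda>s. w (ep d y + s) - w (ep d y))"
  unfolding glues_def
proof (intro conjI allI)
  show "continuous_on UNIV (\<lambda>s. w (ep d y + s) - w (ep d y))"
  proof (rule continuous_on_diff)
    have "continuous_on UNIV w" using assms by (simp add: glues_def)
    then show "continuous_on UNIV (\<lambda>s. w (ep d y + s))"
      by (rule continuous_on_compose2) (auto intro!: continuous_intros)
  qed simp
  show "path_at (shift_seq d y k) t =
      w (ep d y + (ep k (shift_seq d y) + min (max 0 t) (dur (shift_seq d y k)))) - w (ep d y) -
      (w (ep d y + ep k (shift_seq d y)) - w (ep d y))" for k t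
    using assms unfolding glues_def ep_shift by (simp add: shift_seq_def add.assoc[symmetric])
  show "\<exists>k. r \<le> ep k (shift_seq d y)" for r
  proof -
    obtain k where "r + ep d y \<le> ep k y" using assms unfolding glues_def by blast
    then show ?thesis by (intro exI[of _ "k - d"]) (simp add: ep_shift)
  qed
  show "\<exists>k. ep k (shift_seq d y) \<le> r" for r
  proof -
    obtain k where "ep k y \<le> r + ep d y" using assms unfolding glues_def by blast
    then show ?thesis by (intro exI[of _ "k - d"]) (simp add: ep_shift)
  qed
qed (simp)

lemma glued_shift:
  assumes "glues y w"
  shows "glued (shift_seq d y) s = glued y (ep d y + s) - glued y (ep d y)"
  by (simp add: glued_eq[OF assms] glued_eq[OF glues_shift[OF assms]])

lemma sum_enn2real_unbounded:
  assumes "(\<Sum>n. T n) = (\<infinity> :: ennreal)" "\<And>n. T n < \<infinity>"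
  shows "\<exists>n. r \<le> (\<Sum>i<n. enn2real (T i))"
proof (rule ccontr)
  assume "\<not> ?thesis"
  then have le: "(\<Sum>i<n. enn2real (T i)) \<le> r" for n by (meson linear)
  have "(\<Sum>i<n. T i) \<le> ennreal r" for n
  proof -
    have "(\<Sum>i<n. T i) = (\<Sum>i<n. ennreal (enn2real (T i)))" using assms(2) by (intro sum.cong) auto
    also have "\<dots> = ennreal (\<Sum>i<n. enn2real (T i))" by (rule sum_ennreal) auto
    finally show ?thesis using le[of n] by (simp add: ennreal_leI)
  qed
  then have "(\<Sum>n. T n) \<le> ennreal r" by (intro suminf_le_const) auto
  then show False using assms(1) by (simp add: top_unique)
qed

lemma glues_concatenation:
  assumes fam: "decomposition_family N T B" and con: "concatenation N T B W"
  shows "AE \<omega> in N. glues (\<lambda>k. lifetime_path (T k) (B k) \<omega>) (\<lambda>s. W s \<omega>)"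
proof -
  obtain F where F: "\<And>k. brownian_motion_wrt N (F k) (B k)"
    using fam unfolding decomposition_family_def by blast
  have "AE \<omega> in N. \<forall>k. continuous_on {0..} (\<lambda>t. B k t \<omega>) \<and> B k 0 \<omega> = 0"
    using F unfolding brownian_motion_wrt_def standard_brownian_motion_def by (auto simp: AE_all_countable)
  moreover have "AE \<omega> in N. (\<forall>k. T k \<omega> < \<infinity>) \<and> (\<Sum>n. T (1 + int n) \<omega>) = \<infinity> \<and> (\<Sum>n. T (- 1 - int n) \<omega>) = \<infinity>"
    using fam unfolding decomposition_family_def by auto
  moreover have "AE \<omega> in N. continuous_on UNIV (\<lambda>t. W t \<omega>) \<and> W 0 \<omega> = 0 \<and>
        (\<forall>k. \<forall>t\<ge>0. ennreal t < T k \<omega> \<longrightarrow>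
           W (epoch T k \<omega> + t) \<omega> - W (epoch T k \<omega>) \<omega> = B k t \<omega>)"
    using con unfolding concatenation_def by blast
  ultimately show ?thesis
  proof eventually_elim
    case (elim \<omega>)
    define y where "y = (\<lambda>k. lifetime_path (T k) (B k) \<omega>)"
    have T: "T k \<omega> < \<infinity>" for k using elim by blast
    have B0: "B k 0 \<omega> = 0" for k using elim by blast
    have dy: "dur (y k) = enn2real (T k \<omega>)" for k by (simp add: y_def dur_def lifetime_path_def)
    have ep: "ep k y = epoch T k \<omega>" for k
      unfolding ep_def epoch_def y_def lifetime_path_def by simp
    have pa: "path_at (y k) t = B k (min (max 0 t) (dur (y k))) \<omega>" for k t
      unfolding dy unfolding y_def using elim by (intro path_at_lifetime_path) auto
    have W: "W (ep k y + t) \<omega> - W (ep k y) \<omega> = B k t \<omega>" if "0 \<le> t" "t \<le> dur (y k)" for k t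
    proof (cases "t < dur (y k)")
      case True
      then have "ennreal t < T k \<omega>" using T[of k] that unfolding dy
        by (metis ennreal_enn2real ennreal_lessI infinity_ennreal_def order.strict_trans1)
      then show ?thesis using elim that unfolding ep by blast
    next
      case False
      show ?thesis
      proof (cases "t = 0")
        case True then show ?thesis by (simp add: B0)
      next
        case t0: False
        \<comment> \<open>The gluing condition speaks of \<open>t < T k\<close> only. The end point
          is reached from below along \<open>r\<close>, by continuity of \<open>W\<close> and of
          \<open>B k\<close>.\<close>
        define r where "r n = t * (1 - 1 / real (Suc n))" for n
        have r: "0 \<le> r n" "r n < t" for n
          using t0 that unfolding r_def by (auto simp: field_simps)
        have "r \<longlonglongrightarrow> t" unfolding r_def by real_asymp
        then have "(\<lambda>n. W (ep k y + r n) \<omega> - W (ep k y) \<omega>) \<longlonglongrightarrow> W (ep k y + t) \<omega> - W (ep k y) \<omega>"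
          using elim by (intro tendsto_intros continuous_on_tendsto_compose[of UNIV "\<lambda>t. W t \<omega>"]) auto
        moreover have "(\<lambda>n. B k (r n) \<omega>) \<longlonglongrightarrow> B k t \<omega>"
          using elim r that \<open>r \<longlonglongrightarrow> t\<close> by (intro continuous_on_tendsto_compose[of "{0..}" "\<lambda>t. B k t \<omega>"]) auto
        moreover have "W (ep k y + r n) \<omega> - W (ep k y) \<omega> = B k (r n) \<omega>" for n
        proof -
          have "ennreal (r n) < T k \<omega>"
            using r[of n] that T[of k] unfolding dy
            by (metis ennreal_enn2real ennreal_lessI infinity_ennreal_def order.strict_trans1 order.strict_trans2)
          then show ?thesis using elim r unfolding ep by blast
        qed
        ultimately show ?thesis by (simp add: LIMSEQ_unique)
      qed
    qed
    show "glues (\<lambda>k. lifetime_path (T k) (B k) \<omega>) (\<lambda>s. W s \<omega>)"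
      unfolding y_def[symmetric] glues_def
    proof (intro conjI allI)
      show "continuous_on UNIV (\<lambda>s. W s \<omega>)" "W 0 \<omega> = 0" using elim by auto
      show "path_at (y k) t = W (ep k y + min (max 0 t) (dur (y k))) \<omega> - W (ep k y) \<omega>" for k t
        unfolding pa by (rule W[symmetric]) auto
      show "\<exists>k. r \<le> ep k y" for r
      proof -
        obtain n where n: "r \<le> (\<Sum>i<n. enn2real (T (1 + int i) \<omega>))"
          using sum_enn2real_unbounded[of "\<lambda>n. T (1 + int n) \<omega>" r] elim by auto
        have "ep (1 + int n) y = dur (y 0) + (\<Sum>i<n. enn2real (T (1 + int i) \<omega>))" for n
        proof (induction n)
          case (Suc n)
          then show ?case using ep_Suc[of "1 + int n" y] by (simp add: dy ac_simps)
        qed (use ep_Suc[of 0 y] in simp)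
        then have "r \<le> ep (1 + int n) y" using n dur_nonneg[of "y 0"] by (simp del: dur_nonneg)
        then show ?thesis ..
      qed
      show "\<exists>k. ep k y \<le> r" for r
      proof -
        obtain n where n: "- r \<le> (\<Sum>i<n. enn2real (T (- 1 - int i) \<omega>))"
          using sum_enn2real_unbounded[of "\<lambda>n. T (- 1 - int n) \<omega>" "- r"] elim by auto
        have "ep (- int n) y = - (\<Sum>i<n. enn2real (T (- 1 - int i) \<omega>))" for n
        proof (induction n)
          case (Suc n)
          then show ?case using ep_Suc[of "- int (Suc n)" y] by (simp add: dy algebra_simps)
        qed simp
        then have "ep (- int n) y \<le> r" using n by simp
        then show ?thesis ..
      qed
    qed
  qed
qed

section \<open>Increments after a time in the first cycle\<close>

locale decomposition = prob_space N for N :: "'b measure" +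
  fixes T :: "int \<Rightarrow> 'b \<Rightarrow> ennreal" and B :: "int \<Rightarrow> real \<Rightarrow> 'b \<Rightarrow> real" and W :: "real \<Rightarrow> 'b \<Rightarrow> real"
  assumes fam: "decomposition_family N T B" and con: "concatenation N T B W"
begin

definition cycles :: "'b \<Rightarrow> int \<Rightarrow> ennreal \<times> (real \<Rightarrow> real)" where
  "cycles \<omega> = (\<lambda>k. lifetime_path (T k) (B k) \<omega>)"

definition cycle_law :: "(ennreal \<times> (real \<Rightarrow> real)) measure" where
  "cycle_law = distr N lifetime_path_space (lifetime_path (T 0) (B 0))"

abbreviation cycles_law :: "(int \<Rightarrow> ennreal \<times> (real \<Rightarrow> real)) measure" where
  "cycles_law \<equiv> PiM UNIV (\<lambda>_. cycle_law)"

lemma sets_cycle_law[measurable_cong]: "sets cycle_law = sets lifetime_path_space"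
  by (simp add: cycle_law_def)

lemma sets_cycles_law: "sets cycles_law = sets (PiM UNIV (\<lambda>_. lifetime_path_space))"
  by (intro sets_PiM_cong refl sets_cycle_law)

lemma indep_cycles: "indep_vars (\<lambda>_. lifetime_path_space) (\<lambda>k. lifetime_path (T k) (B k)) UNIV"
  using fam unfolding decomposition_family_def by blast

lemma measurable_cycle: "lifetime_path (T k) (B k) \<in> N \<rightarrow>\<^sub>M lifetime_path_space"
  using indep_cycles unfolding indep_vars_def by blast

lemma measurable_cycles: "cycles \<in> N \<rightarrow>\<^sub>M PiM UNIV (\<lambda>_. lifetime_path_space)"
  unfolding cycles_def by (rule measurable_PiM_single') (auto simp: space_PiM measurable_cycle measurable_space[OF measurable_cycle])

lemma measurable_cycles_law[measurable]: "cycles \<in> N \<rightarrow>\<^sub>M cycles_law"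
  using measurable_cycles by (simp cong: measurable_cong_sets add: measurable_cong_sets[OF refl sets_cycles_law])

lemma prob_space_cycle_law: "prob_space cycle_law"
  unfolding cycle_law_def by (rule prob_space_distr[OF measurable_cycle])

sublocale PP: product_prob_space "\<lambda>_ :: int. cycle_law" UNIV
  by (simp add: product_prob_space_def product_sigma_finite_def product_prob_space_axioms_def
      prob_space_cycle_law prob_space_imp_sigma_finite)

sublocale cyc: ergodic_shift cycles_law shift_seq
  by (rule ergodic_shift_iid[OF prob_space_cycle_law])

lemma distr_cycles: "distr N cycles_law cycles = cycles_law"
proof -
  have D: "distr N lifetime_path_space (lifetime_path (T k) (B k)) = cycle_law" for k
    using fam unfolding decomposition_family_def cycle_law_def by blast
  have "distr N (PiM UNIV (\<lambda>_. lifetime_path_space)) (\<lambda>\<omega>. \<lambda>k\<in>UNIV. lifetime_path (T k) (B k) \<omega>) =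
      PiM UNIV (\<lambda>k. distr N lifetime_path_space (lifetime_path (T k) (B k)))"
    using indep_vars_iff_distr_eq_PiM[of UNIV "\<lambda>k. lifetime_path (T k) (B k)" "\<lambda>_. lifetime_path_space"]
      measurable_cycle indep_cycles by blast
  then have "distr N (PiM UNIV (\<lambda>_. lifetime_path_space)) cycles = cycles_law"
    unfolding D by (simp add: restrict_UNIV cycles_def[abs_def])
  moreover have "distr N cycles_law cycles = distr N (PiM UNIV (\<lambda>_. lifetime_path_space)) cycles"
    by (rule distr_cong) (simp_all only: sets_cycles_law)
  ultimately show ?thesis by simp
qed

lemma AE_glues: "AE \<omega> in N. glues (cycles \<omega>) (\<lambda>s. W s \<omega>)"
  unfolding cycles_def by (rule glues_concatenation[OF fam con])

lemma AE_T_finite: "AE \<omega> in N. \<forall>k. T k \<omega> < \<infinity>"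
  using fam unfolding decomposition_family_def by blast

lemma fst_cycles [simp]: "fst (cycles \<omega> k) = T k \<omega>"
  by (simp add: cycles_def lifetime_path_def)

text \<open>The factor that a cycle starting at time \<open>s\<close> contributes to the exponential
  of the whole path: for a lifetime path, both path and clock stand still before \<open>s\<close>
  and after the end of the cycle.\<close>

definition cycle_expo :: "(nat \<Rightarrow> real) \<Rightarrow> (nat \<Rightarrow> real) \<Rightarrow> nat \<Rightarrow> real \<Rightarrow> ennreal \<times> (real \<Rightarrow> real) \<Rightarrow> complex" where
  "cycle_expo a l n s c = expo a l n (\<lambda>t. path_at c (t - s)) (\<lambda>t. min (max 0 (t - s)) (dur c))"

lemma measurable_cycle_expo:
  assumes f[measurable]: "f \<in> M \<rightarrow>\<^sub>M lifetime_path_space" and g[measurable]: "g \<in> borel_measurable M"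
  shows "(\<lambda>x. cycle_expo a l n (g x) (f x)) \<in> borel_measurable M"
  unfolding cycle_expo_def
proof (rule borel_measurable_expo)
  show "(\<lambda>w. path_at (f w) (a j - g w)) \<in> borel_measurable M" for j
    by (rule measurable_path_at[OF f]) measurable
  have [measurable]: "(\<lambda>w. dur (f w)) \<in> borel_measurable M" by (rule measurable_compose[OF f measurable_dur])
  show "(\<lambda>w. min (max 0 (a j - g w)) (dur (f w))) \<in> borel_measurable M" for j by measurable
qed

lemma norm_cycle_expo_le:
  assumes "mono a"
  shows "norm (cycle_expo a l n s c) \<le> exp (incr_variance a l n / 2)"
  unfolding cycle_expo_def
proof (rule norm_expo_le)
  show "min (max 0 (a (Suc j) - s)) (dur c) - min (max 0 (a j - s)) (dur c) \<le> a (Suc j) - a j" for j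
    using assms monoD[OF assms, of j "Suc j"] by (auto simp: min_def max_def)
qed

lemma adapted: "\<exists>F. adapted_brownian_motion N F (B k) \<and> stopping_time F (T k)"
proof -
  obtain F where F: "normal_filtration N (F k)" "brownian_motion_wrt N (F k) (B k)" "stopping_time (F k) (T k)"
    using fam unfolding decomposition_family_def by blast
  then have "adapted_brownian_motion N (F k) (B k)"
    by unfold_locales (auto simp: normal_filtration_def filtration_def)
  with F show ?thesis by blast
qed

abbreviation alive :: "real \<Rightarrow> 'b set" where
  "alive u \<equiv> {\<omega> \<in> space N. u < dur (cycles \<omega> 0)}"

text \<open>Starting the cycle at \<open>s\<close> amounts to replacing the grid by
  \<open>max 0 (a j - s)\<close>, which is again monotone and nonnegative. So optional stopping
  applies wherever \<open>s\<close> lies relative to the grid.\<close>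

lemma integral_cycle_expo:
  assumes a: "mono a"
  shows "(\<integral>c. cycle_expo a l n s c \<partial>cycle_law) = 1"
    and "0 \<le> u \<Longrightarrow> u \<le> a 0 \<Longrightarrow>
      (\<integral>c. of_bool (u < dur c) * cycle_expo a l n 0 c \<partial>cycle_law) = complex_of_real (prob (alive u))"
proof -
  obtain F where "adapted_brownian_motion N F (B 0)" and T: "stopping_time F (T 0)" using adapted by blast
  then interpret adapted_brownian_motion N F "B 0" by simp
  define \<sigma> where "\<sigma> t \<omega> = enn2real (min (ennreal t) (T 0 \<omega>))" for t \<omega>
  have meas: "(\<lambda>\<omega>. B 0 (\<sigma> t \<omega>) \<omega>) \<in> borel_measurable N" if "0 \<le> t" for t
  proof -
    have "(\<lambda>\<omega>. snd (lifetime_path (T 0) (B 0) \<omega>) t) \<in> borel_measurable N"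
      by (rule measurable_compose[OF measurable_compose[OF measurable_cycle measurable_snd] measurable_component_singleton])
         (use that in simp)
    then show ?thesis using that by (simp add: lifetime_path_def \<sigma>_def)
  qed
  have eq: "AE \<omega> in N. cycle_expo a l n s (lifetime_path (T 0) (B 0) \<omega>) =
      expo (\<lambda>j. max 0 (a j - s)) l n (\<lambda>t. B 0 (\<sigma> t \<omega>) \<omega>) (\<lambda>t. \<sigma> t \<omega>)" for s
    using continuous_B AE_T_finite
  proof eventually_elim
    case (elim \<omega>)
    then have "T 0 \<omega> < \<infinity>" by blast
    then have "\<sigma> (max 0 t) \<omega> = min (max 0 t) (enn2real (T 0 \<omega>))" for t
      unfolding \<sigma>_def by (rule enn2real_min_ennreal[rotated]) simp
    moreover have "path_at (lifetime_path (T 0) (B 0) \<omega>) t = B 0 (min (max 0 t) (enn2real (T 0 \<omega>))) \<omega>" for t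
      using elim \<open>T 0 \<omega> < \<infinity>\<close> by (intro path_at_lifetime_path)
    moreover have "dur (lifetime_path (T 0) (B 0) \<omega>) = enn2real (T 0 \<omega>)" by (simp add: dur_def lifetime_path_def)
    ultimately show ?case unfolding cycle_expo_def expo_def by simp
  qed
  have a': "mono (\<lambda>j. max 0 (a j - s))" "0 \<le> max 0 (a 0 - s)" for s
  proof (rule monoI)
    fix i j :: nat assume "i \<le> j"
    then have "a i \<le> a j" by (rule monoD[OF a])
    then show "max 0 (a i - s) \<le> max 0 (a j - s)" by auto
  qed simp
  have ce: "cycle_expo a l n s \<in> borel_measurable lifetime_path_space" for s
    by (rule measurable_cycle_expo) auto
  have em: "(\<lambda>\<omega>. expo (\<lambda>j. max 0 (a j - s)) l n (\<lambda>t. B 0 (\<sigma> t \<omega>) \<omega>) (\<lambda>t. \<sigma> t \<omega>)) \<in> borel_measurable N" for s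
  proof (rule borel_measurable_expo)
    show "(\<lambda>w. B 0 (\<sigma> (max 0 (a j - s)) w) w) \<in> borel_measurable N" for j by (rule meas) simp
    have [measurable]: "T 0 \<in> borel_measurable N" by (rule measurable_stopping_time[OF T sets_F space_F])
    show "(\<lambda>w. \<sigma> (max 0 (a j - s)) w) \<in> borel_measurable N" for j unfolding \<sigma>_def by measurable
  qed
  have cm: "(\<lambda>\<omega>. cycle_expo a l n s (lifetime_path (T 0) (B 0) \<omega>)) \<in> borel_measurable N" for s
    by (rule measurable_compose[OF measurable_cycle ce])
  have "(\<integral>c. cycle_expo a l n s c \<partial>cycle_law) = (\<integral>\<omega>. cycle_expo a l n s (lifetime_path (T 0) (B 0) \<omega>) \<partial>N)"
    unfolding cycle_law_def by (rule integral_distr[OF measurable_cycle ce])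
  also have "\<dots> = (\<integral>\<omega>. expo (\<lambda>j. max 0 (a j - s)) l n (\<lambda>t. B 0 (\<sigma> t \<omega>) \<omega>) (\<lambda>t. \<sigma> t \<omega>) \<partial>N)"
    by (rule integral_cong_AE[OF cm em eq])
  also have "\<dots> = 1"
    unfolding \<sigma>_def by (rule expo_optional_stopping[OF a' T meas[unfolded \<sigma>_def]])
  finally show "(\<integral>c. cycle_expo a l n s c \<partial>cycle_law) = 1" .
  assume u: "0 \<le> u" "u \<le> a 0"
  have [measurable]: "T 0 \<in> borel_measurable N" by (rule measurable_stopping_time[OF T sets_F space_F])
  have lt: "u < enn2real (T 0 \<omega>) \<longleftrightarrow> ennreal u < T 0 \<omega>" if "T 0 \<omega> < \<infinity>" for \<omega>
    using that u by (cases "T 0 \<omega>") (auto simp: ennreal_less_iff)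
  have ub: "(\<lambda>c. of_bool (u < dur c) * cycle_expo a l n 0 c) \<in> borel_measurable lifetime_path_space"
    using ce[of 0] by measurable
  have "(\<integral>c. of_bool (u < dur c) * cycle_expo a l n 0 c \<partial>cycle_law)
    = (\<integral>\<omega>. of_bool (u < dur (lifetime_path (T 0) (B 0) \<omega>)) * cycle_expo a l n 0 (lifetime_path (T 0) (B 0) \<omega>) \<partial>N)"
    unfolding cycle_law_def by (rule integral_distr[OF measurable_cycle ub])
  also have "\<dots> = (\<integral>\<omega>. of_bool (ennreal u < T 0 \<omega>) *
     expo (\<lambda>j. max 0 (a j - 0)) l n (\<lambda>t. B 0 (\<sigma> t \<omega>) \<omega>) (\<lambda>t. \<sigma> t \<omega>) \<partial>N)"
  proof (rule integral_cong_AE[OF measurable_compose[OF measurable_cycle ub]])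
    show "(\<lambda>\<omega>. of_bool (ennreal u < T 0 \<omega>) *
     expo (\<lambda>j. max 0 (a j - 0)) l n (\<lambda>t. B 0 (\<sigma> t \<omega>) \<omega>) (\<lambda>t. \<sigma> t \<omega>)) \<in> borel_measurable N"
      using em[of 0] by measurable
    show "AE \<omega> in N. of_bool (u < dur (lifetime_path (T 0) (B 0) \<omega>)) * cycle_expo a l n 0 (lifetime_path (T 0) (B 0) \<omega>)
      = of_bool (ennreal u < T 0 \<omega>) * expo (\<lambda>j. max 0 (a j - 0)) l n (\<lambda>t. B 0 (\<sigma> t \<omega>) \<omega>) (\<lambda>t. \<sigma> t \<omega>)"
      using eq[of 0] AE_T_finite
    proof eventually_elim
      case (elim \<omega>)
      then have "u < enn2real (T 0 \<omega>) \<longleftrightarrow> ennreal u < T 0 \<omega>" using lt by blast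
      with elim(1) show ?case by (simp add: dur_def lifetime_path_def)
    qed
  qed
  also have "\<dots> = complex_of_real (prob {\<omega> \<in> space N. ennreal u < T 0 \<omega>})"
    unfolding \<sigma>_def by (rule expo_optional_stopping_alive[OF a' T meas[unfolded \<sigma>_def]]) (use u in auto)
  also have "prob {\<omega> \<in> space N. ennreal u < T 0 \<omega>} = prob (alive u)"
  proof (rule finite_measure_eq_AE)
    show "AE \<omega> in N. \<omega> \<in> {\<omega> \<in> space N. ennreal u < T 0 \<omega>} \<longleftrightarrow> \<omega> \<in> alive u"
      using AE_T_finite by eventually_elim (use lt in \<open>auto simp: dur_def\<close>)
    have [measurable]: "(\<lambda>\<omega>. dur (cycles \<omega> 0)) \<in> borel_measurable N" unfolding dur_def by simp
    show "alive u \<in> sets N" by measurable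
  qed measurable
  finally show "(\<integral>c. of_bool (u < dur c) * cycle_expo a l n 0 c \<partial>cycle_law) = complex_of_real (prob (alive u))" .
qed

lemma measurable_cycles_law_component: "(\<lambda>y. y k) \<in> cycles_law \<rightarrow>\<^sub>M lifetime_path_space"
  using measurable_component_singleton[of k UNIV "\<lambda>_ :: int. cycle_law"]
  by (simp add: measurable_cong_sets[OF refl sets_cycle_law])

lemma measurable_ep_cycles_law[measurable]: "ep k \<in> borel_measurable cycles_law"
  using measurable_ep by (simp add: measurable_cong_sets[OF sets_cycles_law refl])

lemma measurable_dur_component [measurable]: "(\<lambda>y. dur (y k)) \<in> borel_measurable cycles_law"
  by (rule measurable_compose[OF measurable_cycles_law_component measurable_dur])

lemma measurable_cycle_expo_ep:
  "(\<lambda>y. cycle_expo a l n (ep i y) (y i)) \<in> borel_measurable cycles_law"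
  by (rule measurable_cycle_expo[OF measurable_cycles_law_component]) measurable

text \<open>The start \<open>ep m\<close> of cycle \<open>m\<close> is a function of the cycles
  \<open>0\<close> to \<open>m - 1\<close>, hence independent of cycle \<open>m\<close>. Integrating
  out the last cycle at a fixed start gives 1, and only the survival factor of cycle
  \<open>0\<close> remains in the end.\<close>

lemma integral_cycle_product:
  assumes a: "mono a" and u: "0 \<le> u" "u \<le> a 0"
  shows "(\<integral>y. of_bool (u < dur (y 0)) * (\<Prod>i<Suc m. cycle_expo a l n (ep (int i) y) (y (int i))) \<partial>cycles_law)
     = complex_of_real (prob (alive u))"
proof (induction m)
  case 0
  have m: "(\<lambda>y. y 0) \<in> cycles_law \<rightarrow>\<^sub>M cycle_law" by (rule measurable_component_singleton) simp
  have d: "distr cycles_law cycle_law (\<lambda>y. y 0) = cycle_law"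
    using PP.PiM_component[of 0] by simp
  have ub: "(\<lambda>c. of_bool (u < dur c) * cycle_expo a l n 0 c) \<in> borel_measurable cycle_law"
    using measurable_cycle_expo[of "\<lambda>c. c" lifetime_path_space "\<lambda>_. 0" a l n]
    by (simp add: measurable_cong_sets[OF sets_cycle_law refl])
  have "(\<integral>c. of_bool (u < dur c) * cycle_expo a l n 0 c \<partial>cycle_law) = (\<integral>y. of_bool (u < dur (y 0)) * cycle_expo a l n 0 (y 0) \<partial>cycles_law)"
    by (subst (1) d[symmetric], rule integral_distr[OF m ub])
  then show ?case using integral_cycle_expo(2)[OF a u, of l n] by simp
next
  case (Suc m)
  define G where "G y = of_bool (u < dur (y 0)) * (\<Prod>i<Suc m. cycle_expo a l n (ep (int i) y) (y (int i)))" for y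
  let ?k = "int (Suc m)"
  define H where "H y = G y * cycle_expo a l n (ep ?k y) (y ?k)" for y
  define K where "K = exp (incr_variance a l n / 2)"
  have Kb: "norm (cycle_expo a l n s c) \<le> K" for s c unfolding K_def by (rule norm_cycle_expo_le[OF a])
  have Gm[measurable]: "G \<in> borel_measurable cycles_law"
    unfolding G_def using measurable_cycle_expo_ep by measurable
  have Hm: "H \<in> borel_measurable cycles_law" unfolding H_def using measurable_cycle_expo_ep by measurable
  have Gb: "norm (G y) \<le> K ^ Suc m" for y
  proof -
    have "norm (\<Prod>i<Suc m. cycle_expo a l n (ep (int i) y) (y (int i))) \<le> (\<Prod>i<Suc m. K)"
      unfolding prod_norm[symmetric] by (intro prod_mono) (auto simp: Kb)
    then have "norm (\<Prod>i<Suc m. cycle_expo a l n (ep (int i) y) (y (int i))) \<le> K ^ Suc m" by simp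
    moreover have "0 \<le> K ^ Suc m" by (simp add: K_def)
    ultimately show ?thesis unfolding G_def norm_mult by (auto simp: of_bool_def)
  qed
  have upd: "ep i (y(?k := c)) = ep i y" if "0 \<le> i" "i \<le> ?k" for i y c
    using that by (simp add: ep_nonneg)
  have Gupd: "G (y(?k := c)) = G y" for y c
  proof -
    have "cycle_expo a l n (ep (int i) (y(?k := c))) ((y(?k := c)) (int i)) = cycle_expo a l n (ep (int i) y) (y (int i))"
      if "i \<in> {..<Suc m}" for i
    proof -
      have i: "int i \<noteq> ?k" "int i \<le> ?k" using that by auto
      show ?thesis unfolding upd[OF of_nat_0_le_iff i(2)] fun_upd_other[OF i(1)] ..
    qed
    then show ?thesis unfolding G_def by (simp cong: prod.cong_simp)
  qed
  interpret pr: pair_prob_space cycle_law cycles_law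
    by (intro pair_prob_space.intro pair_sigma_finite.intro prob_space_cycle_law prob_space_imp_sigma_finite PP.P.prob_space_axioms)
  let ?Q = "cycle_law \<Otimes>\<^sub>M cycles_law"
  \<comment> \<open>Overwriting coordinate \<open>?k\<close> by an independent copy preserves the
    law. In this representation \<open>G\<close> and the start time do not see the copy, and Fubini
    applies.\<close>
  have di: "distr ?Q cycles_law (\<lambda>(c, y). y(?k := c)) = cycles_law"
    using distr_pair_PiM_eq_PiM[of UNIV "\<lambda>_. cycle_law" ?k] prob_space_cycle_law by simp
  have mu: "(\<lambda>(c, y). y(?k := c)) \<in> ?Q \<rightarrow>\<^sub>M cycles_law"
    using measurable_fun_upd[of UNIV UNIV ?k "\<lambda>p. snd p" ?Q "\<lambda>_. cycle_law" "\<lambda>p. fst p"]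
    by (simp add: case_prod_unfold)
  have fm: "(\<lambda>p. G (snd p) * cycle_expo a l n (ep ?k (snd p)) (fst p)) \<in> borel_measurable ?Q"
  proof (rule borel_measurable_times)
    show "(\<lambda>p. cycle_expo a l n (ep ?k (snd p)) (fst p)) \<in> borel_measurable ?Q"
      by (rule measurable_cycle_expo) (auto simp: measurable_cong_sets[OF refl sets_cycle_law[symmetric]])
  qed measurable
  have int: "integrable ?Q (\<lambda>p. G (snd p) * cycle_expo a l n (ep ?k (snd p)) (fst p))"
  proof (rule pr.integrable_const_bound[where B="K ^ Suc m * K"])
    have "norm (G y * cycle_expo a l n s c) \<le> K ^ Suc m * K" for y s c
      unfolding norm_mult by (intro mult_mono Gb Kb order.trans[OF norm_ge_zero Gb] norm_ge_zero)
    then show "AE p in ?Q. norm (G (snd p) * cycle_expo a l n (ep ?k (snd p)) (fst p)) \<le> K ^ Suc m * K"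
      by (intro AE_I2)
  qed (rule fm)
  have "(\<integral>y. H y \<partial>cycles_law) = (\<integral>p. H ((\<lambda>(c, y). y(?k := c)) p) \<partial>?Q)"
    by (subst (1) di[symmetric], rule integral_distr[OF mu Hm])
  also have "\<dots> = (\<integral>p. G (snd p) * cycle_expo a l n (ep ?k (snd p)) (fst p) \<partial>?Q)"
  proof -
    have "H (y(?k := c)) = G y * cycle_expo a l n (ep ?k y) c" for y c
      unfolding H_def Gupd upd[OF of_nat_0_le_iff order_refl] by (simp only: fun_upd_same)
    then show ?thesis by (simp only: case_prod_unfold)
  qed
  also have "\<dots> = (\<integral>y. (\<integral>c. G y * cycle_expo a l n (ep ?k y) c \<partial>cycle_law) \<partial>cycles_law)"
    using pr.integral_snd[of "\<lambda>c y. G y * cycle_expo a l n (ep ?k y) c"] int by (simp add: case_prod_unfold)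
  also have "\<dots> = (\<integral>y. G y \<partial>cycles_law)"
    by (simp add: integral_cycle_expo(1)[OF a])
  finally have "(\<integral>y. H y \<partial>cycles_law) = complex_of_real (prob (alive u))"
    using Suc by (simp add: G_def)
  moreover have "H y = of_bool (u < dur (y 0)) * (\<Prod>i<Suc (Suc m). cycle_expo a l n (ep (int i) y) (y (int i)))" for y
    unfolding H_def G_def by (simp only: prod.lessThan_Suc[of _ "Suc m"] mult.assoc)
  ultimately show ?case by simp
qed

lemma prod_cycle_expo:
  assumes g: "glues y w"
  shows "(\<Prod>i<m. cycle_expo a l n (ep (int i) y) (y (int i))) =
    expo a l n (\<lambda>t. w (max 0 (min t (ep (int m) y)))) (\<lambda>t. max 0 (min t (ep (int m) y)))"
proof (induction m)
  case 0
  show ?case by (simp add: expo_const[of n _ a "w 0" _ 0])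
next
  case (Suc m)
  let ?k = "int m"
  have path: "path_at (y k) t = w (ep k y + min (max 0 t) (dur (y k))) - w (ep k y)" for k t
    using g by (simp add: glues_def)
  have b: "0 \<le> ep ?k y" using ep_mono[of 0 ?k y] by simp
  \<comment> \<open>Stated for arbitrary \<open>v\<close>, since it is used for the path
    \<open>w\<close> and, with the identity, for the clock.\<close>
  have step: "v (max 0 (min t (ep (?k + 1) y))) = v (max 0 (min t (ep ?k y))) + (v (ep ?k y + min (max 0 (t - ep ?k y)) (dur (y ?k))) - v (ep ?k y))"
    for v :: "real \<Rightarrow> real" and t
  proof (cases "t \<le> ep ?k y")
    case True
    then have "ep ?k y + min (max 0 (t - ep ?k y)) (dur (y ?k)) = ep ?k y" "min t (ep (?k + 1) y) = t" "min t (ep ?k y) = t"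
      using dur_nonneg[of "y ?k"] by (auto simp: ep_Suc simp del: dur_nonneg)
    then show ?thesis by simp
  next
    case False
    then have "ep ?k y + min (max 0 (t - ep ?k y)) (dur (y ?k)) = max 0 (min t (ep (?k + 1) y))" "max 0 (min t (ep ?k y)) = ep ?k y"
      using b dur_nonneg[of "y ?k"] by (auto simp: ep_Suc simp del: dur_nonneg)
    then show ?thesis by simp
  qed
  have "cycle_expo a l n (ep ?k y) (y ?k) = expo a l n
     (\<lambda>t. w (ep ?k y + min (max 0 (t - ep ?k y)) (dur (y ?k))) - w (ep ?k y))
     (\<lambda>t. ep ?k y + min (max 0 (t - ep ?k y)) (dur (y ?k)) - ep ?k y)"
    unfolding cycle_expo_def path by simp
  then show ?case
    unfolding prod.lessThan_Suc Suc.IH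
    by (simp only: expo_add[symmetric] step[of w, symmetric] step[of "\<lambda>x. x", symmetric] of_nat_Suc add.commute[of 1])
qed

text \<open>The product over the first cycles is the exponential of the path clamped to these
  cycles. Once they reach beyond \<open>a n\<close> it no longer changes, and the clamped clock
  never runs faster than time, which gives the bound \<open>K\<close>.\<close>

lemma forward_increments:
  assumes a: "mono a" and u: "0 \<le> u" "u \<le> a 0"
  shows "(\<integral>\<omega>. of_bool (u < dur (cycles \<omega> 0)) * expo a l n (\<lambda>t. W t \<omega>) (\<lambda>t. t) \<partial>N)
    = complex_of_real (prob (alive u))"
proof -
  define K where "K = exp (incr_variance a l n / 2)"
  let ?f = "\<lambda>m y. of_bool (u < dur (y 0)) * (\<Prod>i<Suc m. cycle_expo a l n (ep (int i) y) (y (int i)))"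
  have fm: "?f m \<in> borel_measurable cycles_law" for m
    using measurable_cycle_expo_ep by measurable
  have E: "(\<integral>\<omega>. ?f m (cycles \<omega>) \<partial>N) = complex_of_real (prob (alive u))" for m
    using integral_cycle_product[OF a u, where m=m and l=l and n=n]
    by (subst (asm) distr_cycles[symmetric], subst (asm) integral_distr[OF measurable_cycles_law fm])
  have an: "a j \<le> a k" if "j \<le> k" for j k using a that by (auto simp: mono_def)
  have a0: "0 \<le> a j" for j using an[of 0 j] u by simp
  have Wm: "W t \<in> borel_measurable N" for t using con unfolding concatenation_def by blast
  have "(\<lambda>m. \<integral>\<omega>. ?f m (cycles \<omega>) \<partial>N) \<longlonglongrightarrow> (\<integral>\<omega>. of_bool (u < dur (cycles \<omega> 0)) * expo a l n (\<lambda>t. W t \<omega>) (\<lambda>t. t) \<partial>N)"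
  proof (rule integral_dominated_convergence[where w="\<lambda>_. K"])
    show "(\<lambda>\<omega>. ?f m (cycles \<omega>)) \<in> borel_measurable N" for m
      by (rule measurable_compose[OF measurable_cycles_law fm])
    have [measurable]: "(\<lambda>\<omega>. expo a l n (\<lambda>t. W t \<omega>) (\<lambda>t. t)) \<in> borel_measurable N"
      by (rule borel_measurable_expo) (auto simp: Wm)
    have [measurable]: "(\<lambda>\<omega>. dur (cycles \<omega> 0)) \<in> borel_measurable N"
      by (rule measurable_compose[OF measurable_cycles_law]) simp
    show "(\<lambda>\<omega>. of_bool (u < dur (cycles \<omega> 0)) * expo a l n (\<lambda>t. W t \<omega>) (\<lambda>t. t)) \<in> borel_measurable N"
      by measurable
    show "AE \<omega> in N. (\<lambda>m. ?f m (cycles \<omega>)) \<longlonglongrightarrow> of_bool (u < dur (cycles \<omega> 0)) * expo a l n (\<lambda>t. W t \<omega>) (\<lambda>t. t)"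
      using AE_glues
    proof eventually_elim
      case (elim \<omega>)
      obtain k where k: "a n \<le> ep k (cycles \<omega>)" using elim unfolding glues_def by blast
      have "?f m (cycles \<omega>) = of_bool (u < dur (cycles \<omega> 0)) * expo a l n (\<lambda>t. W t \<omega>) (\<lambda>t. t)" if "m \<ge> nat k" for m
      proof -
        have "k \<le> int (Suc m)" using that by linarith
        then have "a n \<le> ep (int (Suc m)) (cycles \<omega>)" using k ep_mono order.trans by blast
        then have "max 0 (min (a j) (ep (int (Suc m)) (cycles \<omega>))) = a j" if "j \<le> n" for j
          using an[OF that] a0[of j] by auto
        then show ?thesis unfolding prod_cycle_expo[OF elim]
          by (intro arg_cong2[where f="(*)"] refl expo_cong) simp_all
      qed
      then show ?case by (intro tendsto_eventually eventually_sequentiallyI)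
    qed
    show "AE \<omega> in N. norm (?f m (cycles \<omega>)) \<le> K" for m
      using AE_glues
    proof eventually_elim
      case (elim \<omega>)
      have "norm (expo a l n (\<lambda>t. W (max 0 (min t (ep (int (Suc m)) (cycles \<omega>)))) \<omega>) (\<lambda>t. max 0 (min t (ep (int (Suc m)) (cycles \<omega>))))) \<le> K"
        unfolding K_def
      proof (rule norm_expo_le)
        show "max 0 (min (a (Suc j)) e) - max 0 (min (a j) e) \<le> a (Suc j) - a j" for j e
          using an[of j "Suc j"] by (auto simp: min_def max_def)
      qed
      moreover have "0 \<le> K" by (simp add: K_def)
      ultimately show ?case unfolding prod_cycle_expo[OF elim] norm_mult by (auto simp: of_bool_def)
    qed
  qed simp
  then show ?thesis unfolding E by (simp add: LIMSEQ_const_iff)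
qed

end

section \<open>The process seen from a typical time\<close>

definition incr_expo :: "(nat \<Rightarrow> real) \<Rightarrow> (nat \<Rightarrow> real) \<Rightarrow> nat \<Rightarrow> (real \<Rightarrow> real) \<Rightarrow> real \<Rightarrow> complex" where
  "incr_expo a l n v s = iexp (\<Sum>j<n. l j * (v (s + a (Suc j)) - v (s + a j)))"

lemma norm_incr_expo [simp]: "norm (incr_expo a l n v s) = 1"
  by (simp add: incr_expo_def)

locale finite_mean_decomposition = decomposition +
  assumes mean_finite: "(\<integral>\<^sup>+\<omega>. T 0 \<omega> \<partial>N) < \<infinity>"
begin

definition "rate = 1 / enn2real (\<integral>\<^sup>+\<omega>. T 0 \<omega> \<partial>N)"

lemma measurable_T [measurable]: "T k \<in> borel_measurable N"
proof -
  have "(\<lambda>\<omega>. fst (lifetime_path (T k) (B k) \<omega>)) \<in> borel_measurable N"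
    by (rule measurable_compose[OF measurable_cycle measurable_fst])
  then show ?thesis by (simp add: lifetime_path_def)
qed

text \<open>All \<open>T k\<close> have the same law, so with mean zero they would vanish almost
  surely, contrary to the divergence of their sum.\<close>

lemma mean_pos: "(\<integral>\<^sup>+\<omega>. T 0 \<omega> \<partial>N) > 0"
proof (rule ccontr)
  assume "\<not> ?thesis"
  then have 0: "(\<integral>\<^sup>+\<omega>. T 0 \<omega> \<partial>N) = 0" by simp
  have I: "(\<integral>\<^sup>+\<omega>. T k \<omega> \<partial>N) = (\<integral>\<^sup>+c. fst c \<partial>distr N lifetime_path_space (lifetime_path (T k) (B k)))" for k
    by (subst nn_integral_distr[OF measurable_cycle]) (auto simp: lifetime_path_def)
  have D: "distr N lifetime_path_space (lifetime_path (T k) (B k)) = distr N lifetime_path_space (lifetime_path (T 0) (B 0))" for k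
    using fam unfolding decomposition_family_def by blast
  have "(\<integral>\<^sup>+\<omega>. T k \<omega> \<partial>N) = 0" for k
    using 0 unfolding I D[of k] .
  then have "AE \<omega> in N. T k \<omega> = 0" for k by (subst (asm) nn_integral_0_iff_AE) auto
  then have "AE \<omega> in N. \<forall>k. T k \<omega> = 0" by (simp add: AE_all_countable)
  moreover have "AE \<omega> in N. (\<Sum>n. T (1 + int n) \<omega>) = \<infinity>"
    using fam unfolding decomposition_family_def by blast
  ultimately have "AE \<omega> in N. False" by eventually_elim simp
  then show False by simp
qed

lemma rate: "0 < rate" "ennreal rate * (\<integral>\<^sup>+\<omega>. T 0 \<omega> \<partial>N) = 1"
proof -
  obtain m where m: "(\<integral>\<^sup>+\<omega>. T 0 \<omega> \<partial>N) = ennreal m" "0 \<le> m"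
    using mean_finite by (cases "\<integral>\<^sup>+\<omega>. T 0 \<omega> \<partial>N") auto
  have "m > 0" using mean_pos m by simp
  then show "0 < rate" "ennreal rate * (\<integral>\<^sup>+\<omega>. T 0 \<omega> \<partial>N) = 1"
    unfolding rate_def m by (simp_all add: ennreal_mult[symmetric])
qed

text \<open>A functional of the process seen from time \<open>s\<close>, through the sequence of cycles.\<close>

definition covariant :: "((int \<Rightarrow> ennreal \<times> (real \<Rightarrow> real)) \<Rightarrow> real \<Rightarrow> ennreal) \<Rightarrow> bool" where
  "covariant H \<longleftrightarrow> (\<lambda>(y, s). H y s) \<in> borel_measurable (cycles_law \<Otimes>\<^sub>M borel) \<and>
    (\<forall>y w d s. glues y w \<longrightarrow> H (shift_seq d y) s = H y (ep d y + s))"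

lemma covariant_measurable:
  assumes "covariant H" and f[measurable]: "f \<in> M \<rightarrow>\<^sub>M cycles_law" and g[measurable]: "g \<in> borel_measurable M"
  shows "(\<lambda>x. H (f x) (g x)) \<in> borel_measurable M"
  using measurable_compose[of "\<lambda>x. (f x, g x)" M "cycles_law \<Otimes>\<^sub>M borel" "\<lambda>(y, s). H y s" borel] assms
  unfolding covariant_def by simp

definition window :: "((int \<Rightarrow> ennreal \<times> (real \<Rightarrow> real)) \<Rightarrow> real \<Rightarrow> ennreal) \<Rightarrow>
    (int \<Rightarrow> ennreal \<times> (real \<Rightarrow> real)) \<Rightarrow> real \<Rightarrow> real \<Rightarrow> ennreal" where
  "window H y p q = (\<integral>\<^sup>+s. indicator {p..<q} s * H y s \<partial>lborel)"

lemma measurable_window: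
  assumes H: "covariant H" and f[measurable]: "f \<in> M \<rightarrow>\<^sub>M cycles_law"
    and [measurable]: "p \<in> borel_measurable M" "q \<in> borel_measurable M"
  shows "(\<lambda>x. window H (f x) (p x) (q x)) \<in> borel_measurable M"
  unfolding window_def
proof (rule lborel.borel_measurable_nn_integral)
  have [measurable]: "(\<lambda>z. H (f (fst z)) (snd z)) \<in> borel_measurable (M \<Otimes>\<^sub>M lborel)"
    by (rule covariant_measurable[OF H]) measurable
  have [measurable]: "(\<lambda>z. indicator {p (fst z)..<q (fst z)} (snd z) :: ennreal) \<in> borel_measurable (M \<Otimes>\<^sub>M lborel)"
    unfolding indicator_def atLeastLessThan_iff by measurable
  show "(\<lambda>(x, s). indicator {p x..<q x} s * H (f x) s) \<in> borel_measurable (M \<Otimes>\<^sub>M lborel)"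
    unfolding case_prod_unfold by measurable
qed

lemma measurable_H_time:
  assumes "covariant H" "y \<in> space cycles_law"
  shows "H y \<in> borel_measurable borel"
  by (rule covariant_measurable[OF assms(1)]) (use assms(2) in auto)

lemma cycles_in_space: "\<omega> \<in> space N \<Longrightarrow> cycles \<omega> \<in> space cycles_law"
  by (rule measurable_space[OF measurable_cycles_law])

lemma nn_integral_translate:
  "g \<in> borel_measurable borel \<Longrightarrow> (\<integral>\<^sup>+s. g (c + s) \<partial>lborel) = (\<integral>\<^sup>+s. g s \<partial>lborel)" for g :: "real \<Rightarrow> ennreal"
  using nn_integral_real_affine[of g 1 c] by simp

lemma window_shift:
  assumes H: "covariant H" and y: "glues y w" "y \<in> space cycles_law"
  shows "window H (shift_seq d y) p q = window H y (ep d y + p) (ep d y + q)"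
proof -
  note [measurable] = measurable_H_time[OF H y(2)]
  have "window H (shift_seq d y) p q = (\<integral>\<^sup>+s. indicator {ep d y + p..<ep d y + q} (ep d y + s) * H y (ep d y + s) \<partial>lborel)"
    using H y unfolding window_def covariant_def by (intro nn_integral_cong) (auto simp: indicator_def)
  also have "\<dots> = window H y (ep d y + p) (ep d y + q)"
    unfolding window_def by (rule nn_integral_translate) measurable
  finally show ?thesis .
qed

lemma window_split:
  assumes H: "covariant H" "y \<in> space cycles_law" and "p \<le> q" "q \<le> r"
  shows "window H y p r = window H y p q + window H y q r"
proof -
  note [measurable] = measurable_H_time[OF H]
  have "indicator {p..<r} s * H y s = indicator {p..<q} s * H y s + indicator {q..<r} s * H y s" for s
    using assms(3,4) by (auto simp: indicator_def)
  then show ?thesis unfolding window_def by (simp add: nn_integral_add)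
qed

lemma window_le: "(\<And>s. H y s \<le> 1) \<Longrightarrow> window H y p q \<le> ennreal (q - p)"
proof -
  assume le: "\<And>s. H y s \<le> 1"
  have "window H y p q \<le> (\<integral>\<^sup>+s. indicator {p..<q} s \<partial>lborel)"
    unfolding window_def using le by (intro nn_integral_mono) (auto simp: indicator_def)
  also have "\<dots> \<le> ennreal (q - p)" by (cases "p \<le> q") (simp_all add: emeasure_lborel_Ico)
  finally show ?thesis .
qed

lemma nn_integral_cycles_shift:
  assumes "g \<in> borel_measurable cycles_law"
  shows "(\<integral>\<^sup>+\<omega>. g (shift_seq d (cycles \<omega>)) \<partial>N) = (\<integral>\<^sup>+\<omega>. g (cycles \<omega>) \<partial>N)"
proof -
  have tr: "(\<integral>\<^sup>+\<omega>. h (cycles \<omega>) \<partial>N) = (\<integral>\<^sup>+y. h y \<partial>cycles_law)" if "h \<in> borel_measurable cycles_law" for h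
    using nn_integral_distr[OF measurable_cycles_law, of h] that by (simp add: distr_cycles)
  show ?thesis
    using tr[of "\<lambda>y. g (shift_seq d y)"] tr[of g] assms cyc.nn_integral_shift[OF assms, of d] by simp
qed

lemma cycle_stationary:
  assumes H: "covariant H" and le: "\<And>y s. H y s \<le> 1" and r: "0 \<le> r"
  shows "(\<integral>\<^sup>+\<omega>. window H (cycles \<omega>) (- r) (dur (cycles \<omega> 0) - r) \<partial>N) = (\<integral>\<^sup>+\<omega>. window H (cycles \<omega>) 0 (dur (cycles \<omega> 0)) \<partial>N)"
proof -
  have wm: "(\<lambda>\<omega>. window H (cycles \<omega>) (p (cycles \<omega>)) (q (cycles \<omega>))) \<in> borel_measurable N"
    if [measurable]: "p \<in> borel_measurable cycles_law" "q \<in> borel_measurable cycles_law" for p q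
    by (rule measurable_window[OF H]) measurable
  let ?d = "\<lambda>\<omega>. dur (cycles \<omega> 0)"
  \<comment> \<open>The next epoch is at \<open>?d \<omega>\<close>; seen from there, the stretch of
    length \<open>r\<close> before it is the window from \<open>- r\<close> to
    \<open>0\<close>.\<close>
  have "(\<integral>\<^sup>+\<omega>. window H (cycles \<omega>) (?d \<omega> - r) (?d \<omega>) \<partial>N) = (\<integral>\<^sup>+\<omega>. window H (shift_seq 1 (cycles \<omega>)) (- r) 0 \<partial>N)"
  proof (rule nn_integral_cong_AE)
    show "AE \<omega> in N. window H (cycles \<omega>) (?d \<omega> - r) (?d \<omega>) = window H (shift_seq 1 (cycles \<omega>)) (- r) 0"
      using AE_glues AE_space
    proof eventually_elim
      case (elim \<omega>)
      have "ep 1 (cycles \<omega>) = ?d \<omega>" using ep_Suc[of 0 "cycles \<omega>"] by simp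
      then show ?case using window_shift[OF H elim(1) cycles_in_space[OF elim(2)], of 1 "- r" 0] by simp
    qed
  qed
  also have "\<dots> = (\<integral>\<^sup>+\<omega>. window H (cycles \<omega>) (- r) 0 \<partial>N)"
    by (rule nn_integral_cycles_shift) (rule measurable_window[OF H], measurable)
  finally have eq: "(\<integral>\<^sup>+\<omega>. window H (cycles \<omega>) (?d \<omega> - r) (?d \<omega>) \<partial>N) = (\<integral>\<^sup>+\<omega>. window H (cycles \<omega>) (- r) 0 \<partial>N)" .
  have "(\<integral>\<^sup>+\<omega>. window H (cycles \<omega>) (- r) 0 \<partial>N) \<le> (\<integral>\<^sup>+\<omega>. ennreal r \<partial>N)"
    using window_le[of H _ "- r" 0] le by (intro nn_integral_mono) simp
  then have fin: "(\<integral>\<^sup>+\<omega>. window H (cycles \<omega>) (- r) 0 \<partial>N) \<noteq> \<infinity>"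
    by (auto simp: emeasure_space_1 top_unique)
  \<comment> \<open>The window from \<open>- r\<close> to \<open>?d \<omega>\<close> is cut at
    \<open>?d \<omega> - r\<close> and at \<open>0\<close>, which also works if \<open>r\<close>
    exceeds the cycle. Cancelling the common boundary term in \<open>ennreal\<close> relies on its
    finiteness, \<open>fin\<close>.\<close>
  have "(\<integral>\<^sup>+\<omega>. window H (cycles \<omega>) (- r) (?d \<omega> - r) \<partial>N) + (\<integral>\<^sup>+\<omega>. window H (cycles \<omega>) (?d \<omega> - r) (?d \<omega>) \<partial>N)
     = (\<integral>\<^sup>+\<omega>. window H (cycles \<omega>) (- r) (?d \<omega> - r) + window H (cycles \<omega>) (?d \<omega> - r) (?d \<omega>) \<partial>N)"
    by (rule nn_integral_add[symmetric]) (rule wm; measurable)+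
  also have "\<dots> = (\<integral>\<^sup>+\<omega>. window H (cycles \<omega>) (- r) 0 + window H (cycles \<omega>) 0 (?d \<omega>) \<partial>N)"
  proof (rule nn_integral_cong)
    fix \<omega> assume "\<omega> \<in> space N"
    note sp = window_split[OF H cycles_in_space[OF this]]
    show "window H (cycles \<omega>) (- r) (?d \<omega> - r) + window H (cycles \<omega>) (?d \<omega> - r) (?d \<omega>) =
      window H (cycles \<omega>) (- r) 0 + window H (cycles \<omega>) 0 (?d \<omega>)"
      using sp[of "- r" "?d \<omega> - r" "?d \<omega>"] sp[of "- r" 0 "?d \<omega>"] r by simp
  qed
  also have "\<dots> = (\<integral>\<^sup>+\<omega>. window H (cycles \<omega>) (- r) 0 \<partial>N) + (\<integral>\<^sup>+\<omega>. window H (cycles \<omega>) 0 (?d \<omega>) \<partial>N)"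
    by (rule nn_integral_add) (rule wm; measurable)+
  finally show ?thesis using fin unfolding eq by (simp add: ennreal_add_left_cancel add.commute)
qed

section \<open>Gaussian increments under the length-biased law\<close>

text \<open>The first coordinate has density \<open>T 0\<close> over its mean with respect to
  \<open>N\<close>; given it, the second is uniform on cycle \<open>0\<close>.\<close>

definition stat_law where
  "stat_law = density (N \<Otimes>\<^sub>M lborel) (\<lambda>(\<omega>, s). ennreal (rate * indicator {0..<dur (cycles \<omega> 0)} s))"

lemma sets_stat_law[measurable_cong]: "sets stat_law = sets (N \<Otimes>\<^sub>M lborel)"
  by (simp add: stat_law_def)

lemma measurable_cycles_fst[measurable]: "(\<lambda>p. cycles (fst p)) \<in> N \<Otimes>\<^sub>M lborel \<rightarrow>\<^sub>M cycles_law"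
  by (rule measurable_compose[OF measurable_fst measurable_cycles_law])

lemma measurable_dur_cycles[measurable]: "(\<lambda>\<omega>. dur (cycles \<omega> k)) \<in> borel_measurable N"
  by (rule measurable_compose[OF measurable_cycles_law measurable_dur_component])

lemma measurable_dur_fst[measurable]: "(\<lambda>p. dur (cycles (fst p) k)) \<in> borel_measurable (N \<Otimes>\<^sub>M lborel)"
  by (rule measurable_compose[OF measurable_fst measurable_dur_cycles])

lemma stat_density[measurable]:
  "(\<lambda>p. rate * indicator {0..<dur (cycles (fst p) 0)} (snd p)) \<in> borel_measurable (N \<Otimes>\<^sub>M lborel)"
  unfolding indicator_def atLeastLessThan_iff by measurable

lemma nn_integral_stat_law:
  assumes h[measurable]: "h \<in> borel_measurable (N \<Otimes>\<^sub>M lborel)"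
  shows "(\<integral>\<^sup>+p. h p \<partial>stat_law) = ennreal rate * (\<integral>\<^sup>+\<omega>. (\<integral>\<^sup>+s. indicator {0..<dur (cycles \<omega> 0)} s * h (\<omega>, s) \<partial>lborel) \<partial>N)"
proof -
  let ?i = "\<lambda>p. indicator {0..<dur (cycles (fst p) 0)} (snd p) :: ennreal"
  have [measurable]: "?i \<in> borel_measurable (N \<Otimes>\<^sub>M lborel)"
    unfolding indicator_def atLeastLessThan_iff by measurable
  have "(\<integral>\<^sup>+p. h p \<partial>stat_law) = (\<integral>\<^sup>+p. ennreal (rate * indicator {0..<dur (cycles (fst p) 0)} (snd p)) * h p \<partial>(N \<Otimes>\<^sub>M lborel))"
    unfolding stat_law_def case_prod_unfold by (rule nn_integral_density) measurable
  also have "\<dots> = (\<integral>\<^sup>+p. ennreal rate * (?i p * h p) \<partial>(N \<Otimes>\<^sub>M lborel))"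
    using rate(1) by (intro nn_integral_cong) (auto simp: indicator_def)
  also have "\<dots> = ennreal rate * (\<integral>\<^sup>+p. ?i p * h p \<partial>(N \<Otimes>\<^sub>M lborel))"
    by (rule nn_integral_cmult) measurable
  also have "(\<integral>\<^sup>+p. ?i p * h p \<partial>(N \<Otimes>\<^sub>M lborel)) = (\<integral>\<^sup>+\<omega>. (\<integral>\<^sup>+s. indicator {0..<dur (cycles \<omega> 0)} s * h (\<omega>, s) \<partial>lborel) \<partial>N)"
    by (subst lborel.nn_integral_fst[symmetric]) auto
  finally show ?thesis .
qed

lemma nn_integral_T_dur: "AE \<omega> in N. T k \<omega> = ennreal (dur (cycles \<omega> k))"
  using AE_T_finite by eventually_elim (auto simp: dur_def)

lemma prob_space_stat_law: "prob_space stat_law"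
proof
  have "emeasure stat_law (space stat_law) = (\<integral>\<^sup>+p. 1 \<partial>stat_law)" by simp
  also have "\<dots> = ennreal rate * (\<integral>\<^sup>+\<omega>. ennreal (dur (cycles \<omega> 0)) \<partial>N)"
    by (subst nn_integral_stat_law) (auto simp: emeasure_lborel_Ico)
  also have "(\<integral>\<^sup>+\<omega>. ennreal (dur (cycles \<omega> 0)) \<partial>N) = (\<integral>\<^sup>+\<omega>. T 0 \<omega> \<partial>N)"
    by (rule nn_integral_cong_AE) (use nn_integral_T_dur[of 0] in eventually_elim, simp)
  finally show "emeasure stat_law (space stat_law) = 1" by (simp add: rate(2))
qed

lemma measurable_incr_expo:
  assumes [measurable]: "f \<in> M \<rightarrow>\<^sub>M cycles_law" "g \<in> borel_measurable M"
  shows "(\<lambda>x. incr_expo a l n (glued (f x)) (g x)) \<in> borel_measurable M"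
proof -
  have f: "f \<in> M \<rightarrow>\<^sub>M PiM UNIV (\<lambda>_. lifetime_path_space)"
    using assms(1) by (simp add: measurable_cong_sets[OF refl sets_cycles_law])
  have [measurable]: "(\<lambda>x. glued (f x) (g x + r)) \<in> borel_measurable M" for r
    by (rule measurable_glued[OF f]) measurable
  show ?thesis unfolding incr_expo_def by measurable
qed

lemma covariant_incr_expo:
  assumes [measurable]: "A \<in> sets borel"
  shows "covariant (\<lambda>y s. indicator A (incr_expo a l n (glued y) s))"
  unfolding covariant_def
proof (intro conjI allI impI)
  have "(\<lambda>p. incr_expo a l n (glued (fst p)) (snd p)) \<in> borel_measurable (cycles_law \<Otimes>\<^sub>M borel)"
    by (rule measurable_incr_expo) auto
  then show "(\<lambda>(y, s). indicator A (incr_expo a l n (glued y) s) :: ennreal) \<in> borel_measurable (cycles_law \<Otimes>\<^sub>M borel)"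
    unfolding case_prod_unfold by measurable
  fix y w d s assume "glues y w"
  then show "indicator A (incr_expo a l n (glued (shift_seq d y)) s) = (indicator A (incr_expo a l n (glued y) (ep d y + s)) :: ennreal)"
    by (simp add: incr_expo_def glued_shift add.assoc)
qed

text \<open>With the origin \<open>s\<close> fixed outside, the density restricts to the event that
  cycle \<open>0\<close> survives \<open>s\<close>, and \<open>forward_increments\<close> applies at
  \<open>u = s\<close> to the grid moved by \<open>s\<close>. What is left is the compensator times
  the total mass of the density.\<close>

lemma integral_incr_expo_forward:
  assumes a: "mono a" "0 \<le> a 0"
  shows "(\<integral>p. incr_expo a l n (glued (cycles (fst p))) (snd p) \<partial>stat_law) =
    complex_of_real (exp (- incr_variance a l n / 2))"
proof -
  define e where "e = exp (- incr_variance a l n / 2)"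
  let ?L = "N \<Otimes>\<^sub>M lborel"
  let ?g = "\<lambda>p. rate * indicator {0..<dur (cycles (fst p) 0)} (snd p)"
  let ?h = "\<lambda>p. incr_expo a l n (glued (cycles (fst p))) (snd p)"
  interpret S: prob_space stat_law by (rule prob_space_stat_law)
  interpret pl: pair_sigma_finite N lborel ..
  have hm[measurable]: "?h \<in> borel_measurable ?L" by (rule measurable_incr_expo) auto
  have g0: "0 \<le> ?g p" for p using rate(1) by simp
  have nn: "(\<integral>\<^sup>+p. ennreal (?g p) \<partial>?L) = 1"
  proof -
    have "(\<integral>\<^sup>+p. 1 \<partial>stat_law) = (\<integral>\<^sup>+p. ennreal (?g p) * 1 \<partial>?L)"
      unfolding stat_law_def case_prod_unfold by (rule nn_integral_density) measurable
    then show ?thesis by (simp add: S.emeasure_space_1)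
  qed
  have gi: "integrable ?L ?g" by (rule integrableI_nonneg) (use g0 nn in auto)
  have g1: "(\<integral>p. ?g p \<partial>?L) = 1"
    using nn g0 by (subst integral_eq_nn_integral) auto
  have ghi: "integrable ?L (\<lambda>p. ?g p *\<^sub>R ?h p)"
    by (rule Bochner_Integration.integrable_bound[OF gi]) auto
  have inner: "(\<integral>\<omega>. ?g (\<omega>, s) *\<^sub>R ?h (\<omega>, s) \<partial>N) = complex_of_real e * complex_of_real (\<integral>\<omega>. ?g (\<omega>, s) \<partial>N)" for s
  proof (cases "0 \<le> s")
    case False
    then show ?thesis by simp
  next
    case True
    let ?a = "\<lambda>j. s + a j"
    have a': "mono ?a" using a(1) by (auto simp: mono_def)
    have eq: "AE \<omega> in N. ?g (\<omega>, s) *\<^sub>R ?h (\<omega>, s) =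
       complex_of_real (rate * e) * (of_bool (s < dur (cycles \<omega> 0)) * expo ?a l n (\<lambda>t. W t \<omega>) (\<lambda>t. t))"
      using AE_glues
    proof eventually_elim
      case (elim \<omega>)
      have "complex_of_real e * expo ?a l n (\<lambda>t. W t \<omega>) (\<lambda>t. t) = incr_expo a l n (\<lambda>t. W t \<omega>) s"
      proof -
        have "complex_of_real e = exp (complex_of_real (- incr_variance a l n / 2))"
          unfolding e_def by (simp only: exp_of_real)
        then show ?thesis
          unfolding expo_def incr_expo_def by (simp only: exp_add[symmetric]) (rule arg_cong[where f=exp], simp)
      qed
      moreover have "glued (cycles \<omega>) = (\<lambda>t. W t \<omega>)" using glued_eq[OF elim] by (rule ext)
      ultimately show ?case using True by (simp add: indicator_def scaleR_conv_of_real)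
    qed
    have Wm: "W t \<in> borel_measurable N" for t using con unfolding concatenation_def by blast
    have em[measurable]: "(\<lambda>\<omega>. expo ?a l n (\<lambda>t. W t \<omega>) (\<lambda>t. t)) \<in> borel_measurable N"
      by (rule borel_measurable_expo) (auto simp: Wm)
    have hs: "(\<lambda>\<omega>. ?h (\<omega>, s)) \<in> borel_measurable N"
      unfolding fst_conv snd_conv by (rule measurable_incr_expo) auto
    have gs: "(\<lambda>\<omega>. ?g (\<omega>, s)) \<in> borel_measurable N"
      unfolding fst_conv snd_conv indicator_def atLeastLessThan_iff by measurable
    have "(\<integral>\<omega>. ?g (\<omega>, s) *\<^sub>R ?h (\<omega>, s) \<partial>N) =
      (\<integral>\<omega>. complex_of_real (rate * e) * (of_bool (s < dur (cycles \<omega> 0)) * expo ?a l n (\<lambda>t. W t \<omega>) (\<lambda>t. t)) \<partial>N)"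
      by (rule integral_cong_AE[OF borel_measurable_scaleR[OF gs hs] _ eq]) measurable
    also have "\<dots> = complex_of_real (rate * e) * complex_of_real (prob {\<omega> \<in> space N. s < dur (cycles \<omega> 0)})"
      unfolding integral_mult_right_zero using forward_increments[OF a' True, of l n] a(2) by simp
    also have "prob {\<omega> \<in> space N. s < dur (cycles \<omega> 0)} = (\<integral>\<omega>. indicator {\<omega> \<in> space N. s < dur (cycles \<omega> 0)} \<omega> \<partial>N)"
      by (simp add: Int_absorb2)
    also have "\<dots> = (\<integral>\<omega>. indicator {0..<dur (cycles \<omega> 0)} s \<partial>N)"
      using True by (intro Bochner_Integration.integral_cong refl) (auto simp: indicator_def)
    finally show ?thesis by simp
  qed
  have "(\<integral>p. ?h p \<partial>stat_law) = (\<integral>p. ?g p *\<^sub>R ?h p \<partial>?L)"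
    unfolding stat_law_def case_prod_unfold by (rule integral_density) (use g0 in auto)
  also have "\<dots> = (\<integral>s. (\<integral>\<omega>. ?g (\<omega>, s) *\<^sub>R ?h (\<omega>, s) \<partial>N) \<partial>lborel)"
    using pl.integral_snd[of "\<lambda>\<omega> s. ?g (\<omega>, s) *\<^sub>R ?h (\<omega>, s)"] ghi by (simp add: case_prod_unfold)
  also have "\<dots> = complex_of_real e * complex_of_real (\<integral>s. (\<integral>\<omega>. ?g (\<omega>, s) \<partial>N) \<partial>lborel)"
    unfolding inner by (simp only: integral_mult_right_zero integral_complex_of_real)
  also have "(\<integral>s. (\<integral>\<omega>. ?g (\<omega>, s) \<partial>N) \<partial>lborel) = (\<integral>p. ?g p \<partial>?L)"
    using pl.integral_snd[of "\<lambda>\<omega> s. ?g (\<omega>, s)"] gi by (simp add: case_prod_unfold)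
  finally show ?thesis unfolding g1 e_def by (simp only: of_real_1 mult_1_right)
qed

text \<open>Invariance is proved for nonnegative functionals. It reaches the complex exponentials
  through their laws, tested on indicators.\<close>

lemma distr_eq_of_nn_integral:
  assumes M: "f \<in> borel_measurable M" and M': "g \<in> borel_measurable M'"
    and eq: "\<And>A. A \<in> sets borel \<Longrightarrow> (\<integral>\<^sup>+x. indicator A (f x) \<partial>M) = (\<integral>\<^sup>+x. indicator A (g x) \<partial>M')"
  shows "distr M borel f = distr M' borel g"
proof (rule measure_eqI)
  fix A assume "A \<in> sets (distr M borel f)"
  then have A: "A \<in> sets borel" by simp
  have e: "emeasure (distr K borel h) A = (\<integral>\<^sup>+x. indicator A (h x) \<partial>K)" if "h \<in> borel_measurable K" for K h
  proof -
    have "(\<integral>\<^sup>+x. indicator A (h x) \<partial>K) = (\<integral>\<^sup>+x. indicator A x \<partial>distr K borel h)"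
      by (rule nn_integral_distr[OF that, symmetric]) (use A in simp)
    then show ?thesis using A by simp
  qed
  show "emeasure (distr M borel f) A = emeasure (distr M' borel g) A"
    unfolding e[OF M] e[OF M'] by (rule eq[OF A])
qed simp

lemma integral_incr_expo:
  assumes a: "mono a"
  shows "(\<integral>p. incr_expo a l n (glued (cycles (fst p))) (snd p) \<partial>stat_law) =
    complex_of_real (exp (- incr_variance a l n / 2))"
proof -
  \<comment> \<open>Large enough for the shifted grid \<open>b\<close> to start at a nonnegative
    time.\<close>
  define r where "r = max 0 (- a 0)"
  define b where "b = (\<lambda>j. a j + r)"
  have b: "mono b" "0 \<le> b 0" using a by (auto simp: mono_def b_def r_def)
  have r: "0 \<le> r" by (simp add: r_def)
  let ?f = "\<lambda>a p. incr_expo a l n (glued (cycles (fst p))) (snd p)"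
  have fm: "?f a \<in> borel_measurable (N \<Otimes>\<^sub>M lborel)" for a by (rule measurable_incr_expo) auto
  then have fm': "?f a \<in> borel_measurable stat_law" for a by (simp add: measurable_cong_sets[OF sets_stat_law refl])
  have ab: "incr_expo a l n v s = incr_expo b l n v (s - r)" for v s
    unfolding incr_expo_def b_def by (simp add: algebra_simps)
  have "distr stat_law borel (?f a) = distr stat_law borel (?f b)"
  proof (rule distr_eq_of_nn_integral[OF fm' fm'])
    fix A :: "complex set" assume A[measurable]: "A \<in> sets borel"
    define H where "H y s = (indicator A (incr_expo b l n (glued y) s) :: ennreal)" for y s
    have H: "covariant H" unfolding H_def using A by (rule covariant_incr_expo)
    have im: "(\<lambda>p. indicator A (?f a p) :: ennreal) \<in> borel_measurable (N \<Otimes>\<^sub>M lborel)" for a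
      using fm[of a] by measurable
    have "(\<integral>\<^sup>+p. indicator A (?f a p) \<partial>stat_law) = ennreal rate * (\<integral>\<^sup>+\<omega>. (\<integral>\<^sup>+s. indicator {0..<dur (cycles \<omega> 0)} s * H (cycles \<omega>) (s - r) \<partial>lborel) \<partial>N)"
      unfolding nn_integral_stat_law[OF im] by (simp add: H_def ab)
    also have "(\<integral>\<^sup>+\<omega>. (\<integral>\<^sup>+s. indicator {0..<dur (cycles \<omega> 0)} s * H (cycles \<omega>) (s - r) \<partial>lborel) \<partial>N)
       = (\<integral>\<^sup>+\<omega>. window H (cycles \<omega>) (- r) (dur (cycles \<omega> 0) - r) \<partial>N)"
    proof (rule nn_integral_cong)
      fix \<omega> assume "\<omega> \<in> space N"
      note [measurable] = measurable_H_time[OF H cycles_in_space[OF this]]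
      have "(\<integral>\<^sup>+s. indicator {0..<dur (cycles \<omega> 0)} s * H (cycles \<omega>) (s - r) \<partial>lborel)
        = (\<integral>\<^sup>+s. indicator {- r..<dur (cycles \<omega> 0) - r} (- r + s) * H (cycles \<omega>) (- r + s) \<partial>lborel)"
        by (intro nn_integral_cong) (auto simp: indicator_def)
      also have "\<dots> = window H (cycles \<omega>) (- r) (dur (cycles \<omega> 0) - r)"
        unfolding window_def by (rule nn_integral_translate) measurable
      finally show "(\<integral>\<^sup>+s. indicator {0..<dur (cycles \<omega> 0)} s * H (cycles \<omega>) (s - r) \<partial>lborel) =
        window H (cycles \<omega>) (- r) (dur (cycles \<omega> 0) - r)" .
    qed
    also have "\<dots> = (\<integral>\<^sup>+\<omega>. window H (cycles \<omega>) 0 (dur (cycles \<omega> 0)) \<partial>N)"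
      by (rule cycle_stationary[OF H _ r]) (simp add: H_def indicator_def)
    also have "ennreal rate * \<dots> = (\<integral>\<^sup>+p. indicator A (?f b p) \<partial>stat_law)"
      unfolding nn_integral_stat_law[OF im] by (simp add: H_def window_def)
    finally show "(\<integral>\<^sup>+p. indicator A (?f a p) \<partial>stat_law) = (\<integral>\<^sup>+p. indicator A (?f b p) \<partial>stat_law)" .
  qed
  then have "(\<integral>z. z \<partial>distr stat_law borel (?f a)) = (\<integral>z. z \<partial>distr stat_law borel (?f b))" by simp
  then have "(\<integral>p. ?f a p \<partial>stat_law) = (\<integral>p. ?f b p \<partial>stat_law)"
    using fm' by (simp add: integral_distr)
  also have "\<dots> = complex_of_real (exp (- (\<Sum>j<n. (l j)\<^sup>2 * (b (Suc j) - b j)) / 2))"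
    by (rule integral_incr_expo_forward[OF b])
  finally show ?thesis by (simp add: b_def)
qed

end

section \<open>Choice of the new origin\<close>

context finite_mean_decomposition
begin

text \<open>The factor \<open>rate\<close> makes the mean demand equal to the unit supply of each
  site.\<close>

definition demand :: "(int \<Rightarrow> ennreal \<times> (real \<Rightarrow> real)) \<Rightarrow> ennreal" where
  "demand y = ennreal rate * fst (y 0)"

definition "ship n = cyc.shipment demand n"

lemma measurable_demand[measurable]: "demand \<in> borel_measurable cycles_law"
proof -
  have [measurable]: "(\<lambda>y. fst (y 0)) \<in> borel_measurable cycles_law"
    by (rule measurable_compose[OF measurable_cycles_law_component measurable_fst])
  show ?thesis unfolding demand_def by measurable
qed

lemma AE_cycles: "AE y in cycles_law. P y \<Longrightarrow> AE \<omega> in N. P (cycles \<omega>)"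
  by (rule AE_distrD[OF measurable_cycles_law]) (subst distr_cycles)

lemma nn_integral_demand: "(\<integral>\<^sup>+y. demand y \<partial>cycles_law) = 1"
proof -
  have "(\<integral>\<^sup>+y. demand y \<partial>cycles_law) = (\<integral>\<^sup>+\<omega>. demand (cycles \<omega>) \<partial>N)"
    using nn_integral_distr[OF measurable_cycles_law, of demand] by (simp add: distr_cycles)
  also have "\<dots> = ennreal rate * (\<integral>\<^sup>+\<omega>. T 0 \<omega> \<partial>N)"
    unfolding demand_def fst_cycles by (rule nn_integral_cmult) simp
  finally show ?thesis by (simp add: rate(2))
qed

lemma measurable_ship[measurable]: "ship n \<in> borel_measurable cycles_law"
  unfolding ship_def using cyc.measurable_shipped[OF measurable_demand] by blast

lemma AE_ship: "AE \<omega> in N. (\<Sum>n. ship n (cycles \<omega>)) = 1"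
  "AE \<omega> in N. (\<Sum>n. ship n (shift_seq (- int_decode n) (cycles \<omega>))) = demand (cycles \<omega>)"
  unfolding ship_def
  by (rule AE_cycles[OF cyc.balanced_transport(1)[OF measurable_demand nn_integral_demand]]
      AE_cycles[OF cyc.balanced_transport(2)[OF measurable_demand nn_integral_demand]])+

lemma ship_le: "ship n y \<le> ennreal rate * fst (y (int_decode n))"
  using cyc.shipment_le[of demand n y] by (simp add: ship_def demand_def shift_seq_def)

text \<open>
  Given \<open>\<omega>\<close>, the time seen as the new origin lies in cycle \<open>int_decode n\<close> with probability
  \<open>ship n (cycles \<omega>)\<close> and is uniformly distributed there. Cycles of length \<open>0\<close> receive no mass,
  so that the junk value of the quotient is harmless.
\<close>

definition coupling_density :: "'a \<times> real \<Rightarrow> ennreal" where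
  "coupling_density p = (\<Sum>n. let y = cycles (fst p); d = int_decode n in
     ship n y * (indicator {ep d y..<ep d y + dur (y d)} (snd p) / ennreal (dur (y d))))"

definition "coupled = density (N \<Otimes>\<^sub>M lborel) coupling_density"

lemma measurable_coupling_term[measurable]:
  "(\<lambda>p. ship n (cycles (fst p)) * (indicator {ep d (cycles (fst p))..<ep d (cycles (fst p)) + dur (cycles (fst p) d)} (snd p)
     / ennreal (dur (cycles (fst p) d)))) \<in> borel_measurable (N \<Otimes>\<^sub>M lborel)"
proof -
  have [measurable]: "(\<lambda>p. ep d (cycles (fst p))) \<in> borel_measurable (N \<Otimes>\<^sub>M lborel)"
    by (rule measurable_compose[OF measurable_cycles_fst measurable_ep_cycles_law])
  have [measurable]: "(\<lambda>p. ship n (cycles (fst p))) \<in> borel_measurable (N \<Otimes>\<^sub>M lborel)"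
    by (rule measurable_compose[OF measurable_cycles_fst measurable_ship])
  show ?thesis unfolding indicator_def atLeastLessThan_iff by measurable
qed

lemma measurable_coupling_density[measurable]: "coupling_density \<in> borel_measurable (N \<Otimes>\<^sub>M lborel)"
  unfolding coupling_density_def[abs_def] Let_def by measurable

lemma sets_coupled[measurable_cong]: "sets coupled = sets (N \<Otimes>\<^sub>M lborel)"
  by (simp add: coupled_def)

lemma space_coupled: "space coupled = space N \<times> UNIV"
  by (simp add: coupled_def space_pair_measure)

lemma nn_integral_coupling_density:
  assumes \<omega>: "\<omega> \<in> space N" and h[measurable]: "h \<in> borel_measurable borel"
  shows "(\<integral>\<^sup>+s. coupling_density (\<omega>, s) * h s \<partial>lborel) =
    (\<Sum>n. let y = cycles \<omega>; d = int_decode n in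
       ship n y * ((\<integral>\<^sup>+s. indicator {ep d y..<ep d y + dur (y d)} s * h s \<partial>lborel) / ennreal (dur (y d))))"
proof -
  let ?y = "cycles \<omega>"
  let ?I = "\<lambda>n s. indicator {ep (int_decode n) ?y..<ep (int_decode n) ?y + dur (?y (int_decode n))} s :: ennreal"
  have "(\<integral>\<^sup>+s. coupling_density (\<omega>, s) * h s \<partial>lborel) =
      (\<integral>\<^sup>+s. (\<Sum>n. (ship n ?y / ennreal (dur (?y (int_decode n)))) * (?I n s * h s)) \<partial>lborel)"
    unfolding coupling_density_def Let_def fst_conv snd_conv ennreal_suminf_multc[symmetric]
    by (intro nn_integral_cong arg_cong[where f=suminf] ext) (simp add: divide_ennreal_def ac_simps)
  also have "\<dots> = (\<Sum>n. (ship n ?y / ennreal (dur (?y (int_decode n)))) * (\<integral>\<^sup>+s. ?I n s * h s \<partial>lborel))"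
    by (simp add: nn_integral_suminf nn_integral_cmult)
  finally show ?thesis by (simp add: Let_def divide_ennreal_def ac_simps)
qed

lemma nn_integral_coupled:
  assumes h[measurable]: "h \<in> borel_measurable (N \<Otimes>\<^sub>M lborel)"
  shows "(\<integral>\<^sup>+p. h p \<partial>coupled) = (\<integral>\<^sup>+\<omega>. (\<integral>\<^sup>+s. coupling_density (\<omega>, s) * h (\<omega>, s) \<partial>lborel) \<partial>N)"
  unfolding coupled_def
  by (subst nn_integral_density) (auto simp: lborel.nn_integral_fst[symmetric])

text \<open>The uniform densities integrate to 1 on cycles of positive length, so the total is the
  mass shipped by site \<open>0\<close>, which is 1 by the balance of supply.\<close>

lemma coupled_marginal: "AE \<omega> in N. (\<integral>\<^sup>+s. coupling_density (\<omega>, s) \<partial>lborel) = 1"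
  using AE_ship(1) AE_T_finite AE_space
proof eventually_elim
  case (elim \<omega>)
  let ?y = "cycles \<omega>"
  have "(\<integral>\<^sup>+s. coupling_density (\<omega>, s) \<partial>lborel) = (\<integral>\<^sup>+s. coupling_density (\<omega>, s) * 1 \<partial>lborel)" by simp
  also have "\<dots> = (\<Sum>n. ship n ?y * (ennreal (dur (?y (int_decode n))) / ennreal (dur (?y (int_decode n)))))"
    by (subst nn_integral_coupling_density[OF elim(3)]) (simp_all add: Let_def emeasure_lborel_Ico)
  also have "\<dots> = (\<Sum>n. ship n ?y)"
  proof (intro arg_cong[where f=suminf] ext)
    fix n
    show "ship n ?y * (ennreal (dur (?y (int_decode n))) / ennreal (dur (?y (int_decode n)))) = ship n ?y"
    proof (cases "dur (?y (int_decode n)) = 0")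
      case True
      then have "T (int_decode n) \<omega> = 0" using elim(2)[rule_format, of "int_decode n"]
        by (auto simp: dur_def enn2real_eq_0_iff)
      then have "ship n ?y = 0" using ship_le[of n ?y] by simp
      then show ?thesis by simp
    next
      case False
      then have "0 < dur (?y (int_decode n))" using dur_nonneg[of "?y (int_decode n)"] by (simp del: dur_nonneg)
      then show ?thesis by (simp add: ennreal_divide_self)
    qed
  qed
  finally show ?case using elim(1) by simp
qed

text \<open>The first marginal of \<open>coupled\<close> is \<open>N\<close>. Hence almost sure
  facts about the cycles persist on the extension.\<close>

lemma emeasure_coupled_Times:
  assumes A[measurable]: "A \<in> sets N"
  shows "emeasure coupled (A \<times> UNIV) = emeasure N A"
proof -
  have AU: "A \<times> UNIV \<in> sets (N \<Otimes>\<^sub>M lborel)" using pair_measureI[OF A, of UNIV lborel] by simp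
  have "emeasure coupled (A \<times> UNIV) = (\<integral>\<^sup>+p. indicator (A \<times> UNIV) p \<partial>coupled)"
    using AU by (simp add: sets_coupled)
  also have "\<dots> = (\<integral>\<^sup>+\<omega>. (\<integral>\<^sup>+s. coupling_density (\<omega>, s) * indicator (A \<times> UNIV) (\<omega>, s) \<partial>lborel) \<partial>N)"
    by (rule nn_integral_coupled) (use AU in simp)
  also have "\<dots> = (\<integral>\<^sup>+\<omega>. indicator A \<omega> \<partial>N)"
  proof (rule nn_integral_cong_AE)
    show "AE \<omega> in N. (\<integral>\<^sup>+s. coupling_density (\<omega>, s) * indicator (A \<times> UNIV) (\<omega>, s) \<partial>lborel) = indicator A \<omega>"
      using coupled_marginal by eventually_elim (simp add: indicator_def)
  qed
  finally show ?thesis by simp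
qed

lemma prob_space_coupled: "prob_space coupled"
  by (rule prob_spaceI) (simp add: space_coupled emeasure_coupled_Times emeasure_space_1)

lemma AE_coupled:
  assumes "AE \<omega> in N. P \<omega>"
  shows "AE p in coupled. P (fst p)"
proof -
  obtain E where E: "E \<in> sets N" "emeasure N E = 0" "{\<omega> \<in> space N. \<not> P \<omega>} \<subseteq> E"
    using assms by (auto elim!: AE_E)
  have "E \<times> UNIV \<in> null_sets coupled"
    using pair_measureI[OF E(1), of UNIV lborel] E by (auto simp: null_sets_def emeasure_coupled_Times sets_coupled)
  then show ?thesis by (rule AE_I') (use E(3) in \<open>auto simp: space_coupled\<close>)
qed

text \<open>Mass transport again: instead of averaging over the cycles to which site
  \<open>0\<close> ships, one averages over the sites that ship to cycle \<open>0\<close>. Their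
  masses add up to \<open>rate\<close> times the length of cycle \<open>0\<close>, and this length
  cancels the denominator of the mean \<open>V\<close> of \<open>H\<close> over the cycle.\<close>

lemma nn_integral_coupled_stat_law:
  assumes H: "covariant H"
  shows "(\<integral>\<^sup>+p. H (cycles (fst p)) (snd p) \<partial>coupled) = (\<integral>\<^sup>+p. H (cycles (fst p)) (snd p) \<partial>stat_law)"
proof -
  define V where "V y = window H y 0 (dur (y 0)) / ennreal (dur (y 0))" for y
  have [measurable]: "(\<lambda>y. window H y 0 (dur (y 0))) \<in> borel_measurable cycles_law"
    by (rule measurable_window[OF H]) measurable
  have V[measurable]: "V \<in> borel_measurable cycles_law" unfolding V_def by measurable
  have Hm: "(\<lambda>p. H (cycles (fst p)) (snd p)) \<in> borel_measurable (N \<Otimes>\<^sub>M lborel)"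
    by (rule covariant_measurable[OF H]) measurable
  have sh[measurable]: "shift_seq d \<in> cycles_law \<rightarrow>\<^sub>M cycles_law" for d by (rule cyc.measurable_shift)
  let ?d = int_decode
  have "(\<integral>\<^sup>+p. H (cycles (fst p)) (snd p) \<partial>coupled)
     = (\<integral>\<^sup>+\<omega>. (\<integral>\<^sup>+s. coupling_density (\<omega>, s) * H (cycles \<omega>) s \<partial>lborel) \<partial>N)"
    unfolding nn_integral_coupled[OF Hm] by simp
  also have "\<dots> = (\<integral>\<^sup>+\<omega>. (\<Sum>n. ship n (cycles \<omega>) * V (shift_seq (?d n) (cycles \<omega>))) \<partial>N)"
  proof (rule nn_integral_cong_AE)
    show "AE \<omega> in N. (\<integral>\<^sup>+s. coupling_density (\<omega>, s) * H (cycles \<omega>) s \<partial>lborel) =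
        (\<Sum>n. ship n (cycles \<omega>) * V (shift_seq (?d n) (cycles \<omega>)))"
      using AE_glues AE_space
    proof eventually_elim
      case (elim \<omega>)
      note y = cycles_in_space[OF elim(2)]
      have "V (shift_seq d (cycles \<omega>)) = window H (cycles \<omega>) (ep d (cycles \<omega>)) (ep d (cycles \<omega>) + dur (cycles \<omega> d)) / ennreal (dur (cycles \<omega> d))" for d
        unfolding V_def window_shift[OF H elim(1) y] by (simp add: shift_seq_def)
      then show ?case
        by (subst nn_integral_coupling_density[OF elim(2) measurable_H_time[OF H y]]) (simp add: Let_def window_def)
    qed
  qed
  also have "\<dots> = (\<Sum>n. \<integral>\<^sup>+\<omega>. ship n (cycles \<omega>) * V (shift_seq (?d n) (cycles \<omega>)) \<partial>N)"
    by (rule nn_integral_suminf) measurable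
  \<comment> \<open>Shifting the \<open>n\<close>-th term by \<open>- ?d n\<close> puts the
    receiving cycle at index \<open>0\<close>, so that \<open>V\<close> no longer depends on
    \<open>n\<close>.\<close>
  also have "\<dots> = (\<Sum>n. \<integral>\<^sup>+\<omega>. ship n (shift_seq (- ?d n) (cycles \<omega>)) * V (cycles \<omega>) \<partial>N)"
  proof (intro arg_cong[where f=suminf] ext)
    fix n
    let ?g = "\<lambda>y. ship n y * V (shift_seq (?d n) y)"
    have "(\<integral>\<^sup>+\<omega>. ?g (shift_seq (- ?d n) (cycles \<omega>)) \<partial>N) = (\<integral>\<^sup>+\<omega>. ?g (cycles \<omega>) \<partial>N)"
      by (rule nn_integral_cycles_shift) measurable
    moreover have "shift_seq (?d n) (shift_seq (- ?d n) y) = y" for y :: "int \<Rightarrow> ennreal \<times> (real \<Rightarrow> real)"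
      by (simp add: shift_seq_def)
    ultimately show "(\<integral>\<^sup>+\<omega>. ?g (cycles \<omega>) \<partial>N) = (\<integral>\<^sup>+\<omega>. ship n (shift_seq (- ?d n) (cycles \<omega>)) * V (cycles \<omega>) \<partial>N)"
      by simp
  qed
  also have "\<dots> = (\<integral>\<^sup>+\<omega>. (\<Sum>n. ship n (shift_seq (- ?d n) (cycles \<omega>)) * V (cycles \<omega>)) \<partial>N)"
    by (rule nn_integral_suminf[symmetric]) measurable
  also have "\<dots> = (\<integral>\<^sup>+\<omega>. ennreal rate * window H (cycles \<omega>) 0 (dur (cycles \<omega> 0)) \<partial>N)"
  proof (rule nn_integral_cong_AE)
    show "AE \<omega> in N. (\<Sum>n. ship n (shift_seq (- ?d n) (cycles \<omega>)) * V (cycles \<omega>)) =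
        ennreal rate * window H (cycles \<omega>) 0 (dur (cycles \<omega> 0))"
      using AE_ship(2) nn_integral_T_dur[of 0]
    proof eventually_elim
      case (elim \<omega>)
      let ?c = "dur (cycles \<omega> 0)" and ?w = "window H (cycles \<omega>) 0 (dur (cycles \<omega> 0))"
      have "(\<Sum>n. ship n (shift_seq (- ?d n) (cycles \<omega>)) * V (cycles \<omega>)) = ennreal rate * (ennreal ?c * (?w / ennreal ?c))"
        unfolding ennreal_suminf_multc elim(1) by (simp add: V_def demand_def elim(2) mult.assoc)
      also have "ennreal ?c * (?w / ennreal ?c) = ?w"
      proof (cases "?c = 0")
        case True
        then show ?thesis by (simp add: window_def)
      next
        case False
        then have "0 < ?c" using dur_nonneg[of "cycles \<omega> 0"] by (simp del: dur_nonneg)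
        then show ?thesis by (simp add: ennreal_times_divide mult.commute[of "ennreal ?c"] mult_divide_eq_ennreal)
      qed
      finally show ?case .
    qed
  qed
  also have "\<dots> = ennreal rate * (\<integral>\<^sup>+\<omega>. window H (cycles \<omega>) 0 (dur (cycles \<omega> 0)) \<partial>N)"
    by (rule nn_integral_cmult) measurable
  also have "\<dots> = (\<integral>\<^sup>+p. H (cycles (fst p)) (snd p) \<partial>stat_law)"
    unfolding nn_integral_stat_law[OF Hm] by (simp add: window_def)
  finally show ?thesis .
qed

lemma integral_incr_expo_coupled:
  assumes a: "mono a"
  shows "(\<integral>p. incr_expo a l n (glued (cycles (fst p))) (snd p) \<partial>coupled) =
    complex_of_real (exp (- incr_variance a l n / 2))"
proof -
  let ?f = "\<lambda>p. incr_expo a l n (glued (cycles (fst p))) (snd p)"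
  have "?f \<in> borel_measurable (N \<Otimes>\<^sub>M lborel)" by (rule measurable_incr_expo) auto
  then have f: "?f \<in> borel_measurable coupled" "?f \<in> borel_measurable stat_law"
    by (simp_all add: measurable_cong_sets[OF sets_stat_law refl] measurable_cong_sets[OF sets_coupled refl])
  have "distr coupled borel ?f = distr stat_law borel ?f"
    by (rule distr_eq_of_nn_integral[OF f]) (rule nn_integral_coupled_stat_law[OF covariant_incr_expo])
  then have "(\<integral>z. z \<partial>distr coupled borel ?f) = (\<integral>z. z \<partial>distr stat_law borel ?f)" by simp
  then show ?thesis using f integral_incr_expo[OF a, of l n] by (simp add: integral_distr)
qed

end

section \<open>Extension of the probability space\<close>

lemma (in complete_measure) measurable_cong_AE:
  assumes f: "f \<in> M \<rightarrow>\<^sub>M K" and g: "g \<in> space M \<rightarrow> space K" and eq: "AE x in M. f x = g x"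
  shows "g \<in> M \<rightarrow>\<^sub>M K"
proof (rule measurableI)
  fix A assume "A \<in> sets K"
  then have A: "f -` A \<inter> space M \<in> sets M" by (rule measurable_sets[OF f])
  have "AE x in M. x \<in> f -` A \<inter> space M \<longleftrightarrow> x \<in> g -` A \<inter> space M"
    using eq by eventually_elim auto
  then show "g -` A \<inter> space M \<in> sets M" by (rule in_sets_AE[OF _ A]) simp
next
  show "g x \<in> space K" if "x \<in> space M" for x using g that by blast
qed

text \<open>
  The image of a measure with the largest possible \<open>\<sigma>\<close>-algebra. On it, measurability and almost
  sure properties can be checked before mapping, even for non-measurable sets such as the set of
  continuous paths.
\<close>

definition final_distr :: "'a measure \<Rightarrow> 'b set \<Rightarrow> ('a \<Rightarrow> 'b) \<Rightarrow> 'b measure" where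
  "final_distr M \<Omega> q = distr M (sigma \<Omega> {A. A \<subseteq> \<Omega> \<and> q -` A \<inter> space M \<in> sets M}) q"

lemma space_final_distr [simp]: "space (final_distr M \<Omega> q) = \<Omega>"
  unfolding final_distr_def by (auto simp: space_measure_of_conv)

lemma sets_final_distrI: "A \<subseteq> \<Omega> \<Longrightarrow> q -` A \<inter> space M \<in> sets M \<Longrightarrow> A \<in> sets (final_distr M \<Omega> q)"
  unfolding final_distr_def by (auto intro!: sigma_sets.Basic simp: sets_measure_of_conv)

lemma measurable_to_final:
  assumes "q \<in> space M \<rightarrow> \<Omega>"
  shows "q \<in> M \<rightarrow>\<^sub>M sigma \<Omega> {A. A \<subseteq> \<Omega> \<and> q -` A \<inter> space M \<in> sets M}"
  by (rule measurable_measure_of) (use assms in auto)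

lemma measurable_final_distr:
  assumes "q \<in> space M \<rightarrow> \<Omega>" "(\<lambda>x. g (q x)) \<in> M \<rightarrow>\<^sub>M K" "g \<in> \<Omega> \<rightarrow> space K"
  shows "g \<in> final_distr M \<Omega> q \<rightarrow>\<^sub>M K"
proof (rule measurableI)
  fix A assume "A \<in> sets K"
  then have "(\<lambda>x. g (q x)) -` A \<inter> space M \<in> sets M" by (rule measurable_sets[OF assms(2)])
  moreover have "(\<lambda>x. g (q x)) -` A \<inter> space M = q -` (g -` A \<inter> \<Omega>) \<inter> space M"
    using assms(1) by auto
  ultimately show "g -` A \<inter> space (final_distr M \<Omega> q) \<in> sets (final_distr M \<Omega> q)"
    by (intro sets_final_distrI) auto
next
  show "g z \<in> space K" if "z \<in> space (final_distr M \<Omega> q)" for z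
    using assms(3) that by auto
qed

lemma integral_final_distr:
  fixes g :: "'b \<Rightarrow> 'c :: {banach, second_countable_topology}"
  assumes q: "q \<in> space M \<rightarrow> \<Omega>" and g: "g \<in> borel_measurable (final_distr M \<Omega> q)"
  shows "(\<integral>z. g z \<partial>final_distr M \<Omega> q) = (\<integral>x. g (q x) \<partial>M)"
  using g unfolding final_distr_def
  by (intro integral_distr measurable_to_final[OF q]) simp

lemma distr_final_distr:
  assumes q: "q \<in> space M \<rightarrow> \<Omega>" and g: "g \<in> final_distr M \<Omega> q \<rightarrow>\<^sub>M K"
  shows "distr (final_distr M \<Omega> q) K g = distr M K (\<lambda>x. g (q x))"
  using g unfolding final_distr_def
  by (subst distr_distr[OF _ measurable_to_final[OF q]]) (simp_all add: comp_def)

text \<open>Completeness makes the exceptional set measurable upstairs, and the maximal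
  sigma-algebra then contains its image set, whatever the form of \<open>P\<close>.\<close>

lemma AE_final_distr:
  assumes M: "complete_measure M" and q: "q \<in> space M \<rightarrow> \<Omega>" and P: "AE x in M. P (q x)"
  shows "AE z in final_distr M \<Omega> q. P z"
proof -
  interpret complete_measure M by fact
  let ?E = "{z \<in> \<Omega>. \<not> P z}"
  have "q -` ?E \<inter> space M = {x \<in> space M. \<not> P (q x)}" using q by auto
  then have n: "q -` ?E \<inter> space M \<in> null_sets M" using P by (simp add: AE_iff_null_sets)
  then have E: "?E \<in> sets (final_distr M \<Omega> q)" by (intro sets_final_distrI) auto
  have "emeasure (final_distr M \<Omega> q) ?E = emeasure M (q -` ?E \<inter> space M)"
    using E unfolding final_distr_def by (intro emeasure_distr measurable_to_final[OF q]) simp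
  then have "?E \<in> null_sets (final_distr M \<Omega> q)" using n E by (auto simp: null_sets_def)
  then show ?thesis by (rule AE_I') auto
qed

lemma (in prob_space) prob_space_completion: "prob_space (completion M)"
  by (rule prob_spaceI) (simp add: emeasure_space_1)

theorem theorem5p1:
  fixes M :: "'a measure" and X :: "real \<Rightarrow> 'a \<Rightarrow> real"
    and N :: "'b measure" and p :: "'b \<Rightarrow> 'a"
    and T :: "int \<Rightarrow> 'b \<Rightarrow> ennreal" and B :: "int \<Rightarrow> real \<Rightarrow> 'b \<Rightarrow> real"
  assumes "strongly_decomposable M X N p T B"
    and "\<And>k. (\<integral>\<^sup>+ \<omega>. T k \<omega> \<partial>N) < \<infinity>"
  shows "two_sided_brownian_motion M X"
proof -
  have ext: "prob_extension M N p" and XM: "\<And>t. X t \<in> borel_measurable M"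
    and fam: "decomposition_family N T B"
    using assms(1) unfolding strongly_decomposable_def by auto
  obtain U where U[measurable]: "U \<in> borel_measurable N"
    and con: "concatenation N T B (\<lambda>t \<omega>. X (U \<omega> + t) (p \<omega>) - X (U \<omega>) (p \<omega>))"
    using assms(1) unfolding strongly_decomposable_def by auto
  have p: "p \<in> N \<rightarrow>\<^sub>M M" and dp: "distr N M p = M" and "prob_space M" and "prob_space N"
    using ext unfolding prob_extension_def by auto
  define W where "W t \<omega> = X (U \<omega> + t) (p \<omega>) - X (U \<omega>) (p \<omega>)" for t \<omega>
  interpret N: prob_space N by fact
  interpret finite_mean_decomposition N T B W
    using fam con assms(2)[of 0] unfolding W_def by unfold_locales
  \<comment> \<open>Completion is used because \<open>Z t (q z)\<close> will be identified with a
    measurable function only almost everywhere.\<close>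
  define N' where "N' = completion coupled"
  interpret coup: prob_space coupled by (rule prob_space_coupled)
  interpret N': prob_space N' unfolding N'_def by (rule coup.prob_space_completion)
  interpret N': complete_measure N' unfolding N'_def by (rule completion.complete_measure_axioms)
  have spN': "space N' = space N \<times> UNIV" by (simp add: N'_def space_coupled)
  have toN': "f \<in> N' \<rightarrow>\<^sub>M K" if "f \<in> N \<Otimes>\<^sub>M lborel \<rightarrow>\<^sub>M K" for f and K :: "'c measure"
    unfolding N'_def using that by (intro measurable_completion) (simp add: measurable_cong_sets[OF sets_coupled refl])
  define \<Omega> where "\<Omega> = space M \<times> (UNIV :: real set)"
  \<comment> \<open>The second coordinate of \<open>coupled\<close> is a time relative to
    \<open>U\<close>. Adding \<open>U\<close> makes it a time of \<open>X\<close>, and after mapping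
    it is the random time sought.\<close>
  define q where "q z = (p (fst z), U (fst z) + snd z)" for z :: "'b \<times> real"
  have q: "q \<in> space N' \<rightarrow> \<Omega>"
    using measurable_space[OF p] by (auto simp: spN' q_def \<Omega>_def)
  define Q where "Q = final_distr N' \<Omega> q"
  define Z where "Z t z = X (snd z + t) (fst z) - X (snd z) (fst z)" for t and z :: "'a \<times> real"
  have Q: "prob_space Q"
    unfolding Q_def final_distr_def by (intro N'.prob_space_distr measurable_to_final q)
  have glN': "AE z in N'. glues (cycles (fst z)) (\<lambda>s. W s (fst z))"
    unfolding N'_def by (intro AE_completion AE_coupled AE_glues)
  have Zq: "Z t (q z) = W (snd z + t) (fst z) - W (snd z) (fst z)" for t z
    by (simp add: Z_def q_def W_def add.assoc)
  have Z_eq: "AE z in N'. \<forall>t. glued (cycles (fst z)) (snd z + t) - glued (cycles (fst z)) (snd z + 0) = Z t (q z)"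
    using glN' by eventually_elim (simp add: Zq glued_eq)
  have glm: "(\<lambda>z. glued (cycles (fst z)) (snd z + t)) \<in> borel_measurable (N \<Otimes>\<^sub>M lborel)" for t
    by (rule measurable_glued[OF measurable_compose[OF measurable_fst measurable_cycles]]) measurable
  \<comment> \<open>Evaluating \<open>X\<close> at a random time need not be measurable for a
    process that is only measurable at each fixed time. The path \<open>glued\<close> built from the
    cycles is jointly measurable and agrees with it almost surely.\<close>
  have Zqm: "(\<lambda>z. Z t (q z)) \<in> borel_measurable N'" for t
  proof (rule N'.measurable_cong_AE)
    show "(\<lambda>z. glued (cycles (fst z)) (snd z + t) - glued (cycles (fst z)) (snd z + 0)) \<in> borel_measurable N'"
      by (rule toN') (rule borel_measurable_diff[OF glm glm])
    show "AE z in N'. glued (cycles (fst z)) (snd z + t) - glued (cycles (fst z)) (snd z + 0) = Z t (q z)"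
      using Z_eq by eventually_elim blast
  qed simp
  have Zm: "Z t \<in> borel_measurable Q" for t
    unfolding Q_def by (rule measurable_final_distr[OF q Zqm]) simp
  have gauss: "gaussian_increments Q Z"
    unfolding gaussian_increments_def
  proof (intro allI impI)
    fix a l :: "nat \<Rightarrow> real" and n assume a: "mono a"
    let ?F = "\<lambda>z. iexp (\<Sum>j<n. l j * (Z (a (Suc j)) z - Z (a j) z))"
    let ?G = "\<lambda>z. incr_expo a l n (glued (cycles (fst z))) (snd z)"
    have Fm: "?F \<in> borel_measurable Q" using Zm by measurable
    have Fqm: "(\<lambda>z. ?F (q z)) \<in> borel_measurable N'" using Zqm by measurable
    have Gm: "?G \<in> borel_measurable (N \<Otimes>\<^sub>M lborel)" by (rule measurable_incr_expo) auto
    have "(\<integral>z. ?F z \<partial>Q) = (\<integral>z. ?F (q z) \<partial>N')"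
      unfolding Q_def by (rule integral_final_distr[OF q Fm[unfolded Q_def]])
    also have "\<dots> = (\<integral>z. ?G z \<partial>N')"
    proof (rule integral_cong_AE[OF Fqm toN'[OF Gm]])
      show "AE z in N'. ?F (q z) = ?G z"
        using Z_eq
      proof eventually_elim
        case (elim z)
        have "Z t (q z) - Z s (q z) = glued (cycles (fst z)) (snd z + t) - glued (cycles (fst z)) (snd z + s)" for s t
          using elim[rule_format, of s] elim[rule_format, of t] by linarith
        then show ?case unfolding incr_expo_def by simp
      qed
    qed
    also have "\<dots> = (\<integral>z. ?G z \<partial>coupled)"
      unfolding N'_def using Gm
      by (intro integral_completion) (simp add: measurable_cong_sets[OF sets_coupled refl])
    also have "\<dots> = complex_of_real (exp (- incr_variance a l n / 2))"
      by (rule integral_incr_expo_coupled[OF a])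
    finally show "(\<integral>z. ?F z \<partial>Q) = complex_of_real (exp (- incr_variance a l n / 2))" .
  qed
  have Z0: "Z 0 z = 0" for z by (simp add: Z_def)
  have cont: "AE z in Q. continuous_on UNIV (\<lambda>t. Z t z)"
    unfolding Q_def
  proof (rule AE_final_distr[OF N'.complete_measure_axioms q])
    show "AE z in N'. continuous_on UNIV (\<lambda>t. Z t (q z))"
      using glN'
    proof eventually_elim
      case (elim z)
      then have W: "continuous_on UNIV (\<lambda>s. W s (fst z))" by (simp add: glues_def)
      have "continuous_on UNIV (\<lambda>t. W (snd z + t) (fst z))"
        by (rule continuous_on_compose2[OF W]) (auto intro!: continuous_intros)
      then show ?case unfolding Zq by (intro continuous_on_diff continuous_on_const)
    qed
  qed
  interpret Q: prob_space Q by (rule Q)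
  have fst_q: "(\<lambda>z. fst (q z)) \<in> N' \<rightarrow>\<^sub>M M"
    unfolding q_def fst_conv by (rule toN') (rule measurable_compose[OF measurable_fst p])
  have fst_Q: "fst \<in> Q \<rightarrow>\<^sub>M M"
    unfolding Q_def by (rule measurable_final_distr[OF q fst_q]) (auto simp: \<Omega>_def)
  have snd_Q: "snd \<in> borel_measurable Q"
    unfolding Q_def
  proof (rule measurable_final_distr[OF q])
    show "(\<lambda>z. snd (q z)) \<in> borel_measurable N'"
      unfolding q_def snd_conv by (rule toN') measurable
  qed simp
  have "distr Q M fst = M"
  proof (rule measure_eqI)
    fix A assume "A \<in> sets (distr Q M fst)"
    then have A: "A \<in> sets M" by simp
    have pA: "p -` A \<inter> space N \<in> sets N" by (rule measurable_sets[OF p A])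
    have "distr Q M fst = distr N' M (\<lambda>z. fst (q z))"
      unfolding Q_def by (rule distr_final_distr[OF q fst_Q[unfolded Q_def]])
    then have "emeasure (distr Q M fst) A = emeasure N' ((\<lambda>z. fst (q z)) -` A \<inter> space N')"
      using A fst_q by (simp add: emeasure_distr)
    also have "(\<lambda>z. fst (q z)) -` A \<inter> space N' = (p -` A \<inter> space N) \<times> UNIV"
      by (auto simp: q_def spN')
    also have "emeasure N' \<dots> = emeasure coupled ((p -` A \<inter> space N) \<times> UNIV)"
    proof -
      have "(p -` A \<inter> space N) \<times> UNIV \<in> sets coupled"
        unfolding sets_coupled by (rule pair_measureI[OF pA]) simp
      then show ?thesis unfolding N'_def by simp
    qed
    also have "\<dots> = emeasure (distr N M p) A"
      using p A pA by (simp add: emeasure_coupled_Times emeasure_distr)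
    finally show "emeasure (distr Q M fst) A = emeasure M A" unfolding dp .
  qed simp
  then have extQ: "prob_extension M Q fst"
    using \<open>prob_space M\<close> Q fst_Q unfolding prob_extension_def by blast
  have R: "standard_brownian_motion Q Z"
    by (rule Q.standard_brownian_motion_of_gaussian_increments[OF Zm gauss Z0])
       (use cont in eventually_elim, auto intro: continuous_on_subset)
  have L: "standard_brownian_motion Q (\<lambda>t. Z (- t))"
  proof (rule Q.standard_brownian_motion_of_gaussian_increments[OF Zm gaussian_increments_reverse[OF gauss]])
    show "AE z in Q. continuous_on {0..} (\<lambda>t. Z (- t) z)"
      using cont
      by eventually_elim (rule continuous_on_compose2, auto intro!: continuous_intros)
  qed (simp add: Z0)
  have RL: "Q.indep_var (\<Pi>\<^sub>M t\<in>{0..}. borel) (\<lambda>z. \<lambda>t\<in>{0..}. Z t z) (\<Pi>\<^sub>M t\<in>{0..}. borel) (\<lambda>z. \<lambda>t\<in>{0..}. Z (- t) z)"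
    by (rule Q.gaussian_increments_indep_halves[OF Zm gauss Z0])
  have "let R = (\<lambda>t \<omega>. X (snd \<omega> + t) (fst \<omega>) - X (snd \<omega>) (fst \<omega>));
             L = (\<lambda>t \<omega>. X (snd \<omega> - t) (fst \<omega>) - X (snd \<omega>) (fst \<omega>))
         in standard_brownian_motion Q R \<and> standard_brownian_motion Q L \<and>
            prob_space.indep_var Q
              (\<Pi>\<^sub>M t\<in>{0..}. borel) (\<lambda>\<omega>. \<lambda>t\<in>{0..}. R t \<omega>)
              (\<Pi>\<^sub>M t\<in>{0..}. borel) (\<lambda>\<omega>. \<lambda>t\<in>{0..}. L t \<omega>)"
    using R L RL unfolding Let_def Z_def[abs_def] by simp
  then show ?thesis
    unfolding two_sided_brownian_motion_def using XM extQ snd_Q by blast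
qed

end
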